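(* Let $q\in\mathbb{C}$ be nonzero and not a root of unity, and let $\widetilde{\mathcal L}=\widetilde{\mathfrak{sl}_2(\mathbb{C}_q)}$ be the extended affine Lie algebra over $\mathbb{C}$ with Lie bracket $[\cdot,\cdot]$. Then every Lie bialgebra structure on $\widetilde{\mathcal L}$ is triangular coboundary; that is, for every linear map $\Delta:\widetilde{\mathcal L}\to\widetilde{\mathcal L}\otimes\widetilde{\mathcal L}$ such that $(\widetilde{\mathcal L},[\cdot,\cdot],\Delta)$ is a Lie bialgebra, there exists $r\in\operatorname{Im}(1-\tau)\subset\widetilde{\mathcal L}\otimes\widetilde{\mathcal L}$ such that $\Delta(x)=x\cdot r$ for all $x\in\widetilde{\mathcal L}$ and $c(r)=0$.
   Context: All vector spaces and tensor products are over $\mathbb{C}$. **The Lie algebra.** Let $\mathbb{C}_q$ be the associative $\mathbb{C}$-algebra with generators $x^{\pm1},y^{\pm1}$ and relations $xx^{-1}=x^{-1}x=1$, $yy^{-1}=y^{-1}y=1$, $yx=qxy$ (it has basis $x^{m_1}y^{m_2}$, $(m_1,m_2)\in\mathbb{Z}^2$). Let $E_{ij}$ ($i,j\in\{1,2\}$) be the $2\times2$ matrix units. Let $\mathcal L=\mathfrak{sl}_2(\mathbb{C}_q)$ be the Lie algebra, under the commutator bracket of $M_2(\mathbb{C}_q)$, with basis $e_{\mathbf m}=E_{12}x^{m_1}y^{m_2}$, $f_{\mathbf m}=E_{21}x^{m_1}y^{m_2}$ for $\mathbf m=(m_1,m_2)\in\mathbb{Z}^2$, $d=E_{11}-E_{22}$,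 and $g_{\mathbf k}=E_{11}x^{k_1}y^{k_2}$, $h_{\mathbf k}=E_{22}x^{k_1}y^{k_2}$ for $\mathbf k=(k_1,k_2)\in\mathbb{Z}^2\setminus\{(0,0)\}$. It is $\mathbb{Z}^2$-graded, with $e_{\mathbf m},f_{\mathbf m},g_{\mathbf m},h_{\mathbf m}$ of degree $\mathbf m$ and $d$ of degree $(0,0)$. Then $\widetilde{\mathcal L}=\mathcal L\oplus\mathbb{C}d_1\oplus\mathbb{C}d_2$, where $[d_i,z]=m_iz$ for $z\in\mathcal L$ homogeneous of degree $(m_1,m_2)$, $i=1,2$, and $[d_1,d_2]=0$. **Lie bialgebras.** For a Lie algebra $S$, let $\tau(a\otimes b)=b\otimes a$ on $S\otimes S$ and $\xi(a\otimes b\otimes c)=b\otimes c\otimes a$ on $S^{\otimes3}$; $S$ acts on $S\otimes S$ by the diagonal adjoint action $x\cdot(a\otimes b)=[x,a]\otimes b+a\otimes[x,b]$. $(S,[\cdot,\cdot],\Delta)$, with $\Delta:S\to S\otimes S$ linear, is a Lie bialgebra if $S$ is a Lie algebra, $\operatorname{Im}\Delta\subset\operatorname{Im}(1-\tau)$, $(1+\xi+\xi^2)\circ(1\otimes\Delta)\circ\Delta=0$, and $\Delta([x,y])=x\cdot\Delta(y)-y\cdot\Delta(x)$ for all $x,y\in S$. For $r=\sum_i a_i\otimes b_i\in S\otimes S$, put $r^{12}=\sum_i a_i\otimes b_i\otimes1$, $r^{13}=\sum_i a_i\otimes1\otimes b_i$, $r^{23}=\sum_i1\otimes a_i\otimes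 b_i$ in $U(S)^{\otimes3}$ ($U(S)$ the universal enveloping algebra), and $c(r)=[r^{12},r^{13}]+[r^{12},r^{23}]+[r^{13},r^{23}]$, which equals $\sum_{i,j}\big([a_i,a_j]\otimes b_i\otimes b_j+a_i\otimes[b_i,a_j]\otimes b_j+a_i\otimes a_j\otimes[b_i,b_j]\big)\in S^{\otimes 3}$. *)

theory Defs
  imports "HOL-Analysis.Analysis" "HOL-Library.Poly_Mapping"
begin

section \<open>Complex vector spaces with a basis, and their tensor products\<close>

text \<open>
  A complex vector space with basis indexed by the type \<open>'b\<close> is rendered as the type
  \<open>'b \<Rightarrow>\<^sub>0 complex\<close> of finitely supported functions; the basis vector with index \<open>i\<close> is
  \<open>bvec i\<close>. The ring multiplication that the library puts on this type is never used.
\<close>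

definition scl :: "complex \<Rightarrow> ('b \<Rightarrow>\<^sub>0 complex) \<Rightarrow> ('b \<Rightarrow>\<^sub>0 complex)" where
  "scl c p = Poly_Mapping.map ((*) c) p"

definition bvec :: "'b \<Rightarrow> ('b \<Rightarrow>\<^sub>0 complex)" where
  "bvec i = Poly_Mapping.single i 1"

text \<open>The linear map with prescribed values on the basis.\<close>

definition lin_ext :: "('b \<Rightarrow> ('c \<Rightarrow>\<^sub>0 complex)) \<Rightarrow> ('b \<Rightarrow>\<^sub>0 complex) \<Rightarrow> ('c \<Rightarrow>\<^sub>0 complex)" where
  "lin_ext f p = (\<Sum>i\<in>Poly_Mapping.keys p. scl (Poly_Mapping.lookup p i) (f i))"

abbreviation clinear :: "(('b \<Rightarrow>\<^sub>0 complex) \<Rightarrow> ('c \<Rightarrow>\<^sub>0 complex)) \<Rightarrow> bool" where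
  "clinear \<equiv> Vector_Spaces.linear scl scl"

lemma lookup_scl [simp]: "Poly_Mapping.lookup (scl c p) i = c * Poly_Mapping.lookup p i"
  unfolding scl_def by transfer (simp add: when_def)

lemma vector_space_scl: "vector_space (scl :: complex \<Rightarrow> ('b \<Rightarrow>\<^sub>0 complex) \<Rightarrow> _)"
  by unfold_locales (auto intro!: poly_mapping_eqI simp: lookup_add algebra_simps)

lemma clinear_iff:
  "clinear f \<longleftrightarrow> (\<forall>x y. f (x + y) = f x + f y) \<and> (\<forall>c x. f (scl c x) = scl c (f x))"
  by (simp add: Vector_Spaces.linear_iff vector_space_scl)

lemma lin_ext_eq_sum:
  assumes "finite A" "Poly_Mapping.keys p \<subseteq> A"
  shows "lin_ext f p = (\<Sum>i\<in>A. scl (Poly_Mapping.lookup p i) (f i))"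
  unfolding lin_ext_def
  by (rule sum.mono_neutral_left)
     (use assms in \<open>auto simp: in_keys_iff intro!: poly_mapping_eqI\<close>)

lemma clinear_lin_ext: "clinear (lin_ext f)"
  unfolding clinear_iff
proof (intro conjI allI)
  fix x y :: "'a \<Rightarrow>\<^sub>0 complex" and c
  let ?A = "Poly_Mapping.keys x \<union> Poly_Mapping.keys y"
  show "lin_ext f (x + y) = lin_ext f x + lin_ext f y"
    using lin_ext_eq_sum[of ?A x f] lin_ext_eq_sum[of ?A y f]
      lin_ext_eq_sum[of ?A "x + y" f] keys_add[of x y]
    by (auto simp: lookup_add sum.distrib algebra_simps lookup_sum intro!: poly_mapping_eqI)
  have "Poly_Mapping.keys (scl c x) \<subseteq> Poly_Mapping.keys x"
    by (auto simp: in_keys_iff)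
  then show "lin_ext f (scl c x) = scl c (lin_ext f x)"
    using lin_ext_eq_sum[of "Poly_Mapping.keys x" "scl c x" f]
    by (auto simp: lin_ext_def lookup_sum sum_distrib_left algebra_simps intro!: poly_mapping_eqI)
qed

lemma lin_ext_bvec [simp]: "lin_ext f (bvec i) = f i"
  by (rule poly_mapping_eqI) (simp add: lin_ext_def bvec_def)

lemma bvec_expansion: "p = (\<Sum>i\<in>Poly_Mapping.keys p. scl (Poly_Mapping.lookup p i) (bvec i))"
proof (rule poly_mapping_eqI)
  fix j
  have "(\<Sum>i\<in>Poly_Mapping.keys p. Poly_Mapping.lookup p i * Poly_Mapping.lookup (bvec i) j)
      = (\<Sum>i\<in>Poly_Mapping.keys p. if i = j then Poly_Mapping.lookup p j else 0)"
    by (intro sum.cong) (auto simp: bvec_def lookup_single)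
  then show "Poly_Mapping.lookup p j =
      Poly_Mapping.lookup (\<Sum>i\<in>Poly_Mapping.keys p. scl (Poly_Mapping.lookup p i) (bvec i)) j"
    by (simp add: lookup_sum in_keys_iff)
qed

lemma clinear_sum:
  assumes "clinear f" shows "f (sum g A) = (\<Sum>a\<in>A. f (g a))"
proof -
  interpret Vector_Spaces.linear scl scl f by fact
  show ?thesis by (rule sum)
qed

lemma clinear_add: "clinear f \<Longrightarrow> f (x + y) = f x + f y"
  and clinear_scl: "clinear f \<Longrightarrow> f (scl c x) = scl c (f x)"
  by (simp_all add: clinear_iff)

lemma clinear_0: "clinear f \<Longrightarrow> f 0 = 0"
  using clinear_add[of f 0 0] by simp

lemma clinear_diff: "clinear f \<Longrightarrow> f (x - y) = f x - f y"
  using clinear_add[of f "x - y" y] by (simp add: algebra_simps)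

lemma clinear_eqI:
  assumes "clinear f" "clinear g" "\<And>i. f (bvec i) = g (bvec i)"
  shows "f x = g x"
proof -
  let ?s = "\<Sum>i\<in>Poly_Mapping.keys x. scl (Poly_Mapping.lookup x i) (bvec i)"
  have "f ?s = g ?s"
    by (simp add: clinear_sum[OF assms(1)] clinear_sum[OF assms(2)]
        clinear_scl[OF assms(1)] clinear_scl[OF assms(2)] assms(3))
  then show ?thesis unfolding bvec_expansion[of x, symmetric] .
qed

lemma lookup_bvec [simp]: "Poly_Mapping.lookup (bvec i) j = (if i = j then 1 else 0)"
  by (simp add: bvec_def lookup_single when_def)

lemma functional_eqI:
  fixes f g :: "('b \<Rightarrow>\<^sub>0 complex) \<Rightarrow> complex"
  assumes "\<And>x y. f (x + y) = f x + f y" "\<And>c x. f (scl c x) = c * f x"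
    and "\<And>x y. g (x + y) = g x + g y" "\<And>c x. g (scl c x) = c * g x"
    and "\<And>i. f (bvec i) = g (bvec i)"
  shows "f x = g x"
proof -
  have "scl (f x) (bvec ()) = scl (g x) (bvec ())"
    by (rule clinear_eqI[of "\<lambda>x. scl (f x) (bvec ())" "\<lambda>x. scl (g x) (bvec ())"])
       (auto simp: clinear_iff assms lookup_add algebra_simps intro!: poly_mapping_eqI)
  from arg_cong[OF this, of "\<lambda>p. Poly_Mapping.lookup p ()"] show ?thesis by simp
qed

lemma clinear_compose: "clinear f \<Longrightarrow> clinear g \<Longrightarrow> clinear (\<lambda>x. f (g x))"
  by (simp add: clinear_iff)

lemma scl_add: "scl c (x + y) = scl c x + scl c y"
  by (rule poly_mapping_eqI) (simp add: lookup_add algebra_simps)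

lemma scl_scl: "scl c (scl d x) = scl (c * d) x"
  by (rule poly_mapping_eqI) (simp add: algebra_simps)

lemma scl_sum: "scl c (sum g A) = (\<Sum>a\<in>A. scl c (g a))"
  by (rule poly_mapping_eqI) (simp add: lookup_sum sum_distrib_left)

lemma clinear_plus: "clinear f \<Longrightarrow> clinear g \<Longrightarrow> clinear (\<lambda>x. f x + g x)"
  by (simp add: clinear_iff scl_add algebra_simps)

lemma clinear_scale: "clinear f \<Longrightarrow> clinear (\<lambda>x. scl c (f x))"
  by (simp add: clinear_iff scl_add scl_scl mult.commute)

lemma clinear_lin_ext_param:
  assumes "\<And>i. clinear (\<lambda>a. F a i)"
  shows "clinear (\<lambda>a. lin_ext (F a) p)"
  using assms unfolding clinear_iff lin_ext_def
  by (simp add: scl_add scl_sum scl_scl sum.distrib mult.commute)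

text \<open>
  The tensor product of the spaces with bases \<open>'b\<close> and \<open>'c\<close> is the space with basis
  \<open>'b \<times> 'c\<close>. Triple tensor products are nested to the right.
\<close>

definition tens :: "('b \<Rightarrow>\<^sub>0 complex) \<Rightarrow> ('c \<Rightarrow>\<^sub>0 complex) \<Rightarrow> ('b \<times> 'c \<Rightarrow>\<^sub>0 complex)"
    (infixr "\<otimes>\<^sub>t" 72) where
  "a \<otimes>\<^sub>t b = lin_ext (\<lambda>i. lin_ext (\<lambda>j. bvec (i, j)) b) a"

lemma tens_bvec [simp]: "bvec i \<otimes>\<^sub>t bvec j = bvec (i, j)"
  by (simp add: tens_def)

lemma clinear_tens_left: "clinear (\<lambda>a. a \<otimes>\<^sub>t b)"
  unfolding tens_def by (rule clinear_lin_ext)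

lemma clinear_tens_right: "clinear (\<lambda>b. a \<otimes>\<^sub>t b)"
  unfolding tens_def by (intro clinear_lin_ext_param clinear_lin_ext)

definition tens_map :: "(('b \<Rightarrow>\<^sub>0 complex) \<Rightarrow> ('d \<Rightarrow>\<^sub>0 complex)) \<Rightarrow> (('c \<Rightarrow>\<^sub>0 complex) \<Rightarrow> ('e \<Rightarrow>\<^sub>0 complex))
    \<Rightarrow> ('b \<times> 'c \<Rightarrow>\<^sub>0 complex) \<Rightarrow> ('d \<times> 'e \<Rightarrow>\<^sub>0 complex)" where
  "tens_map f g = lin_ext (\<lambda>(i, j). f (bvec i) \<otimes>\<^sub>t g (bvec j))"

text \<open>The flip \<open>\<tau>(a \<otimes> b) = b \<otimes> a\<close> and the rotation \<open>\<xi>(a \<otimes> b \<otimes> c) = b \<otimes> c \<otimes> a\<close>.\<close>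

definition flip :: "('b \<times> 'b \<Rightarrow>\<^sub>0 complex) \<Rightarrow> ('b \<times> 'b \<Rightarrow>\<^sub>0 complex)" where
  "flip = lin_ext (\<lambda>(i, j). bvec (j, i))"

definition rot :: "('b \<times> 'b \<times> 'b \<Rightarrow>\<^sub>0 complex) \<Rightarrow> ('b \<times> 'b \<times> 'b \<Rightarrow>\<^sub>0 complex)" where
  "rot = lin_ext (\<lambda>(i, j, k). bvec (j, k, i))"

lemmas lin_simps = scl_add scl_scl
  clinear_add[OF clinear_lin_ext] clinear_scl[OF clinear_lin_ext]
  clinear_add[OF clinear_tens_left] clinear_scl[OF clinear_tens_left]
  clinear_add[OF clinear_tens_right] clinear_scl[OF clinear_tens_right]

lemma bilinear_eqI:
  assumes "\<And>b. clinear (\<lambda>a. F a b)" "\<And>a. clinear (F a)"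
    and "\<And>b. clinear (\<lambda>a. G a b)" "\<And>a. clinear (G a)"
    and "\<And>i j. F (bvec i) (bvec j) = G (bvec i) (bvec j)"
  shows "F a b = G a b"
proof -
  have "F (bvec i) b = G (bvec i) b" for i
    by (rule clinear_eqI[OF assms(2,4)]) (rule assms(5))
  then show ?thesis
    by (rule clinear_eqI[OF assms(1,3)])
qed

lemma tens_map_tens:
  assumes "clinear f" "clinear g"
  shows "tens_map f g (a \<otimes>\<^sub>t b) = f a \<otimes>\<^sub>t g b"
  by (rule bilinear_eqI[of "\<lambda>a b. tens_map f g (a \<otimes>\<^sub>t b)" "\<lambda>a b. f a \<otimes>\<^sub>t g b"])
     (simp_all add: tens_map_def clinear_iff lin_simps assms[THEN clinear_add] assms[THEN clinear_scl])

lemma flip_tens: "flip (a \<otimes>\<^sub>t b) = b \<otimes>\<^sub>t a"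
  by (rule bilinear_eqI[of "\<lambda>a b. flip (a \<otimes>\<^sub>t b)" "\<lambda>a b. b \<otimes>\<^sub>t a"])
     (simp_all add: flip_def clinear_iff lin_simps)

lemma rot_tens: "rot (a \<otimes>\<^sub>t b \<otimes>\<^sub>t c) = b \<otimes>\<^sub>t c \<otimes>\<^sub>t a"
proof -
  have bv: "rot (bvec i \<otimes>\<^sub>t b \<otimes>\<^sub>t c) = b \<otimes>\<^sub>t c \<otimes>\<^sub>t bvec i" for i
    by (rule bilinear_eqI[of "\<lambda>b c. rot (bvec i \<otimes>\<^sub>t b \<otimes>\<^sub>t c)" "\<lambda>b c. b \<otimes>\<^sub>t c \<otimes>\<^sub>t bvec i"])
       (simp_all add: rot_def clinear_iff lin_simps)
  show ?thesis
    by (rule clinear_eqI[of "\<lambda>a. rot (a \<otimes>\<^sub>t b \<otimes>\<^sub>t c)" "\<lambda>a. b \<otimes>\<^sub>t c \<otimes>\<^sub>t a"])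
       (rule bv | simp add: rot_def clinear_iff lin_simps)+
qed


section \<open>Lie algebras and Lie bialgebras\<close>

definition lie_algebra :: "(('b \<Rightarrow>\<^sub>0 complex) \<Rightarrow> ('b \<Rightarrow>\<^sub>0 complex) \<Rightarrow> ('b \<Rightarrow>\<^sub>0 complex)) \<Rightarrow> bool" where
  "lie_algebra br \<longleftrightarrow>
     (\<forall>x. clinear (br x)) \<and> (\<forall>y. clinear (\<lambda>x. br x y)) \<and>
     (\<forall>x. br x x = 0) \<and>
     (\<forall>x y z. br x (br y z) + br y (br z x) + br z (br x y) = 0)"

definition adj_act :: "(('b \<Rightarrow>\<^sub>0 complex) \<Rightarrow> ('b \<Rightarrow>\<^sub>0 complex) \<Rightarrow> ('b \<Rightarrow>\<^sub>0 complex))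
    \<Rightarrow> ('b \<Rightarrow>\<^sub>0 complex) \<Rightarrow> ('b \<times> 'b \<Rightarrow>\<^sub>0 complex) \<Rightarrow> ('b \<times> 'b \<Rightarrow>\<^sub>0 complex)" where
  "adj_act br x = lin_ext (\<lambda>(i, j). br x (bvec i) \<otimes>\<^sub>t bvec j + bvec i \<otimes>\<^sub>t br x (bvec j))"

definition lie_bialgebra :: "(('b \<Rightarrow>\<^sub>0 complex) \<Rightarrow> ('b \<Rightarrow>\<^sub>0 complex) \<Rightarrow> ('b \<Rightarrow>\<^sub>0 complex))
    \<Rightarrow> (('b \<Rightarrow>\<^sub>0 complex) \<Rightarrow> ('b \<times> 'b \<Rightarrow>\<^sub>0 complex)) \<Rightarrow> bool" where
  "lie_bialgebra br \<Delta> \<longleftrightarrow>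
     lie_algebra br \<and> clinear \<Delta> \<and>
     range \<Delta> \<subseteq> range (\<lambda>t. t - flip t) \<and>
     (\<forall>x. let u = tens_map id \<Delta> (\<Delta> x) in u + rot u + rot (rot u) = 0) \<and>
     (\<forall>x y. \<Delta> (br x y) = adj_act br x (\<Delta> y) - adj_act br y (\<Delta> x))"

text \<open>
  The element \<open>c(r) = [r\<^sup>1\<^sup>2, r\<^sup>1\<^sup>3] + [r\<^sup>1\<^sup>2, r\<^sup>2\<^sup>3] + [r\<^sup>1\<^sup>3, r\<^sup>2\<^sup>3]\<close>, computed in \<open>S \<otimes> S \<otimes> S\<close>.
  The definition uses the expansion of \<open>r\<close> in basis tensors; \<open>cyb_sum_tens\<close> below gives
  its value for an arbitrary expression \<open>r = \<Sum>\<^sub>i a\<^sub>i \<otimes> b\<^sub>i\<close>.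
\<close>

definition cyb :: "(('b \<Rightarrow>\<^sub>0 complex) \<Rightarrow> ('b \<Rightarrow>\<^sub>0 complex) \<Rightarrow> ('b \<Rightarrow>\<^sub>0 complex))
    \<Rightarrow> ('b \<times> 'b \<Rightarrow>\<^sub>0 complex) \<Rightarrow> ('b \<times> 'b \<times> 'b \<Rightarrow>\<^sub>0 complex)" where
  "cyb br r = lin_ext (\<lambda>(i, j). lin_ext (\<lambda>(k, l).
       br (bvec i) (bvec k) \<otimes>\<^sub>t bvec j \<otimes>\<^sub>t bvec l
     + bvec i \<otimes>\<^sub>t br (bvec j) (bvec k) \<otimes>\<^sub>t bvec l
     + bvec i \<otimes>\<^sub>t bvec k \<otimes>\<^sub>t br (bvec j) (bvec l)) r) r"

definition triangular_coboundary :: "(('b \<Rightarrow>\<^sub>0 complex) \<Rightarrow> ('b \<Rightarrow>\<^sub>0 complex) \<Rightarrow> ('b \<Rightarrow>\<^sub>0 complex))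
    \<Rightarrow> (('b \<Rightarrow>\<^sub>0 complex) \<Rightarrow> ('b \<times> 'b \<Rightarrow>\<^sub>0 complex)) \<Rightarrow> bool" where
  "triangular_coboundary br \<Delta> \<longleftrightarrow>
     (\<exists>r \<in> range (\<lambda>t. t - flip t). (\<forall>x. \<Delta> x = adj_act br x r) \<and> cyb br r = 0)"

lemma adj_act_tens:
  assumes "lie_algebra br"
  shows "adj_act br x (a \<otimes>\<^sub>t b) = br x a \<otimes>\<^sub>t b + a \<otimes>\<^sub>t br x b"
proof -
  have br: "clinear (br x)" using assms by (simp add: lie_algebra_def)
  show ?thesis
    by (rule bilinear_eqI[of "\<lambda>a b. adj_act br x (a \<otimes>\<^sub>t b)" "\<lambda>a b. br x a \<otimes>\<^sub>t b + a \<otimes>\<^sub>t br x b"])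
       (simp_all add: adj_act_def clinear_iff lin_simps br[THEN clinear_add] br[THEN clinear_scl]
         algebra_simps)
qed

lemma cyb_sum_tens:
  assumes "lie_algebra br"
  shows "cyb br (\<Sum>i\<in>I. a i \<otimes>\<^sub>t b i) = (\<Sum>i\<in>I. \<Sum>j\<in>I.
       br (a i) (a j) \<otimes>\<^sub>t b i \<otimes>\<^sub>t b j
     + a i \<otimes>\<^sub>t br (b i) (a j) \<otimes>\<^sub>t b j
     + a i \<otimes>\<^sub>t a j \<otimes>\<^sub>t br (b i) (b j))"
proof -
  define T where "T = (\<lambda>a b c d. br a c \<otimes>\<^sub>t b \<otimes>\<^sub>t d + a \<otimes>\<^sub>t br b c \<otimes>\<^sub>t d + a \<otimes>\<^sub>t c \<otimes>\<^sub>t br b d)"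
  have br: "clinear (br x)" "clinear (\<lambda>x. br x y)" for x y
    using assms by (auto simp: lie_algebra_def)
  note ti = lin_simps clinear_add[OF br(1)] clinear_scl[OF br(1)] clinear_add[OF br(2)]
    clinear_scl[OF br(2)]
  have T: "clinear (\<lambda>a. T a b c d)" "clinear (\<lambda>b. T a b c d)"
      "clinear (\<lambda>c. T a b c d)" "clinear (\<lambda>d. T a b c d)" for a b c d
    by (auto simp: clinear_iff T_def ti algebra_simps)
  define B where "B = (\<lambda>r s. lin_ext (\<lambda>p. lin_ext (\<lambda>p'.
    T (bvec (fst p)) (bvec (snd p)) (bvec (fst p')) (bvec (snd p'))) s) r)"
  have Bl: "clinear (\<lambda>r. B r s)" "clinear (B r)" for r s
    unfolding B_def by (intro clinear_lin_ext clinear_lin_ext_param)+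
  have B_bvec: "B (bvec (i, j)) (bvec (k, l)) = T (bvec i) (bvec j) (bvec k) (bvec l)" for i j k l
    by (simp add: B_def)
  have B_left: "B (bvec (i, j)) (c \<otimes>\<^sub>t d) = T (bvec i) (bvec j) c d" for i j c d
    by (rule bilinear_eqI[of "\<lambda>c d. B (bvec (i, j)) (c \<otimes>\<^sub>t d)" "T (bvec i) (bvec j)"])
       (simp_all add: T B_bvec clinear_iff lin_simps Bl[THEN clinear_add] Bl[THEN clinear_scl]
         T[THEN clinear_add] T[THEN clinear_scl])
  have BT: "B (x \<otimes>\<^sub>t y) (c \<otimes>\<^sub>t d) = T x y c d" for x y c d
    by (rule bilinear_eqI[of "\<lambda>x y. B (x \<otimes>\<^sub>t y) (c \<otimes>\<^sub>t d)" "\<lambda>x y. T x y c d"])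
       (simp_all add: B_left clinear_iff lin_simps Bl[THEN clinear_add] Bl[THEN clinear_scl]
         T[THEN clinear_add] T[THEN clinear_scl])
  have "cyb br r = B r r" for r
    by (simp add: cyb_def B_def T_def case_prod_unfold del: tens_bvec)
  then show ?thesis
    by (simp add: clinear_sum[OF Bl(1)] clinear_sum[OF Bl(2)] BT) (simp add: T_def, rule sum.swap)
qed


section \<open>The quantum torus and its 2 by 2 matrices\<close>

text \<open>
  \<open>bvec (m, n)\<close> is the monomial \<open>x\<^sup>m y\<^sup>n\<close>. The relation \<open>y x = q x y\<close> gives
  \<open>(x\<^sup>k y\<^sup>l) (x\<^sup>m y\<^sup>n) = q\<^sup>l\<^sup>m x\<^sup>k\<^sup>+\<^sup>m y\<^sup>l\<^sup>+\<^sup>n\<close>.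
\<close>

type_synonym qtorus = "int \<times> int \<Rightarrow>\<^sub>0 complex"

definition qmul :: "complex \<Rightarrow> qtorus \<Rightarrow> qtorus \<Rightarrow> qtorus" where
  "qmul q a b = lin_ext (\<lambda>(k, l). lin_ext (\<lambda>(m, n).
     scl (q powi (l * m)) (bvec (k + m, l + n))) b) a"

text \<open>The derivation \<open>a d\<^sub>1 + b d\<^sub>2\<close> acts on the component of degree \<open>(m, n)\<close> by \<open>a m + b n\<close>.\<close>

definition qgrad :: "complex \<times> complex \<Rightarrow> qtorus \<Rightarrow> qtorus" where
  "qgrad s = lin_ext (\<lambda>(m, n). scl (fst s * of_int m + snd s * of_int n) (bvec (m, n)))"

type_synonym qmat = "qtorus^2^2"

definition munit :: "2 \<Rightarrow> 2 \<Rightarrow> qtorus \<Rightarrow> qmat" where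
  "munit i j p = (\<chi> k l. if k = i \<and> l = j then p else 0)"

definition mmul :: "complex \<Rightarrow> qmat \<Rightarrow> qmat \<Rightarrow> qmat" where
  "mmul q A B = (\<chi> i j. \<Sum>k\<in>UNIV. qmul q (A $ i $ k) (B $ k $ j))"

definition mgrad :: "complex \<times> complex \<Rightarrow> qmat \<Rightarrow> qmat" where
  "mgrad s A = (\<chi> i j. qgrad s (A $ i $ j))"


section \<open>The extended affine Lie algebra\<close>

typedef nonzero_index = "{k :: int \<times> int. k \<noteq> (0, 0)}"
  by (rule exI[of _ "(1, 0)"]) simp

datatype ltilde_basis =
    Be "int \<times> int" | Bf "int \<times> int" | Bd | Bg nonzero_index | Bh nonzero_index | Bd1 | Bd2

type_synonym ltilde = "ltilde_basis \<Rightarrow>\<^sub>0 complex"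

fun basis_mat :: "ltilde_basis \<Rightarrow> qmat" where
  "basis_mat (Be m) = munit 1 2 (bvec m)"
| "basis_mat (Bf m) = munit 2 1 (bvec m)"
| "basis_mat Bd = munit 1 1 (bvec (0, 0)) - munit 2 2 (bvec (0, 0))"
| "basis_mat (Bg k) = munit 1 1 (bvec (Rep_nonzero_index k))"
| "basis_mat (Bh k) = munit 2 2 (bvec (Rep_nonzero_index k))"
| "basis_mat Bd1 = 0"
| "basis_mat Bd2 = 0"

text \<open>
  The two components of an element of the direct sum: the matrix in \<open>sl\<^sub>2\<close> over the quantum
  torus, and the pair of coefficients of \<open>d\<^sub>1\<close> and \<open>d\<^sub>2\<close>.
\<close>

definition mat_part :: "ltilde \<Rightarrow> qmat" where
  "mat_part u = (\<chi> i j. lin_ext (\<lambda>b. basis_mat b $ i $ j) u)"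

definition der_part :: "ltilde \<Rightarrow> complex \<times> complex" where
  "der_part u = (Poly_Mapping.lookup u Bd1, Poly_Mapping.lookup u Bd2)"

text \<open>
  The bracket is \<open>[A + s, B + t] = (A B - B A) + s(B) - t(A)\<close> for matrices \<open>A, B\<close> and
  derivations \<open>s, t\<close> in the span of \<open>d\<^sub>1, d\<^sub>2\<close>. The description below determines a unique
  element, see \<open>ltilde_bracket_parts\<close>.
\<close>

definition ltilde_bracket :: "complex \<Rightarrow> ltilde \<Rightarrow> ltilde \<Rightarrow> ltilde" where
  "ltilde_bracket q u v = (THE w.
     mat_part w = mmul q (mat_part u) (mat_part v) - mmul q (mat_part v) (mat_part u)
       + mgrad (der_part u) (mat_part v) - mgrad (der_part v) (mat_part u) \<and>
     der_part w = (0, 0))"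

lemma clinear_qmul_left: "clinear (\<lambda>a. qmul q a b)"
  unfolding qmul_def by (rule clinear_lin_ext)

lemma clinear_qmul_right: "clinear (\<lambda>b. qmul q a b)"
  unfolding qmul_def case_prod_beta by (intro clinear_lin_ext_param clinear_lin_ext)

lemmas qmul_simps = clinear_qmul_left[THEN clinear_add] clinear_qmul_left[THEN clinear_scl]
  clinear_qmul_left[THEN clinear_diff]
  clinear_qmul_right[THEN clinear_add] clinear_qmul_right[THEN clinear_scl]
  clinear_qmul_right[THEN clinear_diff]

lemma qmul_bvec: "qmul q (bvec (k, l)) (bvec (m, n)) = scl (q powi (l * m)) (bvec (k + m, l + n))"
  by (simp add: qmul_def)

lemma qtorus_relation:
  "qmul q (bvec (0, 1)) (bvec (1, 0)) = scl q (qmul q (bvec (1, 0)) (bvec (0, 1)))"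
  by (simp add: qmul_bvec scl_scl)

lemma qmul_assoc:
  assumes "q \<noteq> 0"
  shows "qmul q (qmul q a b) c = qmul q a (qmul q b c)"
proof -
  have 1: "qmul q (qmul q (bvec i) (bvec j)) (bvec k) = qmul q (bvec i) (qmul q (bvec j) (bvec k))"
    for i j k
    using assms by (cases i; cases j; cases k)
      (simp add: qmul_bvec qmul_simps scl_scl power_int_add[symmetric] algebra_simps)
  have 2: "qmul q (qmul q (bvec i) b) c = qmul q (bvec i) (qmul q b c)" for i
    by (rule bilinear_eqI[of "\<lambda>b c. qmul q (qmul q (bvec i) b) c" "\<lambda>b c. qmul q (bvec i) (qmul q b c)"])
       (simp_all add: 1 clinear_iff qmul_simps)
  show ?thesis
    by (rule clinear_eqI[of "\<lambda>a. qmul q (qmul q a b) c" "\<lambda>a. qmul q a (qmul q b c)"])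
       (simp_all add: 2 clinear_iff qmul_simps)
qed

lemma qmul_trace:
  "Poly_Mapping.lookup (qmul q a b) (0, 0) = Poly_Mapping.lookup (qmul q b a) (0, 0)"
proof -
  have bv: "Poly_Mapping.lookup (qmul q (bvec i) b) (0, 0) =
      Poly_Mapping.lookup (qmul q b (bvec i)) (0, 0)" for i
    by (rule functional_eqI[of "\<lambda>b. Poly_Mapping.lookup (qmul q (bvec i) b) (0, 0)"];
        cases i; auto simp: qmul_simps lookup_add qmul_bvec add_eq_0_iff mult.commute)
  show ?thesis
    by (rule functional_eqI[of "\<lambda>a. Poly_Mapping.lookup (qmul q a b) (0, 0)"
          "\<lambda>a. Poly_Mapping.lookup (qmul q b a) (0, 0)"])
       (simp_all add: bv qmul_simps lookup_add)
qed

lemma lookup_qgrad: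
  "Poly_Mapping.lookup (qgrad s a) (m, n) =
     (fst s * of_int m + snd s * of_int n) * Poly_Mapping.lookup a (m, n)"
  by (rule functional_eqI[of "\<lambda>a. Poly_Mapping.lookup (qgrad s a) (m, n)"])
     (auto simp: qgrad_def lin_simps lookup_add algebra_simps split: if_splits)

lemma clinear_qgrad: "clinear (qgrad s)"
  unfolding qgrad_def by (rule clinear_lin_ext)

lemma qgrad_qmul: "qgrad s (qmul q a b) = qmul q (qgrad s a) b + qmul q a (qgrad s b)"
proof (rule bilinear_eqI[of "\<lambda>a b. qgrad s (qmul q a b)"
      "\<lambda>a b. qmul q (qgrad s a) b + qmul q a (qgrad s b)"])
  show "qgrad s (qmul q (bvec i) (bvec j)) =
      qmul q (qgrad s (bvec i)) (bvec j) + qmul q (bvec i) (qgrad s (bvec j))" for i j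
    by (cases i; cases j)
       (auto simp: qmul_bvec qgrad_def lin_simps qmul_simps lookup_add algebra_simps
         intro!: poly_mapping_eqI)
qed (simp_all add: clinear_iff qmul_simps lin_simps clinear_qgrad[THEN clinear_add]
       clinear_qgrad[THEN clinear_scl] algebra_simps)

lemma qgrad_commute: "qgrad s (qgrad t a) = qgrad t (qgrad s a)"
  by (rule poly_mapping_eqI) (auto simp: lookup_qgrad)

lemma mmul_add:
  "mmul q (A + B) C = mmul q A C + mmul q B C" "mmul q A (B + C) = mmul q A B + mmul q A C"
  "mmul q (A - B) C = mmul q A C - mmul q B C" "mmul q A (B - C) = mmul q A B - mmul q A C"
  by (simp_all add: vec_eq_iff mmul_def sum_2 qmul_simps)

lemma mmul_assoc: "q \<noteq> 0 \<Longrightarrow> mmul q (mmul q A B) C = mmul q A (mmul q B C)"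
  by (simp add: vec_eq_iff mmul_def sum_2 qmul_simps qmul_assoc algebra_simps)

lemma mgrad_add:
  "mgrad s (A + B) = mgrad s A + mgrad s B" "mgrad s (A - B) = mgrad s A - mgrad s B"
  by (simp_all add: vec_eq_iff mgrad_def clinear_qgrad[THEN clinear_add]
      clinear_qgrad[THEN clinear_diff])

lemma mgrad_mmul: "mgrad s (mmul q A B) = mmul q (mgrad s A) B + mmul q A (mgrad s B)"
  by (simp add: vec_eq_iff mgrad_def mmul_def sum_2 qgrad_qmul clinear_qgrad[THEN clinear_add]
      algebra_simps)

lemma mgrad_commute: "mgrad s (mgrad t A) = mgrad t (mgrad s A)"
  by (simp add: vec_eq_iff mgrad_def qgrad_commute)

lemma clinear_mat_part: "clinear (\<lambda>u. mat_part u $ i $ j)"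
  by (simp add: mat_part_def clinear_lin_ext)

lemma mat_part_bvec [simp]: "mat_part (bvec b) = basis_mat b"
  by (simp add: mat_part_def vec_eq_iff)

lemma lookup_ltilde:
  "Poly_Mapping.lookup u (Be m) = Poly_Mapping.lookup (mat_part u $ 1 $ 2) m" (is ?e)
  "Poly_Mapping.lookup u (Bf m) = Poly_Mapping.lookup (mat_part u $ 2 $ 1) m" (is ?f)
  "Poly_Mapping.lookup u Bd = Poly_Mapping.lookup (mat_part u $ 1 $ 1) (0, 0)" (is ?d)
  "Poly_Mapping.lookup u (Bg k) = Poly_Mapping.lookup (mat_part u $ 1 $ 1) (Rep_nonzero_index k)" (is ?g)
  "Poly_Mapping.lookup u (Bh k) = Poly_Mapping.lookup (mat_part u $ 2 $ 2) (Rep_nonzero_index k)" (is ?h)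
proof -
  have *: "Poly_Mapping.lookup u b = Poly_Mapping.lookup (mat_part u $ i $ j) m"
    if "\<And>b'. Poly_Mapping.lookup (basis_mat b' $ i $ j) m = (if b' = b then 1 else 0)" for b i j m
    by (rule functional_eqI[of "\<lambda>u. Poly_Mapping.lookup u b"])
       (simp_all add: that lookup_add clinear_mat_part[THEN clinear_add]
         clinear_mat_part[THEN clinear_scl])
  have nz: "Rep_nonzero_index k \<noteq> (0, 0)" for k
    using Rep_nonzero_index[of k] by simp
  show ?e ?f ?d ?g ?h
    by (rule *, rename_tac b', case_tac b';
        auto simp: munit_def lookup_minus nz nz[symmetric] Rep_nonzero_index_inject)+
qed

lemma ltilde_eqI:
  assumes "mat_part u = mat_part v" "der_part u = der_part v"
  shows "u = v"
proof (rule poly_mapping_eqI)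
  fix b show "Poly_Mapping.lookup u b = Poly_Mapping.lookup v b"
    by (cases b) (use assms in \<open>auto simp: lookup_ltilde der_part_def\<close>)
qed

lemma lin_ext_bvec_id: "lin_ext bvec p = p"
  by (rule clinear_eqI[of "lin_ext bvec" "\<lambda>p. p"]) (simp_all add: clinear_lin_ext clinear_iff[of "\<lambda>p. p"])

lemma ltilde_exists:
  assumes tr: "Poly_Mapping.lookup (M $ 1 $ 1) (0, 0) + Poly_Mapping.lookup (M $ 2 $ 2) (0, 0) = 0"
  shows "\<exists>u. mat_part u = M \<and> der_part u = s"
proof -
  define G where "G = (\<lambda>m. if m = (0, 0) then bvec Bd else bvec (Bg (Abs_nonzero_index m)))"
  define H where "H = (\<lambda>m. if m = (0, 0) then 0 else bvec (Bh (Abs_nonzero_index m)))"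
  define u where "u = lin_ext (\<lambda>m. bvec (Be m)) (M $ 1 $ 2) + lin_ext (\<lambda>m. bvec (Bf m)) (M $ 2 $ 1)
    + lin_ext G (M $ 1 $ 1) + lin_ext H (M $ 2 $ 2) + scl (fst s) (bvec Bd1) + scl (snd s) (bvec Bd2)"
  have comp: "mat_part (lin_ext F p) $ i $ j = lin_ext (\<lambda>m. mat_part (F m) $ i $ j) p"
    for F :: "int \<times> int \<Rightarrow> ltilde" and p i j
    by (rule clinear_eqI[of "\<lambda>p. mat_part (lin_ext F p) $ i $ j"])
       (simp_all add: clinear_lin_ext clinear_iff[of "\<lambda>p. mat_part (lin_ext F p) $ i $ j"] lin_simps
         clinear_mat_part[THEN clinear_add] clinear_mat_part[THEN clinear_scl])
  have GM: "mat_part (G m) $ i $ j = (if i = 1 \<and> j = 1 then bvec m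
      else if i = 2 \<and> j = 2 then - (if m = (0, 0) then bvec m else 0) else 0)"
    and HM: "mat_part (H m) $ i $ j = (if i = 2 \<and> j = 2 then if m = (0, 0) then 0 else bvec m else 0)"
    for m i j
    by (auto simp: G_def H_def Abs_nonzero_index_inverse munit_def
        clinear_0[OF clinear_mat_part])
  have scl_0: "scl c 0 = (0 :: qtorus)" for c
    by (rule poly_mapping_eqI) simp
  have l0: "lin_ext (\<lambda>m. 0) p = (0 :: qtorus)" for p :: qtorus
    by (rule poly_mapping_eqI) (simp add: lin_ext_def lookup_sum)
  have lk: "Poly_Mapping.lookup (lin_ext (\<lambda>m. scl (f m) (bvec m)) p) k
      = f k * Poly_Mapping.lookup p k" for f k and p :: qtorus
    by (auto simp: lin_ext_def lookup_sum in_keys_iff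
        if_distrib cong: if_cong)
  have diag: "lin_ext (\<lambda>m. - (if m = (0,0) then bvec m else 0)) (M $ 1 $ 1)
      + lin_ext (\<lambda>m. if m = (0,0) then 0 else bvec m) (M $ 2 $ 2) = M $ 2 $ 2" (is "?l = _")
  proof -
    have e: "- (if m = (0,0) then bvec m else 0) = scl (if m = (0,0) then -1 else 0) (bvec m)"
      "(if m = (0,0) then 0 else bvec m) = scl (if m = (0,0) then 0 else 1) (bvec m)"
      for m :: "int \<times> int"
      by (auto intro!: poly_mapping_eqI)
    show ?thesis
      unfolding e by (rule poly_mapping_eqI) (use tr in \<open>auto simp: lookup_add lk add_eq_0_iff\<close>)
  qed
  have "mat_part u $ i $ j = M $ i $ j" for i j
    using exhaust_2[of i] exhaust_2[of j] diag
    by (elim disjE) (simp_all add: u_def comp clinear_mat_part[THEN clinear_add]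
        clinear_mat_part[THEN clinear_scl] GM HM munit_def l0 lin_ext_bvec_id scl_0)
  then have "mat_part u = M" by (simp add: vec_eq_iff)
  moreover have "der_part u = s"
  proof -
    have "Poly_Mapping.lookup (lin_ext F p) b = 0" if "\<And>m. Poly_Mapping.lookup (F m) b = 0"
      for F :: "int \<times> int \<Rightarrow> ltilde" and p b
      by (simp add: lin_ext_def lookup_sum that)
    then show ?thesis
      by (simp add: u_def der_part_def lookup_add G_def H_def)
  qed
  ultimately show ?thesis by blast
qed

lemma ltilde_bracket_parts:
  "mat_part (ltilde_bracket q u v) =
     mmul q (mat_part u) (mat_part v) - mmul q (mat_part v) (mat_part u)
       + mgrad (der_part u) (mat_part v) - mgrad (der_part v) (mat_part u)" (is "_ = ?M")
  "der_part (ltilde_bracket q u v) = (0, 0)"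
proof -
  have "\<exists>w. mat_part w = ?M \<and> der_part w = (0, 0)"
    by (rule ltilde_exists)
       (simp add: mmul_def mgrad_def sum_2 lookup_add lookup_minus lookup_qgrad
         qmul_trace[of q "mat_part u $ _ $ _"])
  then have "\<exists>!w. mat_part w = ?M \<and> der_part w = (0, 0)"
    by (auto intro: ltilde_eqI)
  from theI'[OF this]
  show "mat_part (ltilde_bracket q u v) = ?M" "der_part (ltilde_bracket q u v) = (0, 0)"
    unfolding ltilde_bracket_def by auto
qed

theorem lie_algebra_ltilde:
  assumes "q \<noteq> 0"
  shows "lie_algebra (ltilde_bracket q)"
proof -
  have add: "mat_part (u + v) = mat_part u + mat_part v" "der_part (u + v) = der_part u + der_part v"
    "mat_part (0 :: ltilde) = 0" "der_part 0 = (0, 0)" for u v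
    by (simp_all add: vec_eq_iff clinear_mat_part[THEN clinear_add] clinear_mat_part[THEN clinear_0]
        der_part_def lookup_add)
  have scl: "mat_part (scl c u) $ i $ j = scl c (mat_part u $ i $ j)"
    "der_part (scl c u) = (c * fst (der_part u), c * snd (der_part u))" for c u i j
    by (simp_all add: clinear_mat_part[THEN clinear_scl] der_part_def)
  have grad: "mgrad (s + t) A = mgrad s A + mgrad t A" "mgrad (0, 0) A = 0"
    "qgrad (c * fst s, c * snd s) a = scl c (qgrad s a)" for s t A c a
    by (auto simp: vec_eq_iff mgrad_def lookup_qgrad lookup_add algebra_simps
        intro!: poly_mapping_eqI)
  have d: "scl c (x - y) = scl c x - scl c y" for c and x y :: qtorus
    by (rule poly_mapping_eqI) (simp add: lookup_minus algebra_simps)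
  show ?thesis
    unfolding lie_algebra_def clinear_iff
  proof (intro conjI allI)
    fix x y z :: ltilde and c
    show "ltilde_bracket q x (y + z) = ltilde_bracket q x y + ltilde_bracket q x z"
      by (rule ltilde_eqI)
         (simp_all add: ltilde_bracket_parts add mmul_add mgrad_add grad algebra_simps)
    show "ltilde_bracket q (x + z) y = ltilde_bracket q x y + ltilde_bracket q z y"
      by (rule ltilde_eqI)
         (simp_all add: ltilde_bracket_parts add mmul_add mgrad_add grad algebra_simps)
    show "ltilde_bracket q x (scl c y) = scl c (ltilde_bracket q x y)"
      by (rule ltilde_eqI)
         (simp_all add: vec_eq_iff ltilde_bracket_parts scl mmul_def mgrad_def sum_2 qmul_simps
           grad d scl_add clinear_qgrad[THEN clinear_scl])
    show "ltilde_bracket q (scl c x) y = scl c (ltilde_bracket q x y)"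
      by (rule ltilde_eqI)
         (simp_all add: vec_eq_iff ltilde_bracket_parts scl mmul_def mgrad_def sum_2 qmul_simps
           grad d scl_add clinear_qgrad[THEN clinear_scl])
    show "ltilde_bracket q x x = 0"
      by (rule ltilde_eqI) (simp_all add: ltilde_bracket_parts add)
    show "ltilde_bracket q x (ltilde_bracket q y z) + ltilde_bracket q y (ltilde_bracket q z x)
        + ltilde_bracket q z (ltilde_bracket q x y) = 0"
      by (rule ltilde_eqI)
         (simp_all add: ltilde_bracket_parts add mmul_add mgrad_add grad mgrad_mmul
           mmul_assoc[OF assms] mgrad_commute[of "der_part y" "der_part x"]
           mgrad_commute[of "der_part z" "der_part x"] mgrad_commute[of "der_part z" "der_part y"]
           algebra_simps)
  qed
qed

end

theory Submission
  imports Defs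
begin

text \<open>
  A one-cocycle \<open>\<Delta>\<close> with values in the tensor square is modified by coboundaries of skew elements
  until it vanishes. A single diagonalisable element \<open>h\<close> whose eigenvalues separate all degrees and
  roots allows one to assume \<open>\<Delta> h = 0\<close>, so that \<open>\<Delta>\<close> preserves degrees and root weights. The
  components of \<open>\<Delta>\<close> on the diagonal elements \<open>E\<^sub>1\<^sub>1 a\<close>, \<open>E\<^sub>2\<^sub>2 b\<close> along pairs of opposite root
  vectors form a closed discrete one-form with finite support on the lattice of degrees, since
  \<open>E\<^sub>1\<^sub>1 a\<close> and \<open>E\<^sub>2\<^sub>2 b\<close> commute; such a form is exact because the lattice has rank two. The remaining
  components are removed by dividing by structure constants, which vanish only for parallel degrees
  because \<open>q\<close> is not a root of unity. Throughout, a finitely supported function on the lattice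
  that is invariant up to nonzero scalars under a nonzero shift is zero; the same idea shows that
  tensor powers of the algebra have no nonzero invariants. Finally \<open>c(r)\<close> is invariant by the
  co-Jacobi identity, hence zero.
\<close>

section \<open>Functionals and derivations on tensor products\<close>

text \<open>The obstacle is finiteness: \<open>r\<close> must be a finite sum of tensors, while the
  algebra has infinitely many degrees and the cocycle equations only constrain the coefficients of
  \<open>r\<close> one by one. Along \<open>E k\<close>, \<open>F (- k)\<close> they fix differences
  of coefficients; in one lattice direction alone a finitely supported difference need not come from
  a finitely supported function, the obstruction being its sum along a line, and it is the second
  direction that makes this sum constant. Along the diagonal elements a coefficient is found by
  division by \<open>c a k - c k a\<close>. Along the span of \<open>d\<close>, \<open>D1\<close>,
  \<open>D2\<close> neither method is available: three coefficients, as many as the dimension of its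
  exterior square, are normalised, and linear relations force the others to vanish. A square root
  \<open>s\<close> of \<open>q\<close> is used to rescale the monomials so that exchanging the
  arguments of a structure constant inverts it, and the exchange of the two matrix indices halves
  the work. Each correction must respect the normalisations made before it, which explains the side
  conditions on the successive \<open>r\<close>.\<close>

definition lfun :: "(('b \<Rightarrow>\<^sub>0 complex) \<Rightarrow> complex) \<Rightarrow> bool" where
  "lfun f \<longleftrightarrow> (\<forall>x y. f (x + y) = f x + f y) \<and> (\<forall>c x. f (scl c x) = c * f x)"

lemma lfun_add: "lfun f \<Longrightarrow> f (x + y) = f x + f y"
  and lfun_scl: "lfun f \<Longrightarrow> f (scl c x) = c * f x"
  by (simp_all add: lfun_def)

lemma lfun_0: "lfun f \<Longrightarrow> f 0 = 0"
  using lfun_add[of f 0 0] by simp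

lemma lfun_diff: "lfun f \<Longrightarrow> f (x - y) = f x - f y"
  using lfun_add[of f "x - y" y] by (simp add: algebra_simps)

lemma lfun_minus: "lfun f \<Longrightarrow> f (- x) = - f x"
  using lfun_diff[of f 0 x] lfun_0[of f] by simp

lemma lfun_sum: "lfun f \<Longrightarrow> f (sum g A) = (\<Sum>a\<in>A. f (g a))"
  by (induction A rule: infinite_finite_induct) (simp_all add: lfun_0 lfun_add)

lemma lfun_lookup: "lfun (\<lambda>v. Poly_Mapping.lookup v i)"
  by (simp add: lfun_def lookup_add)

lemma lfun_compose: "lfun \<phi> \<Longrightarrow> clinear f \<Longrightarrow> lfun (\<lambda>u. \<phi> (f u))"
  by (simp add: lfun_def clinear_iff)

lemma lfun_eqI: "lfun f \<Longrightarrow> lfun g \<Longrightarrow> (\<And>i. f (bvec i) = g (bvec i)) \<Longrightarrow> f x = g x"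
  by (rule functional_eqI) (simp_all add: lfun_def)

lemma scl_zero [simp]: "scl c 0 = 0" and scl_0_left [simp]: "scl 0 x = 0"
  and scl_one [simp]: "scl 1 x = x"
  by (auto intro!: poly_mapping_eqI)

lemma scl_diff: "scl c (x - y) = scl c x - scl c y"
  by (rule poly_mapping_eqI) (simp add: lookup_minus algebra_simps)

lemma clinear_minus: "clinear f \<Longrightarrow> f (- x) = - f x"
  using clinear_diff[of f 0 x] clinear_0[of f] by simp

lemma clinear_zero: "clinear (\<lambda>x. 0)"
  by (simp add: clinear_iff)

lemma clinear_sub: "clinear f \<Longrightarrow> clinear g \<Longrightarrow> clinear (\<lambda>x. f x - g x)"
  by (simp add: clinear_iff scl_diff algebra_simps)

text \<open>The contraction of \<open>v\<close> with \<phi> on the left and \<psi> on the right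
  factor. Only basis values enter, so it is linear in \<phi> and in \<psi> even when these are
  arbitrary functions; their own linearity enters through \<open>tfun_tens\<close>.\<close>

definition tfun :: "(('b \<Rightarrow>\<^sub>0 complex) \<Rightarrow> complex) \<Rightarrow> (('c \<Rightarrow>\<^sub>0 complex) \<Rightarrow> complex)
    \<Rightarrow> ('b \<times> 'c \<Rightarrow>\<^sub>0 complex) \<Rightarrow> complex" where
  "tfun \<phi> \<psi> v = (\<Sum>p\<in>Poly_Mapping.keys v.
     Poly_Mapping.lookup v p * (\<phi> (bvec (fst p)) * \<psi> (bvec (snd p))))"

lemma lfun_tfun: "lfun (tfun \<phi> \<psi>)"
proof -
  have "tfun \<phi> \<psi> v = Poly_Mapping.lookup (lin_ext (\<lambda>p. scl (\<phi> (bvec (fst p)) * \<psi> (bvec (snd p)))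
      (bvec ())) v) ()" for v
    by (simp add: tfun_def lin_ext_def lookup_sum)
  then show ?thesis
    by (simp add: lfun_def clinear_add[OF clinear_lin_ext] clinear_scl[OF clinear_lin_ext] lookup_add)
qed

lemmas tfun_simps = lfun_add[OF lfun_tfun] lfun_scl[OF lfun_tfun] lfun_diff[OF lfun_tfun]
  lfun_0[OF lfun_tfun] lfun_minus[OF lfun_tfun] lfun_sum[OF lfun_tfun]

lemma tfun_bvec [simp]: "tfun \<phi> \<psi> (bvec (i, j)) = \<phi> (bvec i) * \<psi> (bvec j)"
  by (simp add: tfun_def bvec_def)

lemma lfun_mult: "lfun f \<Longrightarrow> lfun (\<lambda>x. c * f x)" "lfun f \<Longrightarrow> lfun (\<lambda>x. f x * c)"
  by (simp_all add: lfun_def distrib_left distrib_right mult_ac)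

lemma tfun_tens:
  assumes "lfun \<phi>" "lfun \<psi>"
  shows "tfun \<phi> \<psi> (a \<otimes>\<^sub>t b) = \<phi> a * \<psi> b"
proof -
  have "tfun \<phi> \<psi> (bvec i \<otimes>\<^sub>t b) = \<phi> (bvec i) * \<psi> b" for i
    by (rule lfun_eqI[OF lfun_compose[OF lfun_tfun clinear_tens_right] lfun_mult(1)[OF assms(2)]]) simp
  then show ?thesis
    by (rule lfun_eqI[OF lfun_compose[OF lfun_tfun clinear_tens_left] lfun_mult(2)[OF assms(1)]])
qed

lemma tfun_left:
  "tfun (\<lambda>u. c * \<phi> u) \<psi> v = c * tfun \<phi> \<psi> v"
  "tfun (\<lambda>u. \<phi> u * c) \<psi> v = tfun \<phi> \<psi> v * c"
  "tfun (\<lambda>u. - \<phi> u) \<psi> v = - tfun \<phi> \<psi> v"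
  "tfun (\<lambda>u. \<phi> u + \<phi>' u) \<psi> v = tfun \<phi> \<psi> v + tfun \<phi>' \<psi> v"
  "tfun (\<lambda>u. \<phi> u - \<phi>' u) \<psi> v = tfun \<phi> \<psi> v - tfun \<phi>' \<psi> v"
  "tfun (\<lambda>u. 0) \<psi> v = 0"
  "tfun (\<lambda>u. if P then \<phi> u else \<phi>' u) \<psi> v = (if P then tfun \<phi> \<psi> v else tfun \<phi>' \<psi> v)"
  by (simp_all add: tfun_def sum_distrib_left sum_distrib_right sum_negf sum.distrib sum_subtractf
      algebra_simps)

lemma tfun_right:
  "tfun \<phi> (\<lambda>u. c * \<psi> u) v = c * tfun \<phi> \<psi> v"
  "tfun \<phi> (\<lambda>u. \<psi> u * c) v = tfun \<phi> \<psi> v * c"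
  "tfun \<phi> (\<lambda>u. - \<psi> u) v = - tfun \<phi> \<psi> v"
  "tfun \<phi> (\<lambda>u. \<psi> u + \<psi>' u) v = tfun \<phi> \<psi> v + tfun \<phi> \<psi>' v"
  "tfun \<phi> (\<lambda>u. \<psi> u - \<psi>' u) v = tfun \<phi> \<psi> v - tfun \<phi> \<psi>' v"
  "tfun \<phi> (\<lambda>u. 0) v = 0"
  "tfun \<phi> (\<lambda>u. if P then \<psi> u else \<psi>' u) v = (if P then tfun \<phi> \<psi> v else tfun \<phi> \<psi>' v)"
  by (simp_all add: tfun_def sum_distrib_left sum_distrib_right sum_negf sum.distrib sum_subtractf
      algebra_simps)

lemma tfun_lookup:
  "tfun (\<lambda>u. Poly_Mapping.lookup u i) (\<lambda>u. Poly_Mapping.lookup u j) v = Poly_Mapping.lookup v (i, j)"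
  by (rule lfun_eqI[OF lfun_tfun lfun_lookup]) (auto split: prod.splits simp: tfun_def bvec_def
      lookup_single when_def)

lemma tfun_nonzero_ex:
  assumes "tfun \<phi> \<psi> v \<noteq> 0"
  shows "\<exists>p\<in>Poly_Mapping.keys v. \<phi> (bvec (fst p)) \<noteq> 0 \<and> \<psi> (bvec (snd p)) \<noteq> 0"
proof (rule ccontr)
  assume "\<not> ?thesis"
  then have "tfun \<phi> \<psi> v = 0" unfolding tfun_def by (intro sum.neutral) auto
  with assms show False by simp
qed

section \<open>The flip and skew tensors\<close>

lemma clinear_flip: "clinear flip"
  unfolding flip_def by (rule clinear_lin_ext)

lemma tfun_flip: "tfun \<phi> \<psi> (flip v) = tfun \<psi> \<phi> v"
proof (rule lfun_eqI[of "\<lambda>v. tfun \<phi> \<psi> (flip v)" "tfun \<psi> \<phi>"])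
  show "lfun (\<lambda>v. tfun \<phi> \<psi> (flip v))"
    by (rule lfun_compose[OF lfun_tfun clinear_flip])
  show "tfun \<phi> \<psi> (flip (bvec i)) = tfun \<psi> \<phi> (bvec i)" for i
    by (cases i) (simp add: flip_def)
qed (rule lfun_tfun)

lemma lookup_flip: "Poly_Mapping.lookup (flip v) (i, j) = Poly_Mapping.lookup v (j, i)"
  using tfun_flip[of "\<lambda>u. Poly_Mapping.lookup u i" "\<lambda>u. Poly_Mapping.lookup u j" v]
  by (simp add: tfun_lookup)

lemma flip_flip [simp]: "flip (flip v) = v"
  by (rule poly_mapping_eqI) (metis lookup_flip surj_pair)

definition skew :: "('b \<times> 'b \<Rightarrow>\<^sub>0 complex) \<Rightarrow> bool" where
  "skew v \<longleftrightarrow> flip v = - v"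

lemma skew_diff_flip: "skew (t - flip t)"
  by (simp add: skew_def clinear_diff[OF clinear_flip])

lemma skew_iff_range: "skew v \<longleftrightarrow> v \<in> range (\<lambda>t. t - flip t)"
proof
  assume "skew v"
  then have "v = scl (1/2) v - flip (scl (1/2) v)"
    by (intro poly_mapping_eqI)
       (simp add: skew_def clinear_scl[OF clinear_flip] lookup_minus)
  then show "v \<in> range (\<lambda>t. t - flip t)" by blast
qed (auto simp: skew_diff_flip)

lemma skew_add: "skew u \<Longrightarrow> skew v \<Longrightarrow> skew (u + v)"
  and skew_sub: "skew u \<Longrightarrow> skew v \<Longrightarrow> skew (u - v)"
  by (simp_all add: skew_def clinear_add[OF clinear_flip] clinear_diff[OF clinear_flip])

lemma tfun_skew: "skew v \<Longrightarrow> tfun \<phi> \<psi> v = - tfun \<psi> \<phi> v"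
  by (metis minus_minus skew_def tfun_flip tfun_simps(5))

text \<open>The two factors may be different spaces, so that a single result on invariants serves
  both the tensor square, where \<open>D\<close> takes its values, and the tensor cube, where c(r)
  lives.\<close>

definition tens_act :: "(('b \<Rightarrow>\<^sub>0 complex) \<Rightarrow> ('b \<Rightarrow>\<^sub>0 complex)) \<Rightarrow> (('c \<Rightarrow>\<^sub>0 complex) \<Rightarrow> ('c \<Rightarrow>\<^sub>0 complex))
    \<Rightarrow> ('b \<times> 'c \<Rightarrow>\<^sub>0 complex) \<Rightarrow> ('b \<times> 'c \<Rightarrow>\<^sub>0 complex)" where
  "tens_act f g = lin_ext (\<lambda>(i, j). f (bvec i) \<otimes>\<^sub>t bvec j + bvec i \<otimes>\<^sub>t g (bvec j))"

lemma adj_act_eq: "adj_act br x = tens_act (br x) (br x)"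
  by (simp add: adj_act_def tens_act_def)

lemma clinear_tens_act: "clinear (tens_act f g)"
  unfolding tens_act_def by (rule clinear_lin_ext)

lemma tens_act_tens:
  assumes "clinear f" "clinear g"
  shows "tens_act f g (a \<otimes>\<^sub>t b) = f a \<otimes>\<^sub>t b + a \<otimes>\<^sub>t g b"
  by (rule bilinear_eqI[of "\<lambda>a b. tens_act f g (a \<otimes>\<^sub>t b)" "\<lambda>a b. f a \<otimes>\<^sub>t b + a \<otimes>\<^sub>t g b"])
     (simp_all add: tens_act_def clinear_iff lin_simps assms[THEN clinear_add] assms[THEN clinear_scl]
       algebra_simps)

lemma tfun_tens_act:
  assumes "clinear f" "clinear g" "lfun \<phi>" "lfun \<psi>"
  shows "tfun \<phi> \<psi> (tens_act f g v) = tfun (\<lambda>u. \<phi> (f u)) \<psi> v + tfun \<phi> (\<lambda>u. \<psi> (g u)) v"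
proof (rule lfun_eqI[of "\<lambda>v. tfun \<phi> \<psi> (tens_act f g v)"
      "\<lambda>v. tfun (\<lambda>u. \<phi> (f u)) \<psi> v + tfun \<phi> (\<lambda>u. \<psi> (g u)) v"])
  show "lfun (\<lambda>v. tfun \<phi> \<psi> (tens_act f g v))"
    by (rule lfun_compose[OF lfun_tfun clinear_tens_act])
  show "lfun (\<lambda>v. tfun (\<lambda>u. \<phi> (f u)) \<psi> v + tfun \<phi> (\<lambda>u. \<psi> (g u)) v)"
    by (simp add: lfun_def tfun_simps algebra_simps)
  show "tfun \<phi> \<psi> (tens_act f g (bvec i)) =
      tfun (\<lambda>u. \<phi> (f u)) \<psi> (bvec i) + tfun \<phi> (\<lambda>u. \<psi> (g u)) (bvec i)" for i
    by (cases i) (simp add: tens_act_def tfun_simps tfun_tens assms)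
qed

lemma tensor_clinear_eqI:
  assumes "clinear f" "clinear g" "\<And>i j. f (bvec i \<otimes>\<^sub>t bvec j) = g (bvec i \<otimes>\<^sub>t bvec j)"
  shows "f v = g v"
  by (rule clinear_eqI[OF assms(1,2)]) (metis assms(3) tens_bvec surj_pair)

lemma tens_act_commutator:
  assumes "clinear f" "clinear g" "clinear f'" "clinear g'"
  shows "tens_act f g (tens_act f' g' v) - tens_act f' g' (tens_act f g v)
    = tens_act (\<lambda>u. f (f' u) - f' (f u)) (\<lambda>u. g (g' u) - g' (g u)) v"
proof (rule tensor_clinear_eqI[of
      "\<lambda>v. tens_act f g (tens_act f' g' v) - tens_act f' g' (tens_act f g v)"])
  have "clinear (\<lambda>u. f (f' u) - f' (f u))" "clinear (\<lambda>u. g (g' u) - g' (g u))"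
    using assms by (auto intro!: clinear_sub clinear_compose[of f f'] clinear_compose[of f' f]
        clinear_compose[of g g'] clinear_compose[of g' g])
  then show "tens_act f g (tens_act f' g' (bvec i \<otimes>\<^sub>t bvec j)) - tens_act f' g' (tens_act f g (bvec i \<otimes>\<^sub>t bvec j))
      = tens_act (\<lambda>u. f (f' u) - f' (f u)) (\<lambda>u. g (g' u) - g' (g u)) (bvec i \<otimes>\<^sub>t bvec j)" for i j
    by (simp add: tens_act_tens assms clinear_add[OF clinear_tens_act] clinear_diff[OF clinear_tens_left]
        clinear_diff[OF clinear_tens_right] del: tens_bvec)
qed (intro clinear_sub clinear_compose[OF clinear_tens_act clinear_tens_act] clinear_tens_act)+


section \<open>Cocycles with values in the tensor square\<close>

lemma lie_algebraD:
  assumes "lie_algebra br"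
  shows "clinear (br x)" "clinear (\<lambda>x. br x y)" "br x x = 0"
    "br x (br y z) + br y (br z x) + br z (br x y) = 0"
  using assms by (auto simp: lie_algebra_def)

lemma lie_anticomm:
  assumes "lie_algebra br"
  shows "br x y = - br y x"
proof -
  have z: "br z z = 0" for z by (rule lie_algebraD(3)[OF assms])
  have "br (x + y) (x + y) = br x x + br y x + (br x y + br y y)"
    by (simp only: clinear_add[OF lie_algebraD(1)[OF assms]] clinear_add[OF lie_algebraD(2)[OF assms]])
  then show ?thesis by (simp add: z eq_neg_iff_add_eq_0 add.commute)
qed

lemma lie_jacobi:
  assumes "lie_algebra br"
  shows "br x (br y z) = br (br x y) z + br y (br x z)"
proof -
  have "br y (br z x) = - br y (br x z)"
    using lie_anticomm[OF assms, of z x] by (simp add: clinear_minus[OF lie_algebraD(1)[OF assms]])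
  moreover have "br z (br x y) = - br (br x y) z" by (rule lie_anticomm[OF assms])
  ultimately have "br x (br y z) - br y (br x z) - br (br x y) z = 0"
    using lie_algebraD(4)[OF assms, of x y z] by (simp only: diff_conv_add_uminus)
  then show ?thesis by (metis add.commute diff_diff_add eq_iff_diff_eq_0)
qed

lemma tens_act_eqI:
  "(\<And>u. f u = f' u) \<Longrightarrow> (\<And>u. g u = g' u) \<Longrightarrow> tens_act f g v = tens_act f' g' v"
  by (simp add: tens_act_def)

lemma adj_act_bracket:
  assumes "lie_algebra br"
  shows "adj_act br (br x y) v = adj_act br x (adj_act br y v) - adj_act br y (adj_act br x v)"
  unfolding adj_act_eq
  by (subst tens_act_commutator) (auto intro!: tens_act_eqI simp: lie_algebraD[OF assms]
      lie_jacobi[OF assms, of x y])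

lemma clinear_adj_act: "clinear (adj_act br x)"
  unfolding adj_act_eq by (rule clinear_tens_act)

lemma clinear_adj_act_left:
  assumes "lie_algebra br"
  shows "clinear (\<lambda>x. adj_act br x v)"
proof -
  note b = lie_algebraD(2)[OF assms]
  show ?thesis
    unfolding adj_act_def
    by (rule clinear_lin_ext_param)
       (auto simp: clinear_iff clinear_add[OF b] clinear_scl[OF b] lin_simps algebra_simps
         split: prod.splits)
qed

lemma flip_adj_act:
  assumes "lie_algebra br"
  shows "flip (adj_act br x v) = adj_act br x (flip v)"
  by (rule tensor_clinear_eqI[of "\<lambda>v. flip (adj_act br x v)" "\<lambda>v. adj_act br x (flip v)"])
     (simp_all add: clinear_compose[OF clinear_flip clinear_adj_act]
       clinear_compose[OF clinear_adj_act clinear_flip] flip_tens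
       adj_act_tens[OF assms] clinear_add[OF clinear_flip] add.commute del: tens_bvec)

lemma skew_adj_act: "lie_algebra br \<Longrightarrow> skew v \<Longrightarrow> skew (adj_act br x v)"
  by (simp add: skew_def flip_adj_act clinear_minus[OF clinear_adj_act])

definition skew_cocycle :: "(('b \<Rightarrow>\<^sub>0 complex) \<Rightarrow> ('b \<Rightarrow>\<^sub>0 complex) \<Rightarrow> ('b \<Rightarrow>\<^sub>0 complex))
    \<Rightarrow> (('b \<Rightarrow>\<^sub>0 complex) \<Rightarrow> ('b \<times> 'b \<Rightarrow>\<^sub>0 complex)) \<Rightarrow> bool" where
  "skew_cocycle br D \<longleftrightarrow> clinear D \<and> (\<forall>x. skew (D x)) \<and>
     (\<forall>x y. D (br x y) = adj_act br x (D y) - adj_act br y (D x))"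

lemma skew_cocycle_sub_inner:
  assumes "lie_algebra br" "skew_cocycle br D" "skew r"
  shows "skew_cocycle br (\<lambda>x. D x - adj_act br x r)"
  using assms(2) unfolding skew_cocycle_def
  by (auto intro!: clinear_sub clinear_adj_act_left[OF assms(1)] skew_sub skew_adj_act[OF assms(1)]
      assms(3) simp: clinear_diff[OF clinear_adj_act] adj_act_bracket[OF assms(1)])

lemma lookup_adj_act_diagonal:
  assumes "lie_algebra br" "\<And>i. br h (bvec i) = scl (w i) (bvec i)"
  shows "Poly_Mapping.lookup (adj_act br h v) (i, j) = (w i + w j) * Poly_Mapping.lookup v (i, j)"
proof (rule lfun_eqI[of "\<lambda>v. Poly_Mapping.lookup (adj_act br h v) (i, j)"])
  show "lfun (\<lambda>v. Poly_Mapping.lookup (adj_act br h v) (i, j))"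
    by (rule lfun_compose[OF lfun_lookup clinear_adj_act])
  show "Poly_Mapping.lookup (adj_act br h (bvec p)) (i, j)
      = (w i + w j) * Poly_Mapping.lookup (bvec p) (i, j)" for p
    by (cases p) (simp add: adj_act_def assms(2) lin_simps lookup_add)
qed (simp add: lfun_def lookup_add algebra_simps)

text \<open>The part of \<open>D h\<close> of nonzero weight is a coboundary, by division by the
  weights. The rest has weight 0, so acting on it by \<open>bvec i\<close> gives weight
  \<open>w i\<close>; the cocycle identity on \<open>br h (bvec i)\<close> expresses the result as
  \<open>h - w i\<close> applied to \<open>D' (bvec i)\<close>, which has no component of that
  weight. Hence the rest is invariant.\<close>

lemma skew_cocycle_kill_diagonal:
  assumes br: "lie_algebra br" and h: "\<And>i. br h (bvec i) = scl (w i) (bvec i)"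
    and inv: "\<And>v. (\<And>x. adj_act br x v = 0) \<Longrightarrow> v = 0"
    and D: "skew_cocycle br D"
  obtains r where "skew r" "D h = adj_act br h r"
proof -
  define W where "W = (\<lambda>p. w (fst p) + w (snd p))"
  \<comment> \<open>Division by zero yields 0, so \<open>r\<close> ignores the weight-zero part of
    \<open>D h\<close>.\<close>
  define r where "r = (\<Sum>p\<in>Poly_Mapping.keys (D h). scl (Poly_Mapping.lookup (D h) p / W p) (bvec p))"
  have lr: "Poly_Mapping.lookup r p = Poly_Mapping.lookup (D h) p / W p" for p
    by (auto simp: r_def lookup_sum in_keys_iff if_distrib cong: if_cong)
  have skD: "skew (D x)" for x using D by (simp add: skew_cocycle_def)
  have "skew r"
    unfolding skew_def
  proof (rule poly_mapping_eqI)
    fix p :: "'a \<times> 'a"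
    obtain i j where p: "p = (i, j)" by (cases p)
    have "Poly_Mapping.lookup (flip (D h)) (i, j) = Poly_Mapping.lookup (- D h) (i, j)"
      using skD[of h] by (simp add: skew_def)
    then show "Poly_Mapping.lookup (flip r) p = Poly_Mapping.lookup (- r) p"
      by (simp add: p lookup_flip lr W_def add.commute)
  qed
  define D' where "D' = (\<lambda>x. D x - adj_act br x r)"
  have D': "skew_cocycle br D'"
    unfolding D'_def by (rule skew_cocycle_sub_inner[OF br D \<open>skew r\<close>])
  have ad: "Poly_Mapping.lookup (adj_act br h v) p = W p * Poly_Mapping.lookup v p" for v p
    using lookup_adj_act_diagonal[OF br h, of v "fst p" "snd p"] by (simp add: W_def)
  have h0: "adj_act br h (D' h) = 0"
    by (rule poly_mapping_eqI) (auto simp: ad D'_def lookup_minus lr)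
  have "adj_act br (bvec i) (D' h) = 0" for i
  proof (rule poly_mapping_eqI)
    fix p
    let ?v = "adj_act br (bvec i) (D' h)"
    have "adj_act br (br h (bvec i)) (D' h) = adj_act br h ?v"
      by (simp add: adj_act_bracket[OF br] h0 clinear_0[OF clinear_adj_act])
    then have "scl (w i) ?v = adj_act br h ?v"
      by (simp add: h clinear_scl[OF clinear_adj_act_left[OF br]])
    then have 1: "w i * Poly_Mapping.lookup ?v p = W p * Poly_Mapping.lookup ?v p"
      by (metis ad lookup_scl)
    have "D' (br h (bvec i)) = adj_act br h (D' (bvec i)) - ?v" "clinear D'"
      using D' by (auto simp: skew_cocycle_def)
    then have "scl (w i) (D' (bvec i)) = adj_act br h (D' (bvec i)) - ?v"
      by (simp add: h clinear_scl)
    then have "w i * Poly_Mapping.lookup (D' (bvec i)) p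
        = W p * Poly_Mapping.lookup (D' (bvec i)) p - Poly_Mapping.lookup ?v p"
      by (metis ad lookup_scl lookup_minus)
    with 1 show "Poly_Mapping.lookup ?v p = Poly_Mapping.lookup 0 p"
      by (cases "w i = W p") auto
  qed
  then have "adj_act br x (D' h) = 0" for x
    by (rule clinear_eqI[OF clinear_adj_act_left[OF br] clinear_zero])
  then have "D' h = 0" by (rule inv)
  then have "D h = adj_act br h r" by (simp add: D'_def)
  with \<open>skew r\<close> show ?thesis by (rule that)
qed


section \<open>The co-Jacobi identity of a coboundary\<close>

text \<open>\<open>cyb\<close> is quadratic in \<open>r\<close>; this is the bilinear map behind it.
  Likewise \<open>cojac2\<close> below separates the two occurrences of \<open>r\<close> in the
  co-Jacobi expression of a coboundary.\<close>

definition cyb2 :: "(('b \<Rightarrow>\<^sub>0 complex) \<Rightarrow> ('b \<Rightarrow>\<^sub>0 complex) \<Rightarrow> ('b \<Rightarrow>\<^sub>0 complex))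
    \<Rightarrow> ('b \<times> 'b \<Rightarrow>\<^sub>0 complex) \<Rightarrow> ('b \<times> 'b \<Rightarrow>\<^sub>0 complex) \<Rightarrow> ('b \<times> 'b \<times> 'b \<Rightarrow>\<^sub>0 complex)" where
  "cyb2 br r s = lin_ext (\<lambda>(i, j). lin_ext (\<lambda>(k, l).
       br (bvec i) (bvec k) \<otimes>\<^sub>t bvec j \<otimes>\<^sub>t bvec l
     + bvec i \<otimes>\<^sub>t br (bvec j) (bvec k) \<otimes>\<^sub>t bvec l
     + bvec i \<otimes>\<^sub>t bvec k \<otimes>\<^sub>t br (bvec j) (bvec l)) s) r"

definition cojac2 :: "(('b \<Rightarrow>\<^sub>0 complex) \<Rightarrow> ('b \<Rightarrow>\<^sub>0 complex) \<Rightarrow> ('b \<Rightarrow>\<^sub>0 complex)) \<Rightarrow> ('b \<Rightarrow>\<^sub>0 complex)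
    \<Rightarrow> ('b \<times> 'b \<Rightarrow>\<^sub>0 complex) \<Rightarrow> ('b \<times> 'b \<Rightarrow>\<^sub>0 complex) \<Rightarrow> ('b \<times> 'b \<times> 'b \<Rightarrow>\<^sub>0 complex)" where
  "cojac2 br x r s = (let u = tens_map id (\<lambda>y. adj_act br y s) (adj_act br x r) in u + rot u + rot (rot u))"

lemma clinear_id: "clinear id"
  by (simp add: clinear_iff)

lemma clinear_rot: "clinear rot"
  unfolding rot_def by (rule clinear_lin_ext)

lemma clinear_tens_map: "clinear (tens_map f g)"
  unfolding tens_map_def by (rule clinear_lin_ext)

lemma clinear_cyb2: "clinear (\<lambda>r. cyb2 br r s)" "clinear (cyb2 br r)"
  unfolding cyb2_def case_prod_beta by (intro clinear_lin_ext clinear_lin_ext_param)+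

lemma clinear_cojac2: "clinear (\<lambda>r. cojac2 br x r s)" "clinear (cojac2 br x r)"
proof -
  have cyc: "clinear (\<lambda>r. f r + rot (f r) + rot (rot (f r)))" if "clinear f"
    for f :: "('a \<times> 'a \<Rightarrow>\<^sub>0 complex) \<Rightarrow> ('a \<times> 'a \<times> 'a \<Rightarrow>\<^sub>0 complex)"
    by (intro clinear_plus clinear_compose[OF clinear_rot] that)
  have 1: "clinear (\<lambda>r. tens_map id (\<lambda>y. adj_act br y s) (adj_act br x r))"
    unfolding tens_map_def by (rule clinear_compose[OF clinear_lin_ext clinear_adj_act])
  have 2: "clinear (\<lambda>s. tens_map id (\<lambda>y. adj_act br y s) (adj_act br x r))"
    unfolding tens_map_def case_prod_beta
    by (intro clinear_lin_ext_param clinear_compose[OF clinear_tens_right] clinear_adj_act)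
  show "clinear (\<lambda>r. cojac2 br x r s)" "clinear (cojac2 br x r)"
    using cyc[OF 1] cyc[OF 2] by (simp_all add: cojac2_def[abs_def] Let_def)
qed

lemma cojac2_tens:
  assumes br: "lie_algebra br"
  shows "cojac2 br x (a \<otimes>\<^sub>t b) (c \<otimes>\<^sub>t d) = (let
      u = br x a \<otimes>\<^sub>t br b c \<otimes>\<^sub>t d + br x a \<otimes>\<^sub>t c \<otimes>\<^sub>t br b d
        + a \<otimes>\<^sub>t br (br x b) c \<otimes>\<^sub>t d + a \<otimes>\<^sub>t c \<otimes>\<^sub>t br (br x b) d
      in u + rot u + rot (rot u))"
proof -
  have tm: "tens_map id (\<lambda>y. adj_act br y (c \<otimes>\<^sub>t d)) (u \<otimes>\<^sub>t v) =
      u \<otimes>\<^sub>t br v c \<otimes>\<^sub>t d + u \<otimes>\<^sub>t c \<otimes>\<^sub>t br v d" for u v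
    by (subst tens_map_tens[OF clinear_id clinear_adj_act_left[OF br]])
      (simp add: adj_act_tens[OF br] clinear_add[OF clinear_tens_right])
  show ?thesis
    unfolding cojac2_def adj_act_tens[OF br, of x] clinear_add[OF clinear_tens_map] tm
    by (simp add: add.assoc)
qed

lemma cyb2_bvec:
  "cyb2 br (bvec i \<otimes>\<^sub>t bvec j) (bvec k \<otimes>\<^sub>t bvec l) = br (bvec i) (bvec k) \<otimes>\<^sub>t bvec j \<otimes>\<^sub>t bvec l
     + bvec i \<otimes>\<^sub>t br (bvec j) (bvec k) \<otimes>\<^sub>t bvec l
     + bvec i \<otimes>\<^sub>t bvec k \<otimes>\<^sub>t br (bvec j) (bvec l)"
  by (simp add: cyb2_def)

text \<open>Skew-symmetry is used through elements of the form \<open>t - flip t\<close>, and the quadratic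
  identity is polarised so that it can be checked on basis tensors.\<close>

lemma cojac2_polarised:
  assumes br: "lie_algebra br"
  defines "S \<equiv> \<lambda>t. t - flip t"
  shows "cojac2 br x (S t) (S t') + cojac2 br x (S t') (S t)
    = tens_act (br x) (adj_act br x) (cyb2 br (S t) (S t') + cyb2 br (S t') (S t))"
proof -
  have S: "clinear S"
    unfolding S_def by (rule clinear_sub[OF _ clinear_flip]) (simp add: clinear_iff)
  note lin = clinear_compose[OF clinear_cojac2(1) S] clinear_compose[OF clinear_cojac2(2) S]
    clinear_compose[OF clinear_cyb2(1) S] clinear_compose[OF clinear_cyb2(2) S]
  have l: "clinear (\<lambda>t. cojac2 br x (S t) (S t') + cojac2 br x (S t') (S t))"
    "clinear (\<lambda>t'. cojac2 br x (S t) (S t') + cojac2 br x (S t') (S t))"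
    "clinear (\<lambda>t. tens_act (br x) (adj_act br x) (cyb2 br (S t) (S t') + cyb2 br (S t') (S t)))"
    "clinear (\<lambda>t'. tens_act (br x) (adj_act br x) (cyb2 br (S t) (S t') + cyb2 br (S t') (S t)))"
    for t t'
    by (intro clinear_plus lin clinear_compose[OF clinear_tens_act])+
  show ?thesis
  proof (rule bilinear_eqI[of "\<lambda>t t'. cojac2 br x (S t) (S t') + cojac2 br x (S t') (S t)"
      "\<lambda>t t'. tens_act (br x) (adj_act br x) (cyb2 br (S t) (S t') + cyb2 br (S t') (S t))", OF l])
    fix p p' :: "'a \<times> 'a"
    obtain i j where p: "p = (i, j)" by (cases p)
    obtain k l where p': "p' = (k, l)" by (cases p')
    define a b c d where abcd: "a = bvec i" "b = bvec j" "c = bvec k" "d = bvec l"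
    have St: "S (bvec p) = a \<otimes>\<^sub>t b - b \<otimes>\<^sub>t a" "S (bvec p') = c \<otimes>\<^sub>t d - d \<otimes>\<^sub>t c"
      by (simp_all add: S_def p p' abcd flip_def)
    \<comment> \<open>These instances are oriented so that the entry built from \<open>a\<close> or
      \<open>b\<close> comes first, which gives every bracket one normal form.\<close>
    note anti = lie_anticomm[OF br, of c a] lie_anticomm[OF br, of c b] lie_anticomm[OF br, of d a]
      lie_anticomm[OF br, of d b] lie_anticomm[OF br, of "br x c"] lie_anticomm[OF br, of "br x d"]
      lie_anticomm[OF br, of c "br x a"] lie_anticomm[OF br, of c "br x b"]
      lie_anticomm[OF br, of d "br x a"] lie_anticomm[OF br, of d "br x b"]
    note jac = lie_jacobi[OF br, of x a] lie_jacobi[OF br, of x b]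
    note tl = clinear_add[OF clinear_tens_left] clinear_add[OF clinear_tens_right]
      clinear_minus[OF clinear_tens_left] clinear_minus[OF clinear_tens_right]
    note act = tens_act_tens[OF lie_algebraD(1)[OF br] clinear_adj_act] adj_act_tens[OF br]
    have cyb: "cyb2 br (S (bvec p)) (S (bvec p')) + cyb2 br (S (bvec p')) (S (bvec p)) =
      (let C = \<lambda>a b c d. br a c \<otimes>\<^sub>t b \<otimes>\<^sub>t d + a \<otimes>\<^sub>t br b c \<otimes>\<^sub>t d + a \<otimes>\<^sub>t c \<otimes>\<^sub>t br b d in
       C a b c d - C a b d c - C b a c d + C b a d c + C c d a b - C c d b a - C d c a b + C d c b a)"
      unfolding St Let_def
      by (simp add: clinear_diff[OF clinear_cyb2(1)] clinear_diff[OF clinear_cyb2(2)] abcd cyb2_bvec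
          del: tens_bvec)
    show "cojac2 br x (S (bvec p)) (S (bvec p')) + cojac2 br x (S (bvec p')) (S (bvec p)) =
      tens_act (br x) (adj_act br x) (cyb2 br (S (bvec p)) (S (bvec p')) + cyb2 br (S (bvec p')) (S (bvec p)))"
      unfolding cyb unfolding St
      by (simp add: clinear_diff[OF clinear_cojac2(1)] clinear_diff[OF clinear_cojac2(2)]
        cojac2_tens[OF br] Let_def rot_tens clinear_add[OF clinear_rot]
        clinear_add[OF clinear_tens_act] clinear_diff[OF clinear_tens_act] clinear_minus[OF clinear_tens_act]
        act tl jac anti clinear_minus[OF clinear_rot] clinear_diff[OF clinear_rot] del: tens_bvec)
  qed
qed

text \<open>The case of equal arguments in \<open>cojac2_polarised\<close> is this identity doubled.
  Its right-hand side is the action of \<open>x\<close> on c(r), so the co-Jacobi identity says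
  precisely that c(r) is invariant.\<close>

lemma cojacobi_coboundary:
  assumes br: "lie_algebra br" and r: "skew r" and \<Delta>: "\<And>y. \<Delta> y = adj_act br y r"
  shows "(let u = tens_map id \<Delta> (\<Delta> x) in u + rot u + rot (rot u))
    = tens_act (br x) (adj_act br x) (cyb br r)"
proof -
  obtain t where t: "r = t - flip t" using r by (auto simp: skew_iff_range)
  have eq: "\<Delta> = (\<lambda>y. adj_act br y r)" using \<Delta> by auto
  have "cyb br r = cyb2 br r r" by (simp add: cyb_def cyb2_def)
  moreover have "scl 2 (cojac2 br x r r) = scl 2 (tens_act (br x) (adj_act br x) (cyb2 br r r))"
  proof -
    have two: "scl 2 w = w + w" for w :: "'z \<Rightarrow>\<^sub>0 complex"
      by (rule poly_mapping_eqI) (simp add: lookup_add)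
    show ?thesis
      using cojac2_polarised[OF br, of x t t]
      by (simp add: two t[symmetric] clinear_add[OF clinear_tens_act])
  qed
  then have "scl (1/2) (scl 2 (cojac2 br x r r))
      = scl (1/2) (scl 2 (tens_act (br x) (adj_act br x) (cyb2 br r r)))" by simp
  ultimately show ?thesis
    by (simp add: scl_scl eq cojac2_def)
qed


section \<open>Finitely supported functions on the lattice\<close>

text \<open>Only nonvanishing is transported by the hypothesis, so relations that hold up to a
  nonzero scalar suffice. One nonzero value would spread along the infinite ray \<open>k\<close>,
  \<open>k - a\<close>, \<open>k - 2 a\<close> and so on.\<close>

lemma finite_shift_eq_0:
  fixes f :: "int \<times> int \<Rightarrow> complex"
  assumes "finite {k. f k \<noteq> 0}" "a \<noteq> 0" "\<And>k. f k \<noteq> 0 \<Longrightarrow> f (k - a) \<noteq> 0"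
  shows "f k = 0"
proof (rule ccontr)
  assume "f k \<noteq> 0"
  define p where "p = (\<lambda>n::nat. k - (int n * fst a, int n * snd a))"
  have "f (p n) \<noteq> 0" for n
  proof (induction n)
    case (Suc n)
    have "p (Suc n) = p n - a" by (auto simp: p_def prod_eq_iff algebra_simps)
    with assms(3)[OF Suc] show ?case by simp
  qed (use \<open>f k \<noteq> 0\<close> in \<open>simp add: p_def zero_prod_def[symmetric]\<close>)
  then have "range p \<subseteq> {k. f k \<noteq> 0}" by auto
  moreover have "inj p" using \<open>a \<noteq> 0\<close> by (auto simp: inj_on_def p_def prod_eq_iff)
  ultimately show False
    using assms(1) finite_subset finite_imageD infinite_UNIV_nat by blast
qed

lemma escape_finite:
  fixes S :: "(int \<times> int) set"
  assumes "finite S" "b \<noteq> 0"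
  obtains n where "n > 0" "k + (int n * fst b, int n * snd b) \<notin> S"
proof -
  define p where "p = (\<lambda>n::nat. k + (int n * fst b, int n * snd b))"
  have "inj p" using \<open>b \<noteq> 0\<close> by (auto simp: inj_on_def p_def prod_eq_iff)
  then have "finite (p -` S)" using assms(1) by (rule finite_vimageI[rotated])
  then have "\<exists>n. n \<notin> insert 0 (p -` S)"
    by (intro ex_new_if_finite infinite_UNIV_nat) simp
  then show ?thesis using that by (auto simp: p_def)
qed

text \<open>The determinant up to sign, hence nonzero exactly for linearly independent
  \<open>a\<close> and \<open>b\<close>.\<close>

definition pairing :: "int \<times> int \<Rightarrow> int \<times> int \<Rightarrow> int" where
  "pairing a b = snd a * fst b - fst a * snd b"

lemma escape_finite_transversal:
  assumes "finite S" "b \<noteq> 0"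
  obtains a where "pairing a b \<noteq> 0" "k + a \<notin> S"
proof -
  \<comment> \<open>This is \<open>b\<close> rotated by a right angle; its pairing with
    \<open>b\<close> is the squared length of \<open>b\<close>.\<close>
  have "(- snd b, fst b) \<noteq> 0" using assms(2) by (auto simp: prod_eq_iff)
  from escape_finite[OF assms(1) this, of k] obtain n
    where n: "n > 0" "k + (int n * - snd b, int n * fst b) \<notin> S" by auto
  have "fst b * fst b + snd b * snd b \<noteq> 0"
    using assms(2) by (simp add: prod_eq_iff sum_squares_eq_zero_iff)
  moreover have "pairing (int n * - snd b, int n * fst b) b = int n * (fst b * fst b + snd b * snd b)"
    by (simp add: pairing_def algebra_simps)
  ultimately have "pairing (int n * - snd b, int n * fst b) b \<noteq> 0" using n(1) by simp
  with n(2) show ?thesis by (intro that)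
qed

text \<open>Closedness makes the row sums of \<open>f\<close> independent of the row, hence zero, so that the partial
  row sums define a finitely supported potential.\<close>

lemma closed_form_exact:
  fixes f g :: "int \<times> int \<Rightarrow> complex"
  assumes f: "finite {k. f k \<noteq> 0}" and g: "finite {k. g k \<noteq> 0}"
    and closed: "\<And>k. g k - g (k - (1, 0)) = f k - f (k - (0, 1))"
  obtains \<rho> where "finite {k. \<rho> k \<noteq> 0}" "\<And>k. f k = \<rho> (k - (1, 0)) - \<rho> k"
proof -
  define K where "K = fst ` ({k. f k \<noteq> 0} \<union> {k. g k \<noteq> 0} \<union> (\<lambda>k. k + (1, 0)) ` {k. g k \<noteq> 0})"
  have "finite K" unfolding K_def using f g by auto
  define N where "N = Max (abs ` K)"
  have N: "\<bar>i\<bar> \<le> N" if "i \<in> K" for i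
    unfolding N_def using \<open>finite K\<close> that by (intro Max_ge) auto
  \<comment> \<open>The margin keeps \<open>{-N..N}\<close> inside the interval even after it is
    shifted down by one.\<close>
  define I where "I = {-N-1..N+1}"
  have f0: "f (i, j) = 0" if "\<bar>i\<bar> > N" for i j
  proof (rule ccontr)
    assume "f (i, j) \<noteq> 0"
    then have "i \<in> K" unfolding K_def by force
    with N that show False by force
  qed
  have g0: "g (i, j) = 0" if "\<bar>i\<bar> > N" for i j
  proof (rule ccontr)
    assume "g (i, j) \<noteq> 0"
    then have "i \<in> K" unfolding K_def by force
    with N that show False by force
  qed
  define S where "S = (\<lambda>j. \<Sum>i\<in>I. f (i, j))"
  define \<rho> where "\<rho> = (\<lambda>(i, j). \<Sum>m\<in>{m\<in>I. m > i}. f (m, j))"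
  have fI: "finite I" by (simp add: I_def)
  have Sc: "S j = S (j - 1)" for j
  proof -
    have "f (i, j) - f (i, j - 1) = g (i, j) - g (i - 1, j)" for i
      using closed[of "(i, j)"] by simp
    then have "S j - S (j - 1) = (\<Sum>i\<in>I. g (i, j) - g (i - 1, j))"
      by (simp only: S_def sum_subtractf[symmetric])
    also have "\<dots> = (\<Sum>i\<in>I. g (i, j)) - (\<Sum>i\<in>(\<lambda>i. i - 1) ` I. g (i, j))"
      by (simp add: sum_subtractf sum.reindex inj_on_def)
    also have "(\<Sum>i\<in>(\<lambda>i. i - 1) ` I. g (i, j)) = (\<Sum>i\<in>{-N..N}. g (i, j))"
      by (rule sum.mono_neutral_right) (auto simp: I_def image_iff intro!: g0 bexI[of _ "_ + 1"])
    also have "(\<Sum>i\<in>I. g (i, j)) = (\<Sum>i\<in>{-N..N}. g (i, j))"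
      by (rule sum.mono_neutral_right) (auto simp: I_def intro!: g0)
    finally show ?thesis by simp
  qed
  have "finite {j. S j \<noteq> 0}"
  proof (rule finite_subset)
    show "{j. S j \<noteq> 0} \<subseteq> snd ` {k. f k \<noteq> 0}"
      unfolding S_def by (auto elim!: sum.not_neutral_contains_not_neutral simp: image_iff)
  qed (use f in simp)
  \<comment> \<open>The row sums are placed on one axis of the lattice, so that the two-dimensional
    \<open>finite_shift_eq_0\<close> applies to them.\<close>
  define T where "T = (\<lambda>k :: int \<times> int. if fst k = 0 then S (snd k) else 0)"
  have "finite {k. T k \<noteq> 0}"
    by (rule finite_subset[OF _ finite_imageI[OF \<open>finite {j. S j \<noteq> 0}\<close>, of "\<lambda>j. (0, j)"]])
       (auto simp: T_def image_iff prod_eq_iff split: if_splits)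
  moreover have "T (k - (0, 1)) = T k" for k
    using Sc[of "snd k"] by (simp add: T_def)
  ultimately have "T (0, j) = 0" for j
    using finite_shift_eq_0[of T "(0, 1)" "(0, j)"] by (simp add: prod_eq_iff)
  then have "S j = 0" for j by (simp add: T_def)
  note S0 = this
  have step: "f (i, j) = \<rho> (i - 1, j) - \<rho> (i, j)" for i j
  proof (cases "i \<in> I")
    case True
    then have "{m\<in>I. m > i - 1} = insert i {m\<in>I. m > i}" by auto
    then show ?thesis using fI by (simp add: \<rho>_def)
  next
    case False
    have "{m\<in>I. m > i - 1} = {m\<in>I. m > i}" using False by (auto simp: I_def)
    moreover have "f (i, j) = 0" using False by (intro f0) (auto simp: I_def)
    ultimately show ?thesis by (simp add: \<rho>_def)
  qed
  have "{k. \<rho> k \<noteq> 0} \<subseteq> I \<times> snd ` {k. f k \<noteq> 0}"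
  proof safe
    fix i j assume ne: "\<rho> (i, j) \<noteq> 0"
    show "j \<in> snd ` {k. f k \<noteq> 0}"
      using ne unfolding \<rho>_def by (auto elim!: sum.not_neutral_contains_not_neutral simp: image_iff)
    show "i \<in> I"
    proof (rule ccontr)
      assume "i \<notin> I"
      \<comment> \<open>To the right of \<open>I\<close> the tail sum is empty; to the left it is a
        full row sum, which vanishes.\<close>
      then have "{m\<in>I. m > i} = I \<or> {m\<in>I. m > i} = {}" by (auto simp: I_def)
      moreover have "\<rho> (i, j) = (\<Sum>m\<in>{m\<in>I. m > i}. f (m, j))" by (simp add: \<rho>_def)
      ultimately have "\<rho> (i, j) = S j \<or> \<rho> (i, j) = 0" by (metis S_def sum.empty)
      with ne S0 show False by simp
    qed
  qed
  then have "finite {k. \<rho> k \<noteq> 0}"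
    by (rule finite_subset) (use fI f in auto)
  moreover have "f k = \<rho> (k - (1, 0)) - \<rho> k" for k
    using step[of "fst k" "snd k"] by (cases k) simp
  ultimately show ?thesis by (rule that)
qed


section \<open>Lie algebras of the type of the extended affine algebra\<close>

text \<open>If \<open>q\<close> is the square of \<open>s\<close>, the monomials X_a = s^(a1 a2)
  x^a1 y^a2 multiply by X_a X_b = s^(pairing a b) X_(a+b).\<close>

definition str_const :: "complex \<Rightarrow> int \<times> int \<Rightarrow> int \<times> int \<Rightarrow> complex" where
  "str_const s a b = s powi pairing a b"

lemma str_const_simps [simp]: "str_const s a a = 1" "str_const s a 0 = 1" "str_const s 0 a = 1"
    "str_const s a (k - a) = str_const s a k" "str_const s a (k + a) = str_const s a k"
    "str_const s (k - a) a = str_const s k a" "str_const s (k + a) a = str_const s k a"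
    "str_const s a (a - k) = str_const s k a" "str_const s (a - k) a = str_const s a k"
    "str_const s a (- k) = str_const s k a" "str_const s (- k) a = str_const s a k"
    "str_const s a (a + k) = str_const s a k" "str_const s (a + k) a = str_const s k a"
  by (simp_all add: str_const_def pairing_def algebra_simps)

text \<open>The lattice as Gaussian integers: an injective additive map, so that one element can
  have a different eigenvalue in each degree.\<close>

definition degree_value :: "int \<times> int \<Rightarrow> complex" where
  "degree_value k = of_int (fst k) + \<i> * of_int (snd k)"

text \<open>
  The data consist of spanning families \<open>E\<close>, \<open>F\<close>, \<open>G\<close>, \<open>H\<close>, \<open>D1\<close>, \<open>D2\<close> together with coordinate
  functionals. With \<open>s\<^sup>2 = q\<close>, \<open>E a\<close> and \<open>F a\<close> are \<open>s powi (fst a * snd a)\<close> times the basis vectors of degree \<open>a\<close>,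
  which makes the structure constants symmetric; \<open>G a\<close> and \<open>H a\<close> are likewise the diagonal elements,
  except that \<open>G 0 = d / 2\<close> and \<open>H 0 = - d / 2\<close>. The element \<open>h\<close> is a combination of \<open>d\<close>, \<open>D1\<close>, \<open>D2\<close>
  whose eigenvalues separate all the degrees and root weights that occur.
\<close>

locale torus_sl2 =
  fixes br :: "('b \<Rightarrow>\<^sub>0 complex) \<Rightarrow> ('b \<Rightarrow>\<^sub>0 complex) \<Rightarrow> ('b \<Rightarrow>\<^sub>0 complex)"
    and E F G H :: "int \<times> int \<Rightarrow> ('b \<Rightarrow>\<^sub>0 complex)" and D1 D2 h :: "'b \<Rightarrow>\<^sub>0 complex"
    and E' F' G' H' :: "int \<times> int \<Rightarrow> ('b \<Rightarrow>\<^sub>0 complex) \<Rightarrow> complex"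
    and D1' D2' :: "('b \<Rightarrow>\<^sub>0 complex) \<Rightarrow> complex" and s \<eta> :: complex
  assumes lie: "lie_algebra br"
    and s_nonzero: "s \<noteq> 0" and s_not_root: "\<And>n::nat. n > 0 \<Longrightarrow> s ^ n \<noteq> 1"
    and eta: "\<And>k (j::int). degree_value k + of_int j * \<eta> = 0 \<Longrightarrow> \<bar>j\<bar> \<le> 3 \<Longrightarrow> k = 0 \<and> j = 0"
    and lfuns: "lfun (E' k)" "lfun (F' k)" "lfun (G' k)" "lfun (H' k)" "lfun D1'" "lfun D2'"
    and coordinates: "\<And>i. \<exists>c. \<exists>\<phi> \<in> range E' \<union> range F' \<union> range G' \<union> range H' \<union> {D1', D2'}.
      \<forall>u. Poly_Mapping.lookup u i = c * \<phi> u"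
    and finite_coordinates: "finite {k. E' k u \<noteq> 0}" "finite {k. F' k u \<noteq> 0}"
      "finite {k. G' k u \<noteq> 0}" "finite {k. H' k u \<noteq> 0}"
    and G'_0: "H' 0 u = - G' 0 u"
    and E'_br: "E' k (br (E a) u) = str_const s a k * H' (k - a) u - str_const s k a * G' (k - a) u
        - (if k = a then of_int (fst a) * D1' u + of_int (snd a) * D2' u else 0)"
      "E' k (br (F a) u) = 0"
      "E' k (br (G a) u) = str_const s a k * E' (k - a) u"
      "E' k (br (H a) u) = - str_const s k a * E' (k - a) u"
      "E' k (br h u) = (degree_value k + \<eta>) * E' k u"
    and F'_br: "F' k (br (F a) u) = str_const s a k * G' (k - a) u - str_const s k a * H' (k - a) u
        - (if k = a then of_int (fst a) * D1' u + of_int (snd a) * D2' u else 0)"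
      "F' k (br (E a) u) = 0"
      "F' k (br (H a) u) = str_const s a k * F' (k - a) u"
      "F' k (br (G a) u) = - str_const s k a * F' (k - a) u"
      "F' k (br h u) = (degree_value k - \<eta>) * F' k u"
    and G'_br: "G' k (br (E a) u) = str_const s a k * F' (k - a) u"
      "G' k (br (F a) u) = - str_const s k a * E' (k - a) u"
      "G' k (br (G a) u) = (str_const s a k - str_const s k a) * G' (k - a) u
        - (if k = a then of_int (fst a) * D1' u + of_int (snd a) * D2' u else 0)"
      "G' k (br (H a) u) = 0"
      "G' k (br h u) = degree_value k * G' k u"
    and H'_br: "H' k (br (F a) u) = str_const s a k * E' (k - a) u"
      "H' k (br (E a) u) = - str_const s k a * F' (k - a) u"
      "H' k (br (H a) u) = (str_const s a k - str_const s k a) * H' (k - a) u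
        - (if k = a then of_int (fst a) * D1' u + of_int (snd a) * D2' u else 0)"
      "H' k (br (G a) u) = 0"
      "H' k (br h u) = degree_value k * H' k u"
    and D'_br: "D1' (br x u) = 0" "D2' (br x u) = 0"
    and brackets: "br (G a) (E b) = scl (str_const s a b) (E (a + b))"
      "br (H a) (E b) = scl (- str_const s b a) (E (a + b))"
      "br (G a) (F b) = scl (- str_const s b a) (F (a + b))"
      "br (H a) (F b) = scl (str_const s a b) (F (a + b))"
      "br (G a) (H b) = 0"
      "br (E a) (F b) = scl (str_const s a b) (G (a + b)) - scl (str_const s b a) (H (a + b))"
      "br D1 (E a) = scl (of_int (fst a)) (E a)" "br D1 (F a) = scl (of_int (fst a)) (F a)"
      "br D2 (E a) = scl (of_int (snd a)) (E a)" "br D2 (F a) = scl (of_int (snd a)) (F a)"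
    and br_h: "br h (E a) = scl (degree_value a + \<eta>) (E a)" "br h (F a) = scl (degree_value a - \<eta>) (F a)"
      "br h (G a) = scl (degree_value a) (G a)" "br h (H a) = scl (degree_value a) (H a)"
      "br h D1 = 0" "br h D2 = 0"
    and spanning: "\<And>i. \<exists>z. \<exists>x \<in> range E \<union> range F \<union> range G \<union> range H \<union> {D1, D2}. bvec i = scl z x"
    and E'_values: "E' k (E a) = (if k = a then 1 else 0)" "E' k (F a) = 0" "E' k (G a) = 0"
      "E' k (H a) = 0" "E' k D1 = 0" "E' k D2 = 0"
    and F'_values: "F' k (F a) = (if k = a then 1 else 0)" "F' k (E a) = 0" "F' k (G a) = 0"
      "F' k (H a) = 0" "F' k D1 = 0" "F' k D2 = 0"
    and G'_values: "G' k (G a) = (if k = a then if a = 0 then 1/2 else 1 else 0)" "G' k (E a) = 0"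
      "G' k (F a) = 0" "G' k (H a) = (if k = 0 \<and> a = 0 then -1/2 else 0)" "G' k D1 = 0" "G' k D2 = 0"
    and H'_values: "H' k (H a) = (if k = a then if a = 0 then 1/2 else 1 else 0)" "H' k (E a) = 0"
      "H' k (F a) = 0" "H' k (G a) = (if k = 0 \<and> a = 0 then -1/2 else 0)" "H' k D1 = 0" "H' k D2 = 0"
    and D'_values: "D1' (E a) = 0" "D1' (F a) = 0" "D1' (G a) = 0" "D1' (H a) = 0" "D1' D1 = 1"
      "D1' D2 = 0" "D2' (E a) = 0" "D2' (F a) = 0" "D2' (G a) = 0" "D2' (H a) = 0" "D2' D1 = 0" "D2' D2 = 1"
begin

text \<open>Exchanging the two matrix indices preserves the axioms and negates the root value
  \<eta>. Every result on \<open>E\<close> and \<open>G\<close> thereby yields one on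
  \<open>F\<close> and \<open>H\<close>.\<close>

lemma swap: "torus_sl2 br F E H G D1 D2 h F' E' H' G' D1' D2' s (- \<eta>)"
proof -
  have 1: "br (F a) (E b) = scl (str_const s a b) (H (a + b)) - scl (str_const s b a) (G (a + b))" for a b
    using lie_anticomm[OF lie, of "F a" "E b"] by (simp add: brackets add.commute)
  have 2: "br (H a) (G b) = 0" for a b
    using lie_anticomm[OF lie, of "H a" "G b"] by (simp add: brackets)
  have 3: "k = 0 \<and> j = 0" if "degree_value k + of_int j * - \<eta> = 0" "\<bar>j\<bar> \<le> 3" for k and j :: int
    using eta[of k "- j"] that by simp
  have 4: "\<exists>c. \<exists>\<phi> \<in> range F' \<union> range E' \<union> range H' \<union> range G' \<union> {D1', D2'}.
      \<forall>u. Poly_Mapping.lookup u i = c * \<phi> u" for i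
    using coordinates[of i] by blast
  have 5: "\<exists>z. \<exists>x \<in> range F \<union> range E \<union> range H \<union> range G \<union> {D1, D2}. bvec i = scl z x" for i
    using spanning[of i] by blast
  show ?thesis
    by (unfold_locales; (rule 3 4 5 lie s_not_root; assumption?)?)
      (simp_all add: 1 2 s_nonzero lfuns finite_coordinates G'_0 E'_br F'_br
        G'_br H'_br D'_br brackets br_h E'_values F'_values G'_values H'_values D'_values)
qed

section \<open>Arithmetic of the structure constants\<close>

abbreviation c :: "int \<times> int \<Rightarrow> int \<times> int \<Rightarrow> complex" where
  "c \<equiv> str_const s"

lemma c_nonzero [simp]: "c a b \<noteq> 0"
  using s_nonzero by (simp add: str_const_def)

lemmas c_simps = str_const_simps[of s]

lemma c_add: "c (a + b) k = c a k * c b k" "c k (a + b) = c k a * c k b"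
    "c (a - b) k = c a k * c k b" "c k (a - b) = c k a * c b k"
  using s_nonzero by (simp_all add: str_const_def pairing_def power_int_add[symmetric] algebra_simps)

lemma c_inverse: "c a b * c b a = 1" "c b a = inverse (c a b)"
proof -
  show "c a b * c b a = 1"
    using s_nonzero by (simp add: str_const_def pairing_def power_int_add[symmetric] algebra_simps)
  then show "c b a = inverse (c a b)" by (simp add: inverse_unique)
qed

text \<open>Equality makes \<open>s powi (2 * pairing a b)\<close> equal to 1; that \<open>s\<close>
  is not a root of unity is decisive here.\<close>

lemma c_eq_iff: "c a b = c b a \<longleftrightarrow> pairing a b = 0"
proof
  assume "c a b = c b a"
  then have "c a b * c a b = 1" using c_inverse(1)[of a b] by simp
  then have "s powi (2 * pairing a b) = 1"
    using s_nonzero by (simp add: str_const_def power_int_add[symmetric])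
  then have "s ^ nat \<bar>2 * pairing a b\<bar> = 1"
    by (auto simp: power_int_def abs_if power_inverse split: if_splits)
  then show "pairing a b = 0" using s_not_root[of "nat \<bar>2 * pairing a b\<bar>"] by auto
qed (simp add: str_const_def pairing_def mult.commute)

lemmas linear_br = lie_algebraD(1)[OF lie]

lemma tfun_adj:
  assumes "lfun \<phi>" "lfun \<psi>"
  shows "tfun \<phi> \<psi> (adj_act br x v) = tfun (\<lambda>u. \<phi> (br x u)) \<psi> v + tfun \<phi> (\<lambda>u. \<psi> (br x u)) v"
  unfolding adj_act_eq by (rule tfun_tens_act[OF linear_br linear_br assms])

lemmas dual_br = E'_br F'_br G'_br H'_br D'_br
lemmas dual_values = E'_values F'_values G'_values H'_values D'_values
lemmas act_simps = tfun_adj lfuns dual_br tfun_left tfun_right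

lemma tfun_H'_0: "tfun (H' 0) \<psi> v = - tfun (G' 0) \<psi> v" "tfun \<phi> (H' 0) w = - tfun \<phi> (G' 0) w"
proof -
  have "H' 0 = (\<lambda>u. - G' 0 u)" by (rule ext) (rule G'_0)
  then show "tfun (H' 0) \<psi> v = - tfun (G' 0) \<psi> v" "tfun \<phi> (H' 0) w = - tfun \<phi> (G' 0) w"
    by (simp_all add: tfun_left tfun_right)
qed

section \<open>Finite supports and invariants\<close>

lemma finite_left_support:
  "finite {k. E' k u \<noteq> 0 \<or> F' k u \<noteq> 0 \<or> G' k u \<noteq> 0 \<or> H' k u \<noteq> 0}"
  by (rule finite_subset[of _ "{k. E' k u \<noteq> 0} \<union> {k. F' k u \<noteq> 0} \<union> {k. G' k u \<noteq> 0} \<union> {k. H' k u \<noteq> 0}"])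
     (auto simp: finite_coordinates)

text \<open>The left legs of \<open>v\<close> involve finitely many degrees. That \<open>S\<close>
  does not depend on \<psi> matters in \<open>no_invariants\<close>, where \<psi> is composed with
  the action of elements of varying degree.\<close>

lemma left_support:
  fixes v :: "'b \<times> 'c \<Rightarrow>\<^sub>0 complex"
  obtains S where "finite S" "\<And>k \<psi>. k \<notin> S \<Longrightarrow>
    tfun (E' k) \<psi> v = 0 \<and> tfun (F' k) \<psi> v = 0 \<and> tfun (G' k) \<psi> v = 0 \<and> tfun (H' k) \<psi> v = 0"
proof -
  define A where "A = (\<lambda>u. {k. E' k u \<noteq> 0 \<or> F' k u \<noteq> 0 \<or> G' k u \<noteq> 0 \<or> H' k u \<noteq> 0})"
  define S where "S = (\<Union>p\<in>Poly_Mapping.keys v. A (bvec (fst p)))"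
  have "finite S" unfolding S_def A_def using finite_left_support by (intro finite_UN_I) auto
  moreover have "tfun (E' k) \<psi> v = 0 \<and> tfun (F' k) \<psi> v = 0 \<and> tfun (G' k) \<psi> v = 0 \<and> tfun (H' k) \<psi> v = 0"
    if "k \<notin> S" for k \<psi>
  proof -
    have "tfun \<phi> \<psi> v = 0" if "\<And>u. \<phi> u \<noteq> 0 \<Longrightarrow> k \<in> A u" for \<phi>
      using tfun_nonzero_ex[of \<phi> \<psi> v] that \<open>k \<notin> S\<close> unfolding S_def by blast
    then show ?thesis by (simp add: A_def)
  qed
  ultimately show ?thesis by (rule that)
qed

lemma tensor_eq_0I:
  fixes v :: "'b \<times> 'c \<Rightarrow>\<^sub>0 complex"
  assumes "\<And>\<phi> j. \<phi> \<in> range E' \<union> range F' \<union> range G' \<union> range H' \<union> {D1', D2'} \<Longrightarrow>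
    tfun \<phi> (\<lambda>u. Poly_Mapping.lookup u j) v = 0"
  shows "v = 0"
proof (rule poly_mapping_eqI)
  fix p :: "'b \<times> 'c"
  obtain i j where p: "p = (i, j)" by (cases p)
  obtain b \<phi> where \<phi>: "\<phi> \<in> range E' \<union> range F' \<union> range G' \<union> range H' \<union> {D1', D2'}"
    "\<And>u. Poly_Mapping.lookup u i = b * \<phi> u" using coordinates[of i] by blast
  have "Poly_Mapping.lookup v p = tfun (\<lambda>u. b * \<phi> u) (\<lambda>u. Poly_Mapping.lookup u j) v"
    unfolding p tfun_lookup[symmetric] \<phi>(2) ..
  then show "Poly_Mapping.lookup v p = Poly_Mapping.lookup 0 p"
    by (simp add: tfun_left assms[OF \<phi>(1)])
qed

text \<open>Acting by elements of large degree moves the left tensor factor out of the finite support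
  of \<open>v\<close>, so that only the term acting on the left factor survives.\<close>

lemma no_invariants:
  fixes v :: "'b \<times> 'c \<Rightarrow>\<^sub>0 complex"
  assumes A: "\<And>x. clinear (A x)"
    and E: "\<And>a. tens_act (br (E a)) (A (E a)) v = 0" and F: "\<And>a. tens_act (br (F a)) (A (F a)) v = 0"
  shows "v = 0"
proof (rule tensor_eq_0I)
  fix \<phi> j assume \<phi>: "\<phi> \<in> range E' \<union> range F' \<union> range G' \<union> range H' \<union> {D1', D2'}"
  define \<psi> :: "('c \<Rightarrow>\<^sub>0 complex) \<Rightarrow> complex" where "\<psi> = (\<lambda>u. Poly_Mapping.lookup u j)"
  have \<psi>: "lfun \<psi>" unfolding \<psi>_def by (rule lfun_lookup)
  obtain S where S: "finite S" and S0: "\<And>k \<psi>. k \<notin> S \<Longrightarrow>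
    tfun (E' k) \<psi> v = 0 \<and> tfun (F' k) \<psi> v = 0 \<and> tfun (G' k) \<psi> v = 0 \<and> tfun (H' k) \<psi> v = 0"
    using left_support[of v] by blast
  have act: "tfun (\<lambda>u. \<phi> (br (E a) u)) \<psi> v + tfun \<phi> (\<lambda>u. \<psi> (A (E a) u)) v = 0"
    "tfun (\<lambda>u. \<phi> (br (F a) u)) \<psi> v + tfun \<phi> (\<lambda>u. \<psi> (A (F a) u)) v = 0" if "lfun \<phi>" for \<phi> a
    using tfun_tens_act[OF linear_br A that \<psi>, of "E a" "E a" v] E[of a]
      tfun_tens_act[OF linear_br A that \<psi>, of "F a" "F a" v] F[of a]
    by (simp_all add: tfun_simps)
  have 1: "tfun (E' k) \<psi> v = 0" "tfun (F' k) \<psi> v = 0" for k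
  proof -
    obtain a where a: "k + a \<notin> S"
      by (rule escape_finite[OF S, of "(1, 0)" k]) (simp_all add: prod_eq_iff)
    show "tfun (E' k) \<psi> v = 0"
      using act(2)[of "G' (k + a)" a] S0[OF a] by (simp add: lfuns dual_br tfun_left)
    show "tfun (F' k) \<psi> v = 0"
      using act(1)[of "G' (k + a)" a] S0[OF a] by (simp add: lfuns dual_br tfun_left)
  qed
  have 2: "tfun (G' k) \<psi> v = 0 \<and> tfun (H' k) \<psi> v = 0" if "k \<noteq> 0" for k
  proof -
    \<comment> \<open>The two relations below combine to a multiplication by squares of
      \<open>c a k\<close> and \<open>c k a\<close>, that is, by the constants for
      \<open>k + k\<close>.\<close>
    have "k + k \<noteq> 0" using that by (cases k) (simp add: zero_prod_def)
    then obtain a where a: "pairing a (k + k) \<noteq> 0" "k + a \<notin> S"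
      using escape_finite_transversal[OF S] by blast
    define g where "g = tfun (G' k) \<psi> v"
    define f where "f = tfun (H' k) \<psi> v"
    have eq: "c a k * f = c k a * g" "c a k * g = c k a * f"
      using act(1)[of "E' (k + a)" a] act(2)[of "F' (k + a)" a] S0[OF a(2)] that
      by (simp_all add: lfuns dual_br tfun_left f_def g_def)
    have "c a k * c a k * f = c a k * (c k a * g)" by (simp add: eq(1) mult.assoc)
    also have "\<dots> = c k a * c k a * f" using eq(2) by (simp add: mult_ac)
    finally have "c a (k + k) * f = c (k + k) a * f" by (simp add: c_add)
    then have "f = 0" using a(1) c_eq_iff[of a "k + k"] by auto
    then show ?thesis using eq(1) by (simp add: f_def g_def)
  qed
  \<comment> \<open>\<open>E a\<close> and \<open>F a\<close> produce the same combination of the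
    \<open>D1'\<close> and \<open>D2'\<close> coefficients but opposite signs of the
    \<open>G' 0\<close> coefficient. The latter is therefore 0, and degrees on the two axes then
    separate \<open>D1'\<close> from \<open>D2'\<close>.\<close>
  have 3: "- 2 * tfun (G' 0) \<psi> v = of_int (fst a) * tfun D1' \<psi> v + of_int (snd a) * tfun D2' \<psi> v"
    "2 * tfun (G' 0) \<psi> v = of_int (fst a) * tfun D1' \<psi> v + of_int (snd a) * tfun D2' \<psi> v"
    if "a \<notin> S" for a
    using act(1)[of "E' a" a] act(2)[of "F' a" a] S0[OF that]
    by (simp_all add: lfuns dual_br tfun_left G'_0 algebra_simps)
  obtain m :: nat where m: "m > 0" "(int m, 0) \<notin> S"
    by (rule escape_finite[OF S, of "(1, 0)" 0]) (simp_all add: prod_eq_iff)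
  obtain n :: nat where n: "n > 0" "(0, int n) \<notin> S"
    by (rule escape_finite[OF S, of "(0, 1)" 0]) (simp_all add: prod_eq_iff)
  have "- 2 * tfun (G' 0) \<psi> v = 2 * tfun (G' 0) \<psi> v"
    by (rule trans[OF 3(1)[OF m(2)] 3(2)[OF m(2), symmetric]])
  then have "tfun (G' 0) \<psi> v = 0" by simp
  note G0 = this
  have 4: "tfun D1' \<psi> v = 0" "tfun D2' \<psi> v = 0"
    using 3(2)[OF m(2)] 3(2)[OF n(2)] m(1) n(1) G0 by simp_all
  have 5: "tfun (G' k) \<psi> v = 0" "tfun (H' k) \<psi> v = 0" for k
    using 2[of k] G0 by (cases "k = 0"; simp add: tfun_H'_0)+
  have "tfun \<phi> \<psi> v = 0"
    using \<phi> by (elim UnE rangeE insertE emptyE) (simp_all add: 1 4 5)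
  then show "tfun \<phi> (\<lambda>u. Poly_Mapping.lookup u j) v = 0" by (simp add: \<psi>_def)
qed


section \<open>Components along opposite root vectors\<close>

definition hcocycle :: "(('b \<Rightarrow>\<^sub>0 complex) \<Rightarrow> ('b \<times> 'b \<Rightarrow>\<^sub>0 complex)) \<Rightarrow> bool" where
  "hcocycle D \<longleftrightarrow> skew_cocycle br D \<and> D h = 0"

lemma hcocycleD:
  assumes "hcocycle D"
  shows "clinear D" "skew (D x)" "D (br x y) = adj_act br x (D y) - adj_act br y (D x)" "D h = 0"
  using assms by (auto simp: hcocycle_def skew_cocycle_def)

lemma hcocycle_sub:
  "hcocycle D \<Longrightarrow> skew r \<Longrightarrow> adj_act br h r = 0 \<Longrightarrow> hcocycle (\<lambda>x. D x - adj_act br x r)"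
  by (simp add: hcocycle_def skew_cocycle_sub_inner[OF lie])

lemma finite_tfun_support:
  fixes v :: "'b \<times> 'c \<Rightarrow>\<^sub>0 complex"
  shows "finite {k. tfun (E' k) (\<psi> k) v \<noteq> 0}" "finite {k. tfun (F' k) (\<psi> k) v \<noteq> 0}"
    "finite {k. tfun (G' k) (\<psi> k) v \<noteq> 0}" "finite {k. tfun (H' k) (\<psi> k) v \<noteq> 0}"
proof -
  obtain S where S: "finite S" "\<And>k \<psi>. k \<notin> S \<Longrightarrow>
    tfun (E' k) \<psi> v = 0 \<and> tfun (F' k) \<psi> v = 0 \<and> tfun (G' k) \<psi> v = 0 \<and> tfun (H' k) \<psi> v = 0"
    using left_support[of v] by blast
  show "finite {k. tfun (E' k) (\<psi> k) v \<noteq> 0}" "finite {k. tfun (F' k) (\<psi> k) v \<noteq> 0}"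
    "finite {k. tfun (G' k) (\<psi> k) v \<noteq> 0}" "finite {k. tfun (H' k) (\<psi> k) v \<noteq> 0}"
    by (rule finite_subset[OF _ S(1)]; use S(2) in blast)+
qed

lemma adj_act_h_tens:
  "br h x = scl m x \<Longrightarrow> br h y = scl (- m) y \<Longrightarrow> adj_act br h (x \<otimes>\<^sub>t y) = 0"
  by (simp add: adj_act_tens[OF lie] clinear_scl[OF clinear_tens_left] clinear_scl[OF clinear_tens_right])
     (auto intro!: poly_mapping_eqI simp: lookup_add)

lemma adj_act_h_antisym: "adj_act br h t = 0 \<Longrightarrow> adj_act br h (t - flip t) = 0"
  by (simp add: clinear_diff[OF clinear_adj_act] flip_adj_act[OF lie, symmetric] clinear_0[OF clinear_flip])

lemma degree_value_simps: "degree_value (- k) = - degree_value k"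
  by (simp add: degree_value_def)

lemmas tfun_tens_simps = tfun_simps tfun_flip tfun_tens lfuns

text \<open>These are the coefficients through which the coboundary of an element of the exterior square of
  the span of \<open>d\<close>, \<open>D1\<close>, \<open>D2\<close> is read off.\<close>

definition normal_torus :: "(('b \<Rightarrow>\<^sub>0 complex) \<Rightarrow> ('b \<times> 'b \<Rightarrow>\<^sub>0 complex)) \<Rightarrow> bool" where
  "normal_torus D \<longleftrightarrow> tfun (E' 0) D1' (D (E 0)) = 0 \<and> tfun (E' 0) D2' (D (E 0)) = 0 \<and>
     tfun (G' (1, 0)) D2' (D (G (1, 0))) = 0"

lemma normalize_torus:
  assumes D: "hcocycle D"
  obtains r where "skew r" "adj_act br h r = 0" "normal_torus (\<lambda>x. D x - adj_act br x r)"
proof -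
  \<comment> \<open>The minus signs come from \<open>br (E 0) (G 0) = - E 0\<close> and
    \<open>br (G (1, 0)) D1 = - G (1, 0)\<close>.\<close>
  define t where "t = scl (- tfun (E' 0) D1' (D (E 0))) (G 0 \<otimes>\<^sub>t D1)
    + scl (- tfun (E' 0) D2' (D (E 0))) (G 0 \<otimes>\<^sub>t D2)
    + scl (- tfun (G' (1, 0)) D2' (D (G (1, 0)))) (D1 \<otimes>\<^sub>t D2)"
  define r where "r = t - flip t"
  have "br h (G 0) = scl 0 (G 0)" "br h D1 = scl 0 D1" "br h D2 = scl 0 D2"
    "br h D1 = scl (- 0) D1" "br h D2 = scl (- 0) D2"
    by (simp_all add: br_h degree_value_def)
  then have "adj_act br h t = 0"
    by (simp only: t_def clinear_add[OF clinear_adj_act] clinear_scl[OF clinear_adj_act]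
        adj_act_h_tens[where m = 0] scl_zero add_0_left)
  then have h: "adj_act br h r = 0" unfolding r_def by (rule adj_act_h_antisym)
  have "normal_torus (\<lambda>x. D x - adj_act br x r)"
    unfolding normal_torus_def
    by (simp add: tfun_simps act_simps)
       (simp add: r_def t_def tfun_tens_simps dual_values)
  with h show ?thesis by (intro that[of r]) (simp_all add: r_def skew_diff_flip)
qed

text \<open>A condition on later corrections: it ensures that subtracting their coboundaries
  preserves \<open>normal_torus\<close>.\<close>

definition no_D_legs :: "('b \<times> 'b \<Rightarrow>\<^sub>0 complex) \<Rightarrow> bool" where
  "no_D_legs r \<longleftrightarrow> (\<forall>\<psi>. lfun \<psi> \<longrightarrow> tfun D1' \<psi> r = 0 \<and> tfun D2' \<psi> r = 0 \<and> tfun \<psi> D1' r = 0 \<and> tfun \<psi> D2' r = 0)"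

lemma normal_torus_sub:
  "normal_torus D \<Longrightarrow> no_D_legs r \<Longrightarrow> normal_torus (\<lambda>x. D x - adj_act br x r)"
  unfolding normal_torus_def no_D_legs_def by (simp add: tfun_simps act_simps lfuns)

definition EF_free :: "(('b \<Rightarrow>\<^sub>0 complex) \<Rightarrow> ('b \<times> 'b \<Rightarrow>\<^sub>0 complex)) \<Rightarrow> bool" where
  "EF_free D \<longleftrightarrow> (\<forall>a k. tfun (E' k) (F' (a - k)) (D (G a)) = 0 \<and> tfun (E' k) (F' (a - k)) (D (H a)) = 0)"

lemma commute_GH:
  assumes D: "hcocycle D"
  shows "tfun \<phi> \<psi> (adj_act br (G a) (D (H b))) = tfun \<phi> \<psi> (adj_act br (H b) (D (G a)))"
  using hcocycleD(3)[OF D, of "G a" "H b"] by (simp add: brackets clinear_0[OF hcocycleD(1)[OF D]])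

text \<open>As \<open>G a\<close> and \<open>H b\<close> commute, \<open>G a\<close> acting on
  \<open>D (H b)\<close> equals \<open>H b\<close> acting on \<open>D (G a)\<close>. This is the
  coefficient at \<open>E' k\<close> and \<open>F' (a + b - k)\<close>.\<close>

lemma EF_relation:
  assumes D: "hcocycle D"
  defines "f \<equiv> \<lambda>a k. tfun (E' k) (F' (a - k)) (D (G a))"
    and "g \<equiv> \<lambda>a k. tfun (E' k) (F' (a - k)) (D (H a))"
  shows "c a k * g b (k - a) - c (b - k) a * g b k = c b (a - k) * f a k - c k b * f a (k - b)"
proof -
  have idx: "a + b - k - a = b - k" "a + b - k - b = a - k"
    "b - (k - a) = a + b - k" "a - (k - b) = a + b - k"
    by (simp_all add: algebra_simps)
  have cs: "c (a + b - k) a = c (b - k) a" "c b (a + b - k) = c b (a - k)"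
    using c_simps(13)[of a "b - k"] c_simps(5)[of b "a - k"] by (simp_all add: algebra_simps)
  show ?thesis
    using commute_GH[OF D, of "E' k" "F' (a + b - k)" a b]
    unfolding f_def g_def idx(3,4) by (simp add: act_simps idx(1,2) cs)
qed

text \<open>For equal degrees \<open>EF_relation\<close> says that \<open>t\<close> is invariant
  under the shift by \<open>a\<close>, so \<open>t\<close> vanishes. This eliminates the
  \<open>H\<close> family in favour of the \<open>G\<close> family.\<close>

lemma EF_relation_equal:
  assumes D: "hcocycle D" and a: "a \<noteq> 0"
  shows "tfun (E' k) (F' (a - k)) (D (H a)) = - c k a * c k a * tfun (E' k) (F' (a - k)) (D (G a))"
proof -
  define f where "f = (\<lambda>k. tfun (E' k) (F' (a - k)) (D (G a)))"
  define g where "g = (\<lambda>k. tfun (E' k) (F' (a - k)) (D (H a)))"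
  define t where "t = (\<lambda>k. c a k * g k + c k a * f k)"
  have "finite {k. t k \<noteq> 0}"
    by (rule finite_subset[of _ "{k. g k \<noteq> 0} \<union> {k. f k \<noteq> 0}"])
       (auto simp: t_def f_def g_def finite_tfun_support)
  moreover have "t (k - a) = t k" for k
    using EF_relation[OF D, of a k a] by (simp add: t_def f_def g_def algebra_simps)
  ultimately have "t k = 0" using finite_shift_eq_0[of t a k] a by simp
  then have "c a k * g k = - (c k a * f k)" by (simp add: t_def eq_neg_iff_add_eq_0)
  then have "c k a * c a k * g k = - c k a * c k a * f k" by (simp add: mult.assoc)
  then show ?thesis by (simp only: c_inverse(1) mult_1_left f_def g_def)
qed

text \<open>The closedness expresses that \<open>G a\<close> and \<open>H b\<close> commute.\<close>

lemma EF_closed: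
  assumes D: "hcocycle D" and ab: "a \<noteq> 0" "b \<noteq> 0"
  defines "\<phi> \<equiv> \<lambda>a k. c k a * tfun (E' k) (F' (a - k)) (D (G a))"
  shows "\<phi> b k - \<phi> b (k - a) = \<phi> a k - \<phi> a (k - b)"
proof -
  have f: "tfun (E' k) (F' (a - k)) (D (G a)) = c a k * \<phi> a k" for a k
    using c_inverse(1)[of a k] by (simp add: \<phi>_def mult.assoc[symmetric])
  have g: "tfun (E' k) (F' (a - k)) (D (H a)) = - c k a * \<phi> a k" if "a \<noteq> 0" for a k
    using EF_relation_equal[OF D that, of k] by (simp add: \<phi>_def)
  have "c a k * c k b * c b a * (\<phi> b k - \<phi> b (k - a)) = c a k * c k b * c b a * (\<phi> a k - \<phi> a (k - b))"
    using EF_relation[OF D, of a k b, unfolded f g[OF ab(2)]] by (simp add: c_add algebra_simps)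
  then show ?thesis by simp
qed

text \<open>The single element \<open>G (1, 0)\<close> controls all the others: once its components
  vanish, \<open>EF_relation\<close> makes those of every \<open>H b\<close>, and then of every
  \<open>G a\<close>, invariant up to nonzero scalars under the shift by (1, 0).\<close>

lemma EF_free_if:
  assumes D: "hcocycle D" and x: "\<And>k. tfun (E' k) (F' ((1, 0) - k)) (D (G (1, 0))) = 0"
  shows "EF_free D"
proof -
  let ?x = "(1, 0) :: int \<times> int"
  have nz: "?x \<noteq> 0" by (simp add: prod_eq_iff)
  have y: "tfun (E' k) (F' (?x - k)) (D (H ?x)) = 0" for k
    using EF_relation_equal[OF D nz, of k] x by simp
  have "tfun (E' k) (F' (b - k)) (D (H b)) = 0" for b k
  proof (rule finite_shift_eq_0[OF finite_tfun_support(1) nz])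
    show "tfun (E' (k - ?x)) (F' (b - (k - ?x))) (D (H b)) \<noteq> 0"
      if "tfun (E' k) (F' (b - k)) (D (H b)) \<noteq> 0" for k
      using EF_relation[OF D, of ?x k b] that x by auto
  qed
  moreover have "tfun (E' k) (F' (a - k)) (D (G a)) = 0" for a k
  proof (rule finite_shift_eq_0[OF finite_tfun_support(1) nz])
    show "tfun (E' (k - ?x)) (F' (a - (k - ?x))) (D (G a)) \<noteq> 0"
      if "tfun (E' k) (F' (a - k)) (D (G a)) \<noteq> 0" for k
      using EF_relation[OF D, of a k ?x] that y by auto
  qed
  ultimately show ?thesis by (simp add: EF_free_def)
qed

text \<open>Opposite degrees are paired so that, for opposite root weights, \<open>h\<close>
  annihilates the sum and subtracting its coboundary keeps \<open>D h = 0\<close>.\<close>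

definition lattice_sum :: "(int \<times> int \<Rightarrow> complex) \<Rightarrow> (int \<times> int \<Rightarrow> ('b \<Rightarrow>\<^sub>0 complex))
    \<Rightarrow> (int \<times> int \<Rightarrow> ('b \<Rightarrow>\<^sub>0 complex)) \<Rightarrow> ('b \<times> 'b \<Rightarrow>\<^sub>0 complex)" where
  "lattice_sum \<rho> X Y = (let t = \<Sum>k\<in>{k. \<rho> k \<noteq> 0}. scl (\<rho> k) (X k \<otimes>\<^sub>t Y (- k)) in t - flip t)"

lemma skew_lattice_sum: "skew (lattice_sum \<rho> X Y)"
  by (simp add: lattice_sum_def Let_def skew_diff_flip)

lemma adj_act_h_lattice_sum:
  assumes wt: "\<And>k. br h (X k) = scl (degree_value k + m) (X k)"
    "\<And>k. br h (Y k) = scl (degree_value k - m) (Y k)"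
  shows "adj_act br h (lattice_sum \<rho> X Y) = 0"
proof -
  have "adj_act br h (X k \<otimes>\<^sub>t Y (- k)) = 0" for k
    by (rule adj_act_h_tens[OF wt(1)]) (simp add: wt(2) degree_value_simps)
  then show ?thesis
    unfolding lattice_sum_def Let_def
    by (intro adj_act_h_antisym) (simp add: clinear_sum[OF clinear_adj_act] clinear_scl[OF clinear_adj_act])
qed

lemma tfun_lattice_sum:
  assumes "lfun \<phi>" "lfun \<psi>" "finite {k. \<rho> k \<noteq> 0}"
    and z: "\<And>m. \<rho> m \<noteq> 0 \<Longrightarrow> \<phi> (X m) * \<psi> (Y (- m)) - \<psi> (X m) * \<phi> (Y (- m)) = (if m = k then z else 0)"
  shows "tfun \<phi> \<psi> (lattice_sum \<rho> X Y) = \<rho> k * z"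
proof -
  have "tfun \<phi> \<psi> (lattice_sum \<rho> X Y) =
      (\<Sum>m\<in>{k. \<rho> k \<noteq> 0}. \<rho> m * (\<phi> (X m) * \<psi> (Y (- m)) - \<psi> (X m) * \<phi> (Y (- m))))"
    using assms(1,2) by (simp add: lattice_sum_def Let_def tfun_simps tfun_flip tfun_tens
        sum_subtractf right_diff_distrib)
  also have "\<dots> = (\<Sum>m\<in>{k. \<rho> k \<noteq> 0}. if m = k then \<rho> k * z else 0)"
    by (intro sum.cong refl) (simp add: z)
  also have "\<dots> = \<rho> k * z"
    using assms(3) by (simp add: sum.delta)
  finally show ?thesis .
qed

lemma tfun_lattice_sum_0:
  assumes "lfun \<phi>" "lfun \<psi>" "finite {k. \<rho> k \<noteq> 0}"
    and "\<And>m. \<rho> m \<noteq> 0 \<Longrightarrow> \<phi> (X m) * \<psi> (Y (- m)) = \<psi> (X m) * \<phi> (Y (- m))"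
  shows "tfun \<phi> \<psi> (lattice_sum \<rho> X Y) = 0"
  using tfun_lattice_sum[OF assms(1,2,3), of X Y _ 0] assms(4) by simp

text \<open>Needed for \<open>X = Y\<close>, where the sum and its flip both contribute, at
  \<open>k\<close> and at \<open>- k\<close>.\<close>

lemma tfun_lattice_sum2:
  assumes "lfun \<phi>" "lfun \<psi>" "finite {k. \<rho> k \<noteq> 0}"
    and "\<And>m. \<rho> m \<noteq> 0 \<Longrightarrow> \<phi> (X m) * \<psi> (Y (- m)) = (if m = k then z else 0)"
    and "\<And>m. \<rho> m \<noteq> 0 \<Longrightarrow> \<psi> (X m) * \<phi> (Y (- m)) = (if m = k' then z' else 0)"
  shows "tfun \<phi> \<psi> (lattice_sum \<rho> X Y) = \<rho> k * z - \<rho> k' * z'"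
proof -
  have "tfun \<phi> \<psi> (lattice_sum \<rho> X Y) = (\<Sum>m\<in>{k. \<rho> k \<noteq> 0}. \<rho> m * (\<phi> (X m) * \<psi> (Y (- m))))
      - (\<Sum>m\<in>{k. \<rho> k \<noteq> 0}. \<rho> m * (\<psi> (X m) * \<phi> (Y (- m))))"
    using assms(1,2) by (simp add: lattice_sum_def Let_def tfun_simps tfun_flip tfun_tens)
  also have "(\<Sum>m\<in>{k. \<rho> k \<noteq> 0}. \<rho> m * (\<phi> (X m) * \<psi> (Y (- m))))
      = (\<Sum>m\<in>{k. \<rho> k \<noteq> 0}. if m = k then \<rho> k * z else 0)"
    by (intro sum.cong refl) (simp add: assms(4))
  also have "(\<Sum>m\<in>{k. \<rho> k \<noteq> 0}. \<rho> m * (\<psi> (X m) * \<phi> (Y (- m))))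
      = (\<Sum>m\<in>{k. \<rho> k \<noteq> 0}. if m = k' then \<rho> k' * z' else 0)"
    by (intro sum.cong refl) (simp add: assms(5))
  finally show ?thesis
    using assms(3) by (simp add: sum.delta)
qed

lemma no_D_legs_lattice_sum:
  assumes "finite {k. \<rho> k \<noteq> 0}"
    and "\<And>k. D1' (X k) = 0" "\<And>k. D2' (X k) = 0" "\<And>k. D1' (Y k) = 0" "\<And>k. D2' (Y k) = 0"
  shows "no_D_legs (lattice_sum \<rho> X Y)"
  unfolding no_D_legs_def using assms by (auto intro!: tfun_lattice_sum_0 simp: lfuns)

text \<open>The potential of the closed form gives the coefficients of \<open>r\<close> on
  \<open>E k\<close>, \<open>F (- k)\<close>. By \<open>EF_free_if\<close> only the component on
  \<open>G (1, 0)\<close> has to be cancelled, so integrating in that one direction is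
  enough.\<close>

lemma normalize_EF:
  assumes D: "hcocycle D"
  obtains r where "skew r" "adj_act br h r = 0" "no_D_legs r" "EF_free (\<lambda>x. D x - adj_act br x r)"
proof -
  let ?x = "(1, 0) :: int \<times> int" and ?y = "(0, 1) :: int \<times> int"
  have nz: "?x \<noteq> 0" "?y \<noteq> 0" by (simp_all add: prod_eq_iff)
  define \<phi> where "\<phi> = (\<lambda>a k. c k a * tfun (E' k) (F' (a - k)) (D (G a)))"
  have fin: "finite {k. \<phi> a k \<noteq> 0}" for a by (simp add: \<phi>_def finite_tfun_support)
  have closed: "\<phi> ?y k - \<phi> ?y (k - ?x) = \<phi> ?x k - \<phi> ?x (k - ?y)" for k
    using EF_closed[OF D nz, of k] by (simp only: \<phi>_def)
  obtain \<rho> where \<rho>: "finite {k. \<rho> k \<noteq> 0}" "\<And>k. \<phi> ?x k = \<rho> (k - ?x) - \<rho> k"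
    by (rule closed_form_exact[OF fin[of ?x] fin[of ?y] closed]) (rule that)
  define r where "r = lattice_sum \<rho> E F"
  have EF: "tfun (E' k) (F' l) r = (if l = - k then \<rho> k else 0)" for k l
    unfolding r_def
    by (subst tfun_lattice_sum[OF lfuns(1,2) \<rho>(1), where k = k and z = "if l = - k then 1 else 0"])
       (auto simp: dual_values)
  have "no_D_legs r"
    unfolding r_def by (rule no_D_legs_lattice_sum) (simp_all add: \<rho>(1) dual_values)
  moreover have "adj_act br h r = 0"
    unfolding r_def by (rule adj_act_h_lattice_sum[where m = \<eta>]) (simp_all add: br_h)
  moreover have "skew r" unfolding r_def by (rule skew_lattice_sum)
  moreover have "tfun (E' k) (F' (?x - k)) (D (G ?x) - adj_act br (G ?x) r) = 0" for k
  proof -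
    have "tfun (E' k) (F' (?x - k)) (D (G ?x)) = c ?x k * \<phi> ?x k"
      using c_inverse(1)[of ?x k] by (simp add: \<phi>_def mult.assoc[symmetric])
    moreover have "?x - k - ?x = - k" "- (k - ?x) = ?x - k" by simp_all
    ultimately show ?thesis
      by (simp add: tfun_simps act_simps EF \<rho>(2) algebra_simps)
  qed
  ultimately show ?thesis
    using D by (intro that[of r] EF_free_if hcocycle_sub)
qed


section \<open>Diagonal components\<close>

text \<open>The index \<open>j\<close> names the term \<open>G j\<close>, \<open>H (- j)\<close> of
  a correction whose coboundary contributes at this place. For \<open>j = 0\<close> the term would
  be built from \<open>d\<close>, which belongs to the torus.\<close>

definition GH_free :: "(('b \<Rightarrow>\<^sub>0 complex) \<Rightarrow> ('b \<times> 'b \<Rightarrow>\<^sub>0 complex)) \<Rightarrow> bool" where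
  "GH_free D \<longleftrightarrow> (\<forall>a j. j \<noteq> 0 \<longrightarrow>
     tfun (G' (j + a)) (H' (- j)) (D (G a)) = 0 \<and> tfun (G' j) (H' (a - j)) (D (H a)) = 0)"

text \<open>Again commutation of \<open>G a\<close> and \<open>H b\<close>, but now both sides carry
  the same \<open>j\<close>: no shift appears, and the correction can be found separately for each
  \<open>j\<close> by division.\<close>

lemma GH_relation:
  assumes D: "hcocycle D" and j: "j \<noteq> 0"
  shows "(c a j - c j a) * tfun (G' j) (H' (b - j)) (D (H b))
    = (c j b - c b j) * tfun (G' (j + a)) (H' (- j)) (D (G a))"
proof -
  have "j + a \<noteq> a" "b - j \<noteq> b" using j by simp_all
  moreover have "b - j - b = - j" by simp
  moreover have "c b (b - j) = c j b" "c (b - j) b = c b j" by simp_all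
  ultimately show ?thesis
    using commute_GH[OF D, of "G' (j + a)" "H' (b - j)" a b] by (simp add: act_simps)
qed

lemma normalize_GH:
  assumes D: "hcocycle D"
  obtains r where "skew r" "adj_act br h r = 0" "no_D_legs r"
    "\<And>k l. tfun (E' k) (F' l) r = 0" "GH_free (\<lambda>x. D x - adj_act br x r)"
proof -
  let ?x = "(1, 0) :: int \<times> int" and ?y = "(0, 1) :: int \<times> int"
  define u where "u = (\<lambda>a j. tfun (G' (j + a)) (H' (- j)) (D (G a)))"
  \<comment> \<open>The divisor for (1, 0) vanishes exactly when \<open>j\<close> is parallel to it;
    unless \<open>j = 0\<close>, the divisor for (0, 1) is then nonzero.\<close>
  define \<rho> where "\<rho> = (\<lambda>j. if c ?x j \<noteq> c j ?x then u ?x j / (c ?x j - c j ?x)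
    else if j \<noteq> 0 then u ?y j / (c ?y j - c j ?y) else 0)"
  have "finite {j. u a j \<noteq> 0}" for a
  proof (rule finite_subset)
    show "{j. u a j \<noteq> 0} \<subseteq> (\<lambda>k. k - a) ` {k. tfun (G' k) (H' (a - k)) (D (G a)) \<noteq> 0}"
    proof
      fix j assume "j \<in> {j. u a j \<noteq> 0}"
      then have "tfun (G' (j + a)) (H' (a - (j + a))) (D (G a)) \<noteq> 0" by (simp add: u_def)
      then show "j \<in> (\<lambda>k. k - a) ` {k. tfun (G' k) (H' (a - k)) (D (G a)) \<noteq> 0}"
        by (intro image_eqI[of _ _ "j + a"]) simp_all
    qed
  qed (intro finite_imageI finite_tfun_support)
  then have fin: "finite {k. \<rho> k \<noteq> 0}"
    by - (rule finite_subset[of _ "{j. u ?x j \<noteq> 0} \<union> {j. u ?y j \<noteq> 0}"], auto simp: \<rho>_def)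
  have \<rho>0: "\<rho> 0 = 0" by (simp add: \<rho>_def)
  define r where "r = lattice_sum \<rho> G H"
  have GH: "tfun (G' k) (H' l) r = (if l = - k then \<rho> k else 0)" for k l
    unfolding r_def using \<rho>0
    by (subst tfun_lattice_sum[OF lfuns(3,4) fin, where k = k and z = "if l = - k then 1 else 0"])
       (auto simp: dual_values)
  have D0: "no_D_legs r"
    unfolding r_def by (rule no_D_legs_lattice_sum) (simp_all add: fin dual_values)
  have r: "skew r" unfolding r_def by (rule skew_lattice_sum)
  have h: "adj_act br h r = 0"
    unfolding r_def by (rule adj_act_h_lattice_sum[where m = 0]) (simp_all add: br_h)
  define D' where "D' = (\<lambda>x. D x - adj_act br x r)"
  have D': "hcocycle D'" unfolding D'_def by (rule hcocycle_sub[OF D r h])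
  have u': "tfun (G' (j + a)) (H' (- j)) (D' (G a)) = u a j - (c a j - c j a) * \<rho> j"
    if "j \<noteq> 0" for a j
    using that by (simp add: D'_def tfun_simps act_simps GH u_def)
  have "tfun (G' j) (H' (b - j)) (D' (H b)) = 0 \<and> tfun (G' (j + a)) (H' (- j)) (D' (G a)) = 0"
    if j: "j \<noteq> 0" for a b j
  proof -
    \<comment> \<open>One direction transversal to \<open>j\<close> in which the corrected component
      is zero; \<open>GH_relation\<close> carries the zero to every \<open>H b\<close> and from
      there to every \<open>G a\<close>.\<close>
    obtain a0 where a0: "c a0 j \<noteq> c j a0" and z: "tfun (G' (j + a0)) (H' (- j)) (D' (G a0)) = 0"
    proof (cases "c ?x j = c j ?x")
      case True
      then have "snd j = 0" using c_eq_iff[of ?x j] by (simp add: pairing_def)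
      then have "c ?y j \<noteq> c j ?y" using c_eq_iff[of ?y j] j by (simp add: pairing_def prod_eq_iff)
      then show ?thesis using that[of ?y] u'[OF j, of ?y] True j by (simp add: \<rho>_def)
    next
      case False
      then show ?thesis using that[of ?x] u'[OF j, of ?x] by (simp add: \<rho>_def)
    qed
    have w: "tfun (G' j) (H' (b - j)) (D' (H b)) = 0" for b
      using GH_relation[OF D' j, of a0 b] a0 z by simp
    then show ?thesis
      using GH_relation[OF D' j, of a a0] a0 by simp
  qed
  then have "GH_free D'" by (simp add: GH_free_def)
  moreover have "tfun (E' k) (F' l) r = 0" for k l
    unfolding r_def by (rule tfun_lattice_sum_0) (simp_all add: lfuns fin dual_values)
  ultimately show ?thesis using r h D0 by (intro that[of r]) (simp_all add: D'_def)
qed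

lemma EF_free_sub:
  "EF_free D \<Longrightarrow> (\<And>k l. tfun (E' k) (F' l) r = 0) \<Longrightarrow> EF_free (\<lambda>x. D x - adj_act br x r)"
  by (simp add: EF_free_def tfun_simps act_simps)

text \<open>\<open>G a\<close> acts as zero on \<open>H\<close> coordinates, so commutation with
  \<open>H b\<close> constrains \<open>D (G a)\<close> alone.\<close>

lemma HH_relation:
  assumes D: "hcocycle D"
  shows "(c b k - c k b) * tfun (H' (k - b)) (H' l) (D (G a))
    + (c b l - c l b) * tfun (H' k) (H' (l - b)) (D (G a))
    - (if k = b then of_int (fst b) * tfun D1' (H' l) (D (G a)) + of_int (snd b) * tfun D2' (H' l) (D (G a)) else 0)
    - (if l = b then of_int (fst b) * tfun (H' k) D1' (D (G a)) + of_int (snd b) * tfun (H' k) D2' (D (G a)) else 0)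
    = 0"
  using commute_GH[OF D, of "H' k" "H' l" a b]
  by (cases "k = b"; cases "l = b"; simp add: act_simps neg_eq_iff_add_eq_0 algebra_simps)

lemma HH_vanish:
  assumes D: "hcocycle D" and a: "a \<noteq> 0"
  shows "tfun (H' k) (H' (a - k)) (D (G a)) = 0"
    "tfun (H' a) D1' (D (G a)) = 0" "tfun (H' a) D2' (D (G a)) = 0"
proof -
  define p where "p = (\<lambda>k. tfun (H' k) (H' (a - k)) (D (G a)))"
  \<comment> \<open>Avoiding 0 as well ensures \<open>k \<noteq> b\<close> below, so that the terms
    with \<open>D1'\<close> and \<open>D2'\<close> drop out.\<close>
  have fin: "finite (insert 0 {k. p k \<noteq> 0})" by (simp add: p_def finite_tfun_support)
  have p0: "p k = 0" for k
  proof (cases "k = a")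
    case False
    then have "a - k \<noteq> 0" by simp
    from escape_finite_transversal[OF fin this, of k] obtain b'
      where b': "pairing b' (a - k) \<noteq> 0" "k + b' \<notin> insert 0 {k. p k \<noteq> 0}" by blast
    define b where "b = - b'"
    have b: "pairing b (a - k) \<noteq> 0" "p (k - b) = 0" "k \<noteq> b"
      using b' by (auto simp: b_def pairing_def)
    have "tfun (H' (k - b)) (H' (a - k + b)) (D (G a)) = p (k - b)" by (simp add: p_def algebra_simps)
    moreover have "a - k + b \<noteq> b" using False by simp
    ultimately have "(c b (a - k) - c (a - k) b) * p k = 0"
      using HH_relation[OF D, of b k "a - k + b" a] b by (simp add: p_def)
    then show ?thesis using c_eq_iff[of b "a - k"] b(1) by simp
  next
    case True
    obtain b where b: "pairing b a \<noteq> 0"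
      using escape_finite_transversal[OF finite.emptyI a] by blast
    then have "b \<noteq> 0" by (auto simp: pairing_def)
    \<comment> \<open>Here \<open>l = 0\<close>, where the second structure constant difference in
      \<open>HH_relation\<close> is 0.\<close>
    then have "(c b a - c a b) * p a = 0"
      using HH_relation[OF D, of b "a + b" 0 a] a by (simp add: p_def)
    then show ?thesis using c_eq_iff[of b a] b True by simp
  qed
  show "tfun (H' k) (H' (a - k)) (D (G a)) = 0" using p0[of k] by (simp add: p_def)
  have rel: "of_int (fst b) * tfun (H' a) D1' (D (G a)) + of_int (snd b) * tfun (H' a) D2' (D (G a)) = 0"
    if "a \<noteq> b" for b
  proof -
    have "tfun (H' (a - b)) (H' b) (D (G a)) = 0" using p0[of "a - b"] by (simp add: p_def)
    then show ?thesis using HH_relation[OF D, of b a b a] that by (simp add: neg_eq_iff_add_eq_0)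
  qed
  \<comment> \<open>Two points on the axis are at hand because \<open>rel\<close> excludes
    \<open>b = a\<close>.\<close>
  show "tfun (H' a) D1' (D (G a)) = 0"
    using rel[of "(1, 0)"] rel[of "(2, 0)"] by (cases "a = (1, 0)") auto
  show "tfun (H' a) D2' (D (G a)) = 0"
    using rel[of "(0, 1)"] rel[of "(0, 2)"] by (cases "a = (0, 1)") auto
qed

lemma tfun_skewD: "hcocycle D \<Longrightarrow> tfun \<phi> \<psi> (D x) = - tfun \<psi> \<phi> (D x)"
  by (rule tfun_skew[OF hcocycleD(2)])

lemma GG_vanish:
  assumes D: "hcocycle D" and a: "a \<noteq> 0"
  shows "tfun (G' k) (G' (a - k)) (D (H a)) = 0"
    "tfun (G' a) D1' (D (H a)) = 0" "tfun (G' a) D2' (D (H a)) = 0"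
proof -
  interpret sw: torus_sl2 br F E H G D1 D2 h F' E' H' G' D1' D2' s "- \<eta>" by (rule swap)
  show "tfun (G' k) (G' (a - k)) (D (H a)) = 0"
    "tfun (G' a) D1' (D (H a)) = 0" "tfun (G' a) D2' (D (H a)) = 0"
    using sw.HH_vanish[OF D a] by simp_all
qed

lemma EF_free_swap:
  assumes "hcocycle D"
  shows "EF_free D \<Longrightarrow> torus_sl2.EF_free H G F' E' D"
proof -
  interpret sw: torus_sl2 br F E H G D1 D2 h F' E' H' G' D1' D2' s "- \<eta>" by (rule swap)
  assume EF: "EF_free D"
  have "tfun (F' k) (E' (a - k)) (D (H a)) = 0 \<and> tfun (F' k) (E' (a - k)) (D (G a)) = 0" for a k
    using EF[unfolded EF_free_def, rule_format, of "a - k" a]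
    by (simp add: tfun_skewD[OF assms, of "F' _"])
  then show ?thesis by (simp add: sw.EF_free_def)
qed

lemma GH_free_swap:
  assumes "hcocycle D"
  shows "GH_free D \<Longrightarrow> torus_sl2.GH_free H G H' G' D"
proof -
  interpret sw: torus_sl2 br F E H G D1 D2 h F' E' H' G' D1' D2' s "- \<eta>" by (rule swap)
  assume GH: "GH_free D"
  show ?thesis
    unfolding sw.GH_free_def
  proof (intro allI impI conjI)
    fix a j :: "int \<times> int" assume "j \<noteq> 0"
    then show "tfun (H' (j + a)) (G' (- j)) (D (H a)) = 0" "tfun (H' j) (G' (a - j)) (D (G a)) = 0"
      using GH[unfolded GH_free_def, rule_format, of "- j" a]
      by (simp_all add: tfun_skewD[OF assms, of "H' _"] add.commute)
  qed
qed

text \<open>\<open>E a\<close> arises from \<open>E 0\<close> both by \<open>G a\<close> and, up to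
  sign, by \<open>H a\<close>. Comparing the two expressions ties \<open>D (G a)\<close> and
  \<open>D (H a)\<close> to \<open>D (E 0)\<close>.\<close>

lemma E_from_E0:
  assumes D: "hcocycle D"
  shows "tfun \<phi> \<psi> (D (E a)) = tfun \<phi> \<psi> (adj_act br (G a) (D (E 0))) - tfun \<phi> \<psi> (adj_act br (E 0) (D (G a)))"
    "- tfun \<phi> \<psi> (D (E a)) = tfun \<phi> \<psi> (adj_act br (H a) (D (E 0))) - tfun \<phi> \<psi> (adj_act br (E 0) (D (H a)))"
proof -
  have "br (G a) (E 0) = E a" "br (H a) (E 0) = - E a"
    by (simp_all add: brackets) (auto intro!: poly_mapping_eqI)
  then show "tfun \<phi> \<psi> (D (E a)) = tfun \<phi> \<psi> (adj_act br (G a) (D (E 0))) - tfun \<phi> \<psi> (adj_act br (E 0) (D (G a)))"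
    "- tfun \<phi> \<psi> (D (E a)) = tfun \<phi> \<psi> (adj_act br (H a) (D (E 0))) - tfun \<phi> \<psi> (adj_act br (E 0) (D (H a)))"
    using hcocycleD(3)[OF D, of "G a" "E 0"] hcocycleD(3)[OF D, of "H a" "E 0"]
    by (simp_all add: clinear_minus[OF hcocycleD(1)[OF D]] tfun_simps[symmetric])
qed

lemma EF_freeD:
  assumes "EF_free D"
  shows "tfun (E' k) (F' (a - k)) (D (G a)) = 0" "tfun (E' k) (F' (a - k)) (D (H a)) = 0"
  using assms[unfolded EF_free_def, rule_format, of k a] by simp_all

lemma GH_freeD:
  assumes "GH_free D"
  shows "k \<noteq> a \<Longrightarrow> tfun (G' k) (H' (a - k)) (D (G a)) = 0"
    "k \<noteq> 0 \<Longrightarrow> tfun (G' k) (H' (a - k)) (D (H a)) = 0"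
  using assms[unfolded GH_free_def, rule_format, of "k - a" a]
    assms[unfolded GH_free_def, rule_format, of k a] by simp_all

lemma HG_freeD:
  assumes D: "hcocycle D" and GH: "GH_free D"
  shows "k \<noteq> 0 \<Longrightarrow> tfun (H' k) (G' (a - k)) (D (G a)) = 0"
    "k \<noteq> a \<Longrightarrow> tfun (H' k) (G' (a - k)) (D (H a)) = 0"
  using GH_freeD[OF GH, of "a - k" a] by (simp_all add: tfun_skewD[OF D, of "H' _" "G' _"])

text \<open>Adding the two expressions in \<open>E_from_E0\<close> eliminates
  \<open>D (E a)\<close>. Of the terms in which \<open>E 0\<close> acts on \<open>D (G a)\<close>
  and \<open>D (H a)\<close>, only the \<open>G\<close>-\<open>G\<close> coefficient survives the
  earlier vanishing results.\<close>

lemma GG_formula: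
  assumes D: "hcocycle D" and EF: "EF_free D" and GH: "GH_free D"
    and k: "a \<noteq> 0" "k \<noteq> 0" "k \<noteq> a"
  defines "\<alpha> \<equiv> \<lambda>k. tfun (E' k) (G' (- k)) (D (E 0))"
  shows "tfun (G' k) (G' (a - k)) (D (G a)) = (c a k - c k a) * (\<alpha> k - \<alpha> (k - a))"
proof -
  have "a - k \<noteq> a" "a - k - a = - k" using k by simp_all
  then show ?thesis
    using E_from_E0(1)[OF D, of "E' k" "G' (a - k)" a] E_from_E0(2)[OF D, of "E' k" "G' (a - k)" a]
      EF_freeD[OF EF, of k a] HG_freeD[OF D GH, of k a] GG_vanish(1)[OF D k(1), of k] k
    by (simp add: act_simps \<alpha>_def algebra_simps)
qed

text \<open>Not the swapped form of \<open>GG_formula\<close>: it is still read off from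
  \<open>E 0\<close>, so that vanishing \<open>H\<close>-\<open>H\<close> coefficients yield
  information on the \<open>E\<close>-\<open>H\<close> coefficients.\<close>

lemma HH_formula:
  assumes D: "hcocycle D" and EF: "EF_free D" and GH: "GH_free D"
    and k: "a \<noteq> 0" "k \<noteq> 0" "k \<noteq> a"
  defines "\<beta> \<equiv> \<lambda>k. tfun (E' k) (H' (- k)) (D (E 0))"
  shows "tfun (H' k) (H' (a - k)) (D (H a)) = (c a k - c k a) * (\<beta> (k - a) - \<beta> k)"
proof -
  have "a - k \<noteq> a" "a - k - a = - k" using k by simp_all
  then show ?thesis
    using E_from_E0(1)[OF D, of "E' k" "H' (a - k)" a] E_from_E0(2)[OF D, of "E' k" "H' (a - k)" a]
      EF_freeD[OF EF, of k a] GH_freeD[OF GH, of k a] HH_vanish(1)[OF D k(1), of k] k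
    by (simp add: act_simps \<beta>_def algebra_simps)
qed

definition G_diagonal :: "(('b \<Rightarrow>\<^sub>0 complex) \<Rightarrow> ('b \<times> 'b \<Rightarrow>\<^sub>0 complex)) \<Rightarrow> bool" where
  "G_diagonal D \<longleftrightarrow> (\<forall>k. k \<noteq> 0 \<longrightarrow> tfun (E' k) (G' (- k)) (D (E 0)) = 0) \<and>
     (\<forall>a k. a \<noteq> 0 \<longrightarrow> k \<noteq> 0 \<longrightarrow> k \<noteq> a \<longrightarrow> tfun (G' k) (G' (a - k)) (D (G a)) = 0)"

lemma lattice_constant_eq_0:
  assumes fin: "finite {k. f k \<noteq> (0 :: complex)}" and k: "k \<noteq> 0"
    and shift: "\<And>a. pairing a k \<noteq> 0 \<Longrightarrow> f k = f (k - a)"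
  shows "f k = 0"
proof -
  obtain a where "pairing a k \<noteq> 0" "k + a \<notin> {k. f k \<noteq> 0}"
    using escape_finite_transversal[OF fin k] by blast
  moreover from this(1) have "pairing (- a) k \<noteq> 0" by (simp add: pairing_def)
  ultimately show ?thesis using shift[of "- a"] by simp
qed

text \<open>The formula for the \<open>G\<close>-\<open>G\<close> coefficients shows that they are symmetric once the
  \<open>E\<close>-\<open>G\<close> coefficients of \<open>D (E 0)\<close> are even; being also skew, they vanish.\<close>

lemma G_diagonal_if_even:
  assumes D: "hcocycle D" and EF: "EF_free D" and GH: "GH_free D"
    and even: "\<And>k. k \<noteq> 0 \<Longrightarrow> tfun (E' (- k)) (G' k) (D (E 0)) = tfun (E' k) (G' (- k)) (D (E 0))"
  shows "G_diagonal D"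
proof -
  define \<alpha> where "\<alpha> = (\<lambda>k. tfun (E' k) (G' (- k)) (D (E 0)))"
  have ev: "\<alpha> (- k) = \<alpha> k" for k using even[of k] by (cases "k = 0") (simp_all add: \<alpha>_def)
  have P: "tfun (G' k) (G' (a - k)) (D (G a)) = (c a k - c k a) * (\<alpha> k - \<alpha> (k - a))"
    if "a \<noteq> 0" "k \<noteq> 0" "k \<noteq> a" for a k
    using GG_formula[OF D EF GH that] by (simp add: \<alpha>_def)
  have GG: "tfun (G' k) (G' (a - k)) (D (G a)) = 0" if k: "a \<noteq> 0" "k \<noteq> 0" "k \<noteq> a" for a k
  proof -
    have "tfun (G' (a - k)) (G' k) (D (G a)) = (c k a - c a k) * (\<alpha> (a - k) - \<alpha> (- k))"
      using P[of a "a - k"] k by simp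
    also have "\<dots> = (c a k - c k a) * (\<alpha> k - \<alpha> (k - a))"
      using ev[of "k - a"] ev[of k] by (simp add: algebra_simps)
    also have "\<dots> = tfun (G' k) (G' (a - k)) (D (G a))" using P[OF k] by simp
    also have "\<dots> = - tfun (G' (a - k)) (G' k) (D (G a))" by (rule tfun_skewD[OF D])
    finally have "tfun (G' (a - k)) (G' k) (D (G a)) = 0" by simp
    then show ?thesis using tfun_skewD[OF D, of "G' k" "G' (a - k)" "G a"] by simp
  qed
  have "\<alpha> k = 0" if k: "k \<noteq> 0" for k
  proof (rule lattice_constant_eq_0[OF _ k])
    show "finite {k. \<alpha> k \<noteq> 0}" by (simp add: \<alpha>_def finite_tfun_support)
    show "\<alpha> k = \<alpha> (k - a)" if "pairing a k \<noteq> 0" for a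
    proof -
      have "a \<noteq> 0" "k \<noteq> a" using that by (auto simp: pairing_def)
      then show ?thesis using P[of a k] GG[of a k] k that c_eq_iff[of a k] by simp
    qed
  qed
  with GG show ?thesis by (simp add: G_diagonal_def \<alpha>_def)
qed

lemma GH_free_sub:
  "GH_free D \<Longrightarrow> (\<And>k l. k \<noteq> 0 \<Longrightarrow> l \<noteq> 0 \<Longrightarrow> tfun (G' k) (H' l) r = 0) \<Longrightarrow>
    GH_free (\<lambda>x. D x - adj_act br x r)"
  by (simp add: GH_free_def tfun_simps act_simps)

lemma normalize_GG:
  assumes D: "hcocycle D" and EF: "EF_free D" and GH: "GH_free D"
  obtains r where "skew r" "adj_act br h r = 0" "no_D_legs r"
    "EF_free (\<lambda>x. D x - adj_act br x r)" "GH_free (\<lambda>x. D x - adj_act br x r)"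
    "G_diagonal (\<lambda>x. D x - adj_act br x r)" "torus_sl2.G_diagonal F H F' H' (\<lambda>x. D x - adj_act br x r)"
proof -
  interpret sw: torus_sl2 br F E H G D1 D2 h F' E' H' G' D1' D2' s "- \<eta>" by (rule swap)
  \<comment> \<open>Since \<open>G k\<close> and \<open>G (- k)\<close> are antisymmetrised,
    \<open>r1\<close> changes the coefficient by \<open>\<rho> k - \<rho> (- k)\<close>. It can thus
    remove only the odd part; the factor 1/2 leaves exactly the even part.\<close>
  define \<rho> where "\<rho> = (\<lambda>k. if k = 0 then 0 else - tfun (E' k) (G' (- k)) (D (E 0)) / 2)"
  define \<rho>' where "\<rho>' = (\<lambda>k. if k = 0 then 0 else - tfun (F' k) (H' (- k)) (D (F 0)) / 2)"
  have fin: "finite {k. \<rho> k \<noteq> 0}" "finite {k. \<rho>' k \<noteq> 0}"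
  proof -
    show "finite {k. \<rho> k \<noteq> 0}"
      by (rule finite_subset[OF _ finite_tfun_support(1)[of "\<lambda>k. G' (- k)" "D (E 0)"]]) (auto simp: \<rho>_def)
    show "finite {k. \<rho>' k \<noteq> 0}"
      by (rule finite_subset[OF _ finite_tfun_support(2)[of "\<lambda>k. H' (- k)" "D (F 0)"]]) (auto simp: \<rho>'_def)
  qed
  have \<rho>0: "\<rho> 0 = 0" "\<rho>' 0 = 0" by (simp_all add: \<rho>_def \<rho>'_def)
  define r1 where "r1 = lattice_sum \<rho> G G"
  define r2 where "r2 = lattice_sum \<rho>' H H"
  define r where "r = r1 + r2"
  have skew: "skew r" by (simp add: r_def r1_def r2_def skew_add skew_lattice_sum)
  have h: "adj_act br h r = 0"
    unfolding r_def r1_def r2_def clinear_add[OF clinear_adj_act]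
    by (subst (1 2) adj_act_h_lattice_sum[where m = 0]) (simp_all add: br_h)
  have "no_D_legs r1" "no_D_legs r2"
    unfolding r1_def r2_def by (rule no_D_legs_lattice_sum; simp add: fin dual_values)+
  then have D0: "no_D_legs r" by (simp add: no_D_legs_def r_def tfun_simps)
  have GG1: "tfun (G' k) (G' (- k)) r1 = \<rho> k - \<rho> (- k)" if "k \<noteq> 0" for k
    unfolding r1_def using that
    by (subst tfun_lattice_sum2[OF lfuns(3) lfuns(3) fin(1), where k = k and k' = "- k" and z = 1 and z' = 1])
       (auto simp: dual_values \<rho>0)
  have GG2: "tfun (G' k) (G' (- k)) r2 = 0" if "k \<noteq> 0" for k
    unfolding r2_def by (rule tfun_lattice_sum_0) (use that in \<open>auto simp: lfuns dual_values fin\<close>)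
  have HH2: "tfun (H' k) (H' (- k)) r2 = \<rho>' k - \<rho>' (- k)" if "k \<noteq> 0" for k
    unfolding r2_def using that
    by (subst tfun_lattice_sum2[OF lfuns(4) lfuns(4) fin(2), where k = k and k' = "- k" and z = 1 and z' = 1])
       (auto simp: dual_values \<rho>0)
  have HH1: "tfun (H' k) (H' (- k)) r1 = 0" if "k \<noteq> 0" for k
    unfolding r1_def by (rule tfun_lattice_sum_0) (use that in \<open>auto simp: lfuns dual_values fin\<close>)
  have GGr: "tfun (G' k) (G' (- k)) r = \<rho> k - \<rho> (- k)" "tfun (H' k) (H' (- k)) r = \<rho>' k - \<rho>' (- k)"
    if "k \<noteq> 0" for k
    using GG1[OF that] GG2[OF that] HH1[OF that] HH2[OF that] by (simp_all add: r_def tfun_simps)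
  have "tfun (G' k) (H' l) r1 = 0" "tfun (G' k) (H' l) r2 = 0" if "k \<noteq> 0" "l \<noteq> 0" for k l
    unfolding r1_def r2_def by (rule tfun_lattice_sum_0; use that in \<open>auto simp: lfuns dual_values fin\<close>)+
  then have GH0: "tfun (G' k) (H' l) r = 0" if "k \<noteq> 0" "l \<noteq> 0" for k l
    using that by (simp add: r_def tfun_simps)
  have HG0: "tfun (H' k) (G' l) r = 0" if "k \<noteq> 0" "l \<noteq> 0" for k l
    using GH0[OF that(2,1)] tfun_skew[OF skew, of "H' k" "G' l"] by simp
  have "tfun (E' k) (F' l) r1 = 0" "tfun (E' k) (F' l) r2 = 0" for k l
    unfolding r1_def r2_def by (rule tfun_lattice_sum_0; simp add: lfuns dual_values fin)+
  then have EF0: "tfun (E' k) (F' l) r = 0" for k l by (simp add: r_def tfun_simps)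
  have FE0: "tfun (F' k) (E' l) r = 0" for k l
    using EF0[of l k] tfun_skew[OF skew, of "F' k" "E' l"] by simp
  define D' where "D' = (\<lambda>x. D x - adj_act br x r)"
  have D': "hcocycle D'" unfolding D'_def by (rule hcocycle_sub[OF D skew h])
  have EF': "EF_free D'" unfolding D'_def by (rule EF_free_sub[OF EF EF0])
  have GH': "GH_free D'" unfolding D'_def by (rule GH_free_sub[OF GH GH0])
  have "tfun (E' k) (G' (- k)) (D' (E 0)) = tfun (E' k) (G' (- k)) (D (E 0)) + \<rho> k - \<rho> (- k)"
    "tfun (F' k) (H' (- k)) (D' (F 0)) = tfun (F' k) (H' (- k)) (D (F 0)) + \<rho>' k - \<rho>' (- k)"
    if "k \<noteq> 0" for k
    using that GGr[OF that] GH0[of k "- k"] HG0[of k "- k"]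
    by (simp_all add: D'_def tfun_simps act_simps EF0 FE0)
  then have e: "tfun (E' k) (G' (- k)) (D' (E 0))
      = (tfun (E' k) (G' (- k)) (D (E 0)) + tfun (E' (- k)) (G' k) (D (E 0))) / 2"
    "tfun (F' k) (H' (- k)) (D' (F 0))
      = (tfun (F' k) (H' (- k)) (D (F 0)) + tfun (F' (- k)) (H' k) (D (F 0))) / 2"
    if "k \<noteq> 0" for k
    using that by (simp_all add: \<rho>_def \<rho>'_def field_simps)
  have "tfun (E' (- k)) (G' k) (D' (E 0)) = tfun (E' k) (G' (- k)) (D' (E 0))"
    "tfun (F' (- k)) (H' k) (D' (F 0)) = tfun (F' k) (H' (- k)) (D' (F 0))" if "k \<noteq> 0" for k
    using e[OF that] e[of "- k"] that by (metis add.commute minus_minus neg_equal_0_iff_equal)+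
  note even = this
  have "G_diagonal D'"
    by (rule G_diagonal_if_even[OF D' EF' GH' even(1)])
  moreover have "sw.G_diagonal D'"
    by (rule sw.G_diagonal_if_even[OF D' EF_free_swap[OF D' EF'] GH_free_swap[OF D' GH'] even(2)])
  ultimately show ?thesis
    using skew h D0 EF' GH' by (intro that[of r]) (simp_all add: D'_def)
qed

lemma E_diagonal:
  assumes D: "hcocycle D" and EF: "EF_free D" and GH: "GH_free D"
    and Gd: "G_diagonal D" and Hd: "torus_sl2.G_diagonal F H F' H' D" and k: "k \<noteq> b"
  shows "tfun (E' k) (G' (b - k)) (D (E b)) = 0" "tfun (E' k) (H' (b - k)) (D (E b)) = 0"
proof -
  interpret sw: torus_sl2 br F E H G D1 D2 h F' E' H' G' D1' D2' s "- \<eta>" by (rule swap)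
  define \<beta> where "\<beta> = (\<lambda>k. tfun (E' k) (H' (- k)) (D (E 0)))"
  have \<alpha>0: "tfun (E' k) (G' (- k)) (D (E 0)) = 0" if "k \<noteq> 0" for k
    using Gd that unfolding G_diagonal_def by blast
  have "\<beta> k = 0" if k: "k \<noteq> 0" for k
  proof (rule lattice_constant_eq_0[OF _ k])
    show "finite {k. \<beta> k \<noteq> 0}" by (simp add: \<beta>_def finite_tfun_support)
    show "\<beta> k = \<beta> (k - a)" if "pairing a k \<noteq> 0" for a
    proof -
      have ak: "a \<noteq> 0" "k \<noteq> a" using that by (auto simp: pairing_def)
      have "tfun (H' k) (H' (a - k)) (D (H a)) = 0"
        using Hd ak k unfolding sw.G_diagonal_def by blast
      then show ?thesis using HH_formula[OF D EF GH ak(1) k ak(2)] that c_eq_iff[of a k]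
        by (simp add: \<beta>_def)
    qed
  qed
  then have \<beta>0: "tfun (E' k) (H' (- k)) (D (E 0)) = 0" if "k \<noteq> 0" for k
    using that by (simp add: \<beta>_def)
  \<comment> \<open>\<open>E b\<close> is produced here by \<open>H b\<close>, and for the
    \<open>H'\<close> leg by \<open>G b\<close>, because that action is zero on the right leg; only
    known coefficients of \<open>D (E 0)\<close> remain.\<close>
  show "tfun (E' k) (G' (b - k)) (D (E b)) = 0"
  proof (cases "b = 0")
    case False
    then show ?thesis
      using E_from_E0(2)[OF D, of "E' k" "G' (b - k)" b] EF_freeD(2)[OF EF, of k b]
        HG_freeD(2)[OF D GH k] GG_vanish(1)[OF D False, of k] \<alpha>0[of "k - b"] k
      by (simp add: act_simps cong: if_cong)
  qed (use \<alpha>0 k in simp)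
  show "tfun (E' k) (H' (b - k)) (D (E b)) = 0"
  proof (cases "b = 0")
    case False
    then show ?thesis
      using E_from_E0(1)[OF D, of "E' k" "H' (b - k)" b] EF_freeD(1)[OF EF, of k b]
        GH_freeD(1)[OF GH k] HH_vanish(1)[OF D False, of k] \<beta>0[of "k - b"] k
      by (simp add: act_simps cong: if_cong)
  qed (use \<beta>0 k in simp)
qed


section \<open>Components along the torus\<close>

definition diagonal :: "(('b \<Rightarrow>\<^sub>0 complex) \<Rightarrow> ('b \<times> 'b \<Rightarrow>\<^sub>0 complex)) \<Rightarrow> bool" where
  "diagonal D \<longleftrightarrow> hcocycle D \<and> EF_free D \<and> GH_free D \<and> G_diagonal D \<and> torus_sl2.G_diagonal F H F' H' D"

lemma diagonalD:
  assumes "diagonal D"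
  shows "hcocycle D" "EF_free D" "GH_free D" "G_diagonal D" "torus_sl2.G_diagonal F H F' H' D"
  using assms by (simp_all add: diagonal_def)

lemma diagonal_swap:
  assumes "diagonal D"
  shows "torus_sl2.diagonal br F E H G h F' E' H' G' D"
proof -
  interpret sw: torus_sl2 br F E H G D1 D2 h F' E' H' G' D1' D2' s "- \<eta>" by (rule swap)
  note D = diagonalD[OF assms]
  show ?thesis
    unfolding sw.diagonal_def using D EF_free_swap[OF D(1,2)] GH_free_swap[OF D(1,3)] by blast
qed

section \<open>Linear relations among the torus coefficients\<close>

lemma E_relations:
  assumes D: "hcocycle D"
  shows "c a b * tfun \<phi> \<psi> (D (E (a + b)))
      = tfun \<phi> \<psi> (adj_act br (G a) (D (E b))) - tfun \<phi> \<psi> (adj_act br (E b) (D (G a)))"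
    "- c b a * tfun \<phi> \<psi> (D (E (a + b)))
      = tfun \<phi> \<psi> (adj_act br (H a) (D (E b))) - tfun \<phi> \<psi> (adj_act br (E b) (D (H a)))"
proof -
  have "scl (c a b) (D (E (a + b))) = adj_act br (G a) (D (E b)) - adj_act br (E b) (D (G a))"
    "scl (- c b a) (D (E (a + b))) = adj_act br (H a) (D (E b)) - adj_act br (E b) (D (H a))"
    using hcocycleD(3)[OF D, of "G a" "E b"] hcocycleD(3)[OF D, of "H a" "E b"]
    by (simp_all add: brackets clinear_scl[OF hcocycleD(1)[OF D]])
  from arg_cong[OF this(1), of "tfun \<phi> \<psi>"] arg_cong[OF this(2), of "tfun \<phi> \<psi>"]
  show "c a b * tfun \<phi> \<psi> (D (E (a + b)))
      = tfun \<phi> \<psi> (adj_act br (G a) (D (E b))) - tfun \<phi> \<psi> (adj_act br (E b) (D (G a)))"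
    "- c b a * tfun \<phi> \<psi> (D (E (a + b)))
      = tfun \<phi> \<psi> (adj_act br (H a) (D (E b))) - tfun \<phi> \<psi> (adj_act br (E b) (D (H a)))"
    by (simp_all only: tfun_simps)
qed

text \<open>On these components the bracket of \<open>G a\<close> or \<open>H a\<close> with
  \<open>E b\<close> yields the same nonzero structure constant throughout; once it is cancelled,
  the coefficients are additive in the degree.\<close>

lemma torus_additive:
  assumes D: "diagonal D" and a: "a \<noteq> 0"
  shows "tfun (E' (a + b)) D1' (D (E (a + b))) = tfun (E' b) D1' (D (E b)) + tfun (G' a) D1' (D (G a))"
    "tfun (E' (a + b)) D2' (D (E (a + b))) = tfun (E' b) D2' (D (E b)) + tfun (G' a) D2' (D (G a))"
    "tfun (E' (a + b)) (G' 0) (D (E (a + b))) = tfun (E' b) (G' 0) (D (E b)) + tfun (G' a) (G' 0) (D (G a))"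
    "tfun (E' (a + b)) D1' (D (E (a + b))) = tfun (E' b) D1' (D (E b)) + tfun (H' a) D1' (D (H a))"
    "tfun (E' (a + b)) D2' (D (E (a + b))) = tfun (E' b) D2' (D (E b)) + tfun (H' a) D2' (D (H a))"
    "tfun (E' (a + b)) (G' 0) (D (E (a + b))) = tfun (E' b) (G' 0) (D (E b)) + tfun (H' a) (G' 0) (D (H a))"
proof -
  note d = diagonalD[OF D]
  have ab: "a + b \<noteq> b" "0 \<noteq> a" using a by auto
  have EF: "tfun (E' (a + b)) (F' (- b)) (D (G a)) = 0" "tfun (E' (a + b)) (F' (- b)) (D (H a)) = 0"
    using EF_freeD[OF d(2), of "a + b" a] by simp_all
  have HG: "tfun (H' a) (G' 0) (D (G a)) = 0" using HG_freeD(1)[OF d(1,3) a, of a] by simp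
  have GG: "tfun (G' a) (G' 0) (D (H a)) = 0" using GG_vanish(1)[OF d(1) a, of a] by simp
  note v = HH_vanish(2,3)[OF d(1) a] GG_vanish(2,3)[OF d(1) a] EF HG GG ab
  have m: "c a b * x = c a b * y \<Longrightarrow> x = y" "c b a * x = c b a * y \<Longrightarrow> x = y" for x y by simp_all
  show "tfun (E' (a + b)) D1' (D (E (a + b))) = tfun (E' b) D1' (D (E b)) + tfun (G' a) D1' (D (G a))"
    using E_relations(1)[OF d(1), of a b "E' (a + b)" D1'] v by - (rule m(1), simp add: act_simps algebra_simps)
  show "tfun (E' (a + b)) D2' (D (E (a + b))) = tfun (E' b) D2' (D (E b)) + tfun (G' a) D2' (D (G a))"
    using E_relations(1)[OF d(1), of a b "E' (a + b)" D2'] v by - (rule m(1), simp add: act_simps algebra_simps)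
  show "tfun (E' (a + b)) (G' 0) (D (E (a + b))) = tfun (E' b) (G' 0) (D (E b)) + tfun (G' a) (G' 0) (D (G a))"
    using E_relations(1)[OF d(1), of a b "E' (a + b)" "G' 0"] v by - (rule m(1), simp add: act_simps algebra_simps)
  show "tfun (E' (a + b)) D1' (D (E (a + b))) = tfun (E' b) D1' (D (E b)) + tfun (H' a) D1' (D (H a))"
    using E_relations(2)[OF d(1), of b a "E' (a + b)" D1'] v by - (rule m(2), simp add: act_simps algebra_simps)
  show "tfun (E' (a + b)) D2' (D (E (a + b))) = tfun (E' b) D2' (D (E b)) + tfun (H' a) D2' (D (H a))"
    using E_relations(2)[OF d(1), of b a "E' (a + b)" D2'] v by - (rule m(2), simp add: act_simps algebra_simps)
  show "tfun (E' (a + b)) (G' 0) (D (E (a + b))) = tfun (E' b) (G' 0) (D (E b)) + tfun (H' a) (G' 0) (D (H a))"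
    using E_relations(2)[OF d(1), of b a "E' (a + b)" "G' 0"] v by - (rule m(2), simp add: act_simps algebra_simps)
qed

text \<open>The coefficient at \<open>E' b\<close> and \<open>G' a\<close> of the identity for
  \<open>br (G a) (E b)\<close>: by \<open>E_diagonal\<close> the contribution of
  \<open>D (E (a + b))\<close> vanishes, leaving torus coefficients only.\<close>

lemma torus_symplectic:
  assumes D: "diagonal D" and a: "a \<noteq> 0"
  shows "of_int (fst a) * tfun (E' b) D1' (D (E b)) + of_int (snd a) * tfun (E' b) D2' (D (E b))
    + 2 * tfun (G' a) (G' 0) (D (G a))
    + of_int (fst b) * tfun (G' a) D1' (D (G a)) + of_int (snd b) * tfun (G' a) D2' (D (G a)) = 0"
proof -
  note d = diagonalD[OF D]
  have "tfun (E' b) (G' a) (D (E (a + b))) = 0" "tfun (E' (b - a)) (G' a) (D (E b)) = 0"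
    using E_diagonal(1)[OF d, of b "a + b"] E_diagonal(1)[OF d, of "b - a" b] a by simp_all
  moreover have "tfun (E' b) (F' (a - b)) (D (G a)) = 0" by (rule EF_freeD[OF d(2)])
  moreover have "tfun (G' 0) (G' a) (D (G a)) = - tfun (G' a) (G' 0) (D (G a))"
    "tfun D1' (G' a) (D (G a)) = - tfun (G' a) D1' (D (G a))"
    "tfun D2' (G' a) (D (G a)) = - tfun (G' a) D2' (D (G a))"
    by (rule tfun_skewD[OF d(1)])+
  ultimately show ?thesis
    using E_relations(1)[OF d(1), of a b "E' b" "G' a"]
    by (simp add: act_simps tfun_H'_0 algebra_simps)
qed

text \<open>By \<open>torus_symplectic\<close> the values of \<open>t1\<close> and \<open>t2\<close>
  on the two lattice generators form an antisymmetric matrix, whose one free entry is normalised to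
  0. The same relation with \<open>b\<close> a generator then covers every degree.\<close>

lemma torus_vanish:
  assumes D: "diagonal D" and N: "normal_torus D"
  shows "a \<noteq> 0 \<Longrightarrow> tfun (G' a) (G' 0) (D (G a)) = 0" "tfun (E' b) D1' (D (E b)) = 0"
    "tfun (E' b) D2' (D (E b)) = 0" "tfun (E' b) (G' 0) (D (E b)) = tfun (E' 0) (G' 0) (D (E 0))"
    "a \<noteq> 0 \<Longrightarrow> tfun (H' a) D1' (D (H a)) = 0" "a \<noteq> 0 \<Longrightarrow> tfun (H' a) D2' (D (H a)) = 0"
    "a \<noteq> 0 \<Longrightarrow> tfun (H' a) (G' 0) (D (H a)) = 0"
proof -
  define e1 e2 where "e1 = (\<lambda>b. tfun (E' b) D1' (D (E b)))" and "e2 = (\<lambda>b. tfun (E' b) D2' (D (E b)))"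
  define t1 t2 where "t1 = (\<lambda>a. tfun (G' a) D1' (D (G a)))" and "t2 = (\<lambda>a. tfun (G' a) D2' (D (G a)))"
  have N': "e1 0 = 0" "e2 0 = 0" "t2 (1, 0) = 0"
    using N by (simp_all add: normal_torus_def e1_def e2_def t2_def)
  have sym: "of_int (fst a) * e1 b + of_int (snd a) * e2 b + 2 * tfun (G' a) (G' 0) (D (G a))
    + of_int (fst b) * t1 a + of_int (snd b) * t2 a = 0" if "a \<noteq> 0" for a b
    using torus_symplectic[OF D that, of b] by (simp add: e1_def e2_def t1_def t2_def)
  have t0: "tfun (G' a) (G' 0) (D (G a)) = 0" if "a \<noteq> 0" for a
    using sym[OF that, of 0] N' by simp
  have et: "e1 b = t1 b" "e2 b = t2 b" if "b \<noteq> 0" for b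
    using torus_additive(1,2)[OF D that, of 0] N' by (simp_all add: e1_def e2_def t1_def t2_def)
  have nz: "(1, 0) \<noteq> (0 :: int \<times> int)" "(0, 1) \<noteq> (0 :: int \<times> int)" by (simp_all add: prod_eq_iff)
  have "t1 (1, 0) = 0" using sym[OF nz(1), of "(1, 0)"] et[OF nz(1)] t0[OF nz(1)] by simp
  moreover have "t2 (0, 1) = 0" using sym[OF nz(2), of "(0, 1)"] et[OF nz(2)] t0[OF nz(2)] by simp
  moreover have "t1 (0, 1) = 0" using sym[OF nz(2), of "(1, 0)"] et[OF nz(1)] t0[OF nz(2)] N' by simp
  ultimately have t: "t1 a = 0" "t2 a = 0" if "a \<noteq> 0" for a
    using sym[OF that, of "(1, 0)"] sym[OF that, of "(0, 1)"] et[OF nz(1)] et[OF nz(2)] t0[OF that] N'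
    by simp_all
  have e: "e1 b = 0" "e2 b = 0" for b
    using et[of b] t[of b] N' by (cases "b = 0"; simp)+
  show "tfun (E' b) D1' (D (E b)) = 0" "tfun (E' b) D2' (D (E b)) = 0" for b
    using e[of b] by (simp_all add: e1_def e2_def)
  show c0: "tfun (E' b) (G' 0) (D (E b)) = tfun (E' 0) (G' 0) (D (E 0))" for b
    using torus_additive(3)[OF D, of b 0] t0[of b] by (cases "b = 0") simp_all
  assume a: "a \<noteq> 0"
  show "tfun (G' a) (G' 0) (D (G a)) = 0" by (rule t0[OF a])
  show "tfun (H' a) D1' (D (H a)) = 0" "tfun (H' a) D2' (D (H a)) = 0"
    using torus_additive(4,5)[OF D a, of 0] e[of a] e[of 0] by (simp_all add: e1_def e2_def)
  show "tfun (H' a) (G' 0) (D (H a)) = 0"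
    using torus_additive(6)[OF D a, of 0] c0[of a] by simp
qed

text \<open>No further normalisation is possible on the swapped side: the swapped
  \<open>torus_symplectic\<close> at \<open>b = 0\<close>, with \<open>a\<close> each generator,
  gives the \<open>F 0\<close> conditions.\<close>

lemma normal_torus_swap:
  assumes D: "diagonal D" and N: "normal_torus D"
  shows "torus_sl2.normal_torus F H F' H' D1' D2' D"
proof -
  interpret sw: torus_sl2 br F E H G D1 D2 h F' E' H' G' D1' D2' s "- \<eta>" by (rule swap)
  note v = torus_vanish[OF D N]
  have nz: "(1, 0) \<noteq> (0 :: int \<times> int)" "(0, 1) \<noteq> (0 :: int \<times> int)" by (simp_all add: prod_eq_iff)
  have "tfun (F' 0) D1' (D (F 0)) = 0" "tfun (F' 0) D2' (D (F 0)) = 0"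
    using sw.torus_symplectic[OF diagonal_swap[OF D] nz(1), of 0] v(7)[OF nz(1)]
      sw.torus_symplectic[OF diagonal_swap[OF D] nz(2), of 0] v(7)[OF nz(2)]
    by (simp_all add: tfun_H'_0)
  then show ?thesis using v(6)[OF nz(1)] by (simp add: sw.normal_torus_def)
qed

text \<open>The last unknown is one scalar \<open>e\<close>. From
  \<open>br (E 0) (F ?x) = G ?x - H ?x\<close>, with \<open>f\<close> its analogue on
  \<open>F ?x\<close>, two coefficients give \<open>f + e = 0\<close> and
  \<open>f - e = 0\<close>.\<close>

lemma torus_constant_vanish:
  assumes D: "diagonal D" and N: "normal_torus D"
  shows "tfun (E' b) (G' 0) (D (E b)) = 0"
proof -
  interpret sw: torus_sl2 br F E H G D1 D2 h F' E' H' G' D1' D2' s "- \<eta>" by (rule swap)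
  let ?x = "(1, 0) :: int \<times> int"
  note d = diagonalD[OF D] and ds = sw.diagonalD[OF diagonal_swap[OF D]]
  have nz: "?x \<noteq> 0" "0 \<noteq> ?x" "(-1, 0) \<noteq> (0 :: int \<times> int)" by (simp_all add: prod_eq_iff)
  note v = torus_vanish[OF D N]
  define e where "e = tfun (E' 0) (G' 0) (D (E 0))"
  define f where "f = tfun (F' ?x) (G' 0) (D (F ?x))"
  have rel: "tfun \<phi> \<psi> (D (G ?x)) - tfun \<phi> \<psi> (D (H ?x)) =
      tfun \<phi> \<psi> (adj_act br (E 0) (D (F ?x))) - tfun \<phi> \<psi> (adj_act br (F ?x) (D (E 0)))" for \<phi> \<psi>
    using hcocycleD(3)[OF d(1), of "E 0" "F ?x"]
    by (simp add: brackets clinear_diff[OF hcocycleD(1)[OF d(1)]] tfun_simps[symmetric])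
  have "tfun (G' ?x) (F' 0) (D (F ?x)) = 0" "tfun (G' ?x) (E' (- ?x)) (D (E 0)) = 0"
    using sw.E_diagonal(2)[OF ds nz(2)] E_diagonal(1)[OF d, of "- ?x" 0] nz
      tfun_skewD[OF d(1), of "G' ?x" "F' 0" "F ?x"] tfun_skewD[OF d(1), of "G' ?x" "E' (- ?x)" "E 0"]
    by simp_all
  moreover have "tfun (G' ?x) (G' 0) (D (H ?x)) = 0" using GG_vanish(1)[OF d(1) nz(1), of ?x] by simp
  ultimately have "f + e = 0"
    using rel[of "G' ?x" "G' 0"] v(1)[OF nz(1)] by (simp add: act_simps e_def f_def)
  moreover have "f - e = 0"
  proof -
    have "tfun (E' 0) (F' ?x) (D (G ?x)) = 0" "tfun (E' 0) (F' ?x) (D (H ?x)) = 0"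
      using EF_freeD[OF d(2), of 0 ?x] by simp_all
    moreover have "tfun (G' 0) (F' ?x) (D (F ?x)) = - f"
      unfolding f_def by (rule tfun_skewD[OF d(1)])
    ultimately show ?thesis
      using rel[of "E' 0" "F' ?x"] v(2)[of 0] v(3)[of 0]
      by (simp add: act_simps tfun_H'_0 e_def[symmetric])
  qed
  ultimately have "e = 0" by simp
  then show ?thesis using v(4)[of b] by (simp add: e_def)
qed

section \<open>Weights and the vanishing of the normalised cocycle\<close>

definition has_weight :: "(('b \<Rightarrow>\<^sub>0 complex) \<Rightarrow> complex) \<Rightarrow> int \<times> int \<Rightarrow> int \<Rightarrow> bool" where
  "has_weight \<phi> k i \<longleftrightarrow> lfun \<phi> \<and> (\<forall>u. \<phi> (br h u) = (degree_value k + of_int i * \<eta>) * \<phi> u)"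

lemma has_weights: "has_weight (E' k) k 1" "has_weight (F' k) k (-1)" "has_weight (G' k) k 0"
    "has_weight (H' k) k 0" "has_weight D1' 0 0" "has_weight D2' 0 0"
  by (simp_all add: has_weight_def lfuns dual_br degree_value_def)

text \<open>As \<open>D h = 0\<close>, \<open>D\<close> commutes with \<open>h\<close>. Root weights
  lie between -1 and 1, so \<open>i + j - 1\<close> is at least -3; this is the source of the bound
  in \<open>eta\<close>.\<close>

lemma weight_nonzero:
  assumes D: "hcocycle D" and \<phi>: "has_weight \<phi> k i" and \<psi>: "has_weight \<psi> l j"
    and ne: "tfun \<phi> \<psi> (D (E b)) \<noteq> 0" and ij: "\<bar>i + j - 1\<bar> \<le> 3"
  shows "k + l = b \<and> i + j = 1"
proof -
  have "D (br h (E b)) = adj_act br h (D (E b))"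
    using hcocycleD(3)[OF D, of h "E b"] hcocycleD(4)[OF D] by (simp add: clinear_0[OF clinear_adj_act])
  then have "scl (degree_value b + \<eta>) (D (E b)) = adj_act br h (D (E b))"
    by (simp add: br_h clinear_scl[OF hcocycleD(1)[OF D]])
  from arg_cong[OF this, of "tfun \<phi> \<psi>"]
  have "(degree_value b + \<eta>) * tfun \<phi> \<psi> (D (E b))
      = ((degree_value k + of_int i * \<eta>) + (degree_value l + of_int j * \<eta>)) * tfun \<phi> \<psi> (D (E b))"
    using \<phi> \<psi> by (simp add: has_weight_def tfun_simps tfun_adj tfun_left tfun_right distrib_right)
  then have "degree_value b + \<eta> = (degree_value k + of_int i * \<eta>) + (degree_value l + of_int j * \<eta>)"
    using ne by simp
  then have "degree_value (k + l - b) + of_int (i + j - 1) * \<eta> = 0"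
    by (simp add: degree_value_def algebra_simps)
  from eta[OF this ij] show ?thesis by simp
qed

text \<open>The value has root weight 1. Two weights of absolute value at most 1 with sum 1 are 1
  and 0, so one leg is an \<open>E\<close> and the other lies along the diagonal elements or
  \<open>D1\<close>, \<open>D2\<close>, where everything is already zero.\<close>

lemma D_E_vanish:
  assumes D: "diagonal D" and N: "normal_torus D"
  shows "D (E b) = 0"
proof (rule tensor_eq_0I)
  let ?Duals = "range E' \<union> range F' \<union> range G' \<union> range H' \<union> {D1', D2'}"
  note d = diagonalD[OF D]
  have w: "\<exists>k i. has_weight \<phi> k i \<and> \<bar>i\<bar> \<le> 1 \<and> (i = 1 \<longrightarrow> \<phi> \<in> range E')" if "\<phi> \<in> ?Duals" for \<phi>
    using that
  proof (elim UnE rangeE insertE emptyE)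
    fix k assume "\<phi> = E' k" then show ?thesis by (intro exI[of _ k] exI[of _ 1]) (simp add: has_weights)
  next
    fix k assume "\<phi> = F' k" then show ?thesis by (intro exI[of _ k] exI[of _ "-1"]) (simp add: has_weights)
  next
    fix k assume "\<phi> = G' k" then show ?thesis by (intro exI[of _ k] exI[of _ 0]) (simp add: has_weights)
  next
    fix k assume "\<phi> = H' k" then show ?thesis by (intro exI[of _ k] exI[of _ 0]) (simp add: has_weights)
  next
    assume "\<phi> = D1'" then show ?thesis by (intro exI[of _ 0]) (simp add: has_weights)
  next
    assume "\<phi> = D2'" then show ?thesis by (intro exI[of _ 0]) (simp add: has_weights)
  qed
  have main: "tfun (E' k) \<psi> (D (E b)) = 0" if "\<psi> \<in> ?Duals" for k \<psi>
  proof (rule ccontr)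
    assume ne: "tfun (E' k) \<psi> (D (E b)) \<noteq> 0"
    note wt = weight_nonzero[OF d(1) has_weights(1) _ ne]
    have G0: "tfun (E' b) (G' 0) (D (E b)) = 0" by (rule torus_constant_vanish[OF D N])
    from that show False
    proof (elim UnE rangeE insertE emptyE)
      fix l assume \<psi>: "\<psi> = E' l" then show False using wt[OF has_weights(1)[of l, folded \<psi>]] by simp
    next
      fix l assume \<psi>: "\<psi> = F' l" then show False using wt[OF has_weights(2)[of l, folded \<psi>]] by simp
    next
      fix l assume \<psi>: "\<psi> = G' l"
      then have "l = b - k" using wt[OF has_weights(3)[of l, folded \<psi>]] by auto
      then show False using ne G0 E_diagonal(1)[OF d, of k b] \<psi> by (cases "k = b") auto
    next
      fix l assume \<psi>: "\<psi> = H' l"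
      then have "l = b - k" using wt[OF has_weights(4)[of l, folded \<psi>]] by auto
      then show False using ne G0 E_diagonal(2)[OF d, of k b] \<psi> by (cases "k = b") (auto simp: tfun_H'_0)
    next
      assume \<psi>: "\<psi> = D1'" then show False using ne wt[OF has_weights(5)[folded \<psi>]] torus_vanish(2)[OF D N, of b] \<psi> by auto
    next
      assume \<psi>: "\<psi> = D2'" then show False using ne wt[OF has_weights(6)[folded \<psi>]] torus_vanish(3)[OF D N, of b] \<psi> by auto
    qed
  qed
  have all: "tfun \<phi> \<psi> (D (E b)) = 0" if mem: "\<phi> \<in> ?Duals" "\<psi> \<in> ?Duals" for \<phi> \<psi>
  proof -
    obtain k i l j where wt: "has_weight \<phi> k i" "\<bar>i\<bar> \<le> 1" "i = 1 \<longrightarrow> \<phi> \<in> range E'"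
      "has_weight \<psi> l j" "\<bar>j\<bar> \<le> 1" "j = 1 \<longrightarrow> \<psi> \<in> range E'"
      using w[OF mem(1)] w[OF mem(2)] by blast
    consider "\<phi> \<in> range E'" | "\<psi> \<in> range E'" | "i \<noteq> 1" "j \<noteq> 1" using wt by blast
    then show ?thesis
    proof cases
      case 1
      then show ?thesis using main[OF mem(2)] by auto
    next
      case 2
      then show ?thesis using main[OF mem(1)] tfun_skewD[OF d(1), of \<phi> \<psi>] by auto
    next
      case 3
      then show ?thesis using weight_nonzero[OF d(1) wt(1,4), of b] wt(2,5) by fastforce
    qed
  qed
  fix \<phi> j assume \<phi>: "\<phi> \<in> ?Duals"
  obtain z \<psi> where \<psi>: "\<psi> \<in> ?Duals" "\<And>u. Poly_Mapping.lookup u j = z * \<psi> u"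
    using coordinates[of j] by blast
  show "tfun \<phi> (\<lambda>u. Poly_Mapping.lookup u j) (D (E b)) = 0"
    unfolding \<psi>(2) by (simp add: tfun_right all[OF \<phi> \<psi>(1)])
qed

lemma no_invariants_adj:
  "(\<And>a. adj_act br (E a) v = 0) \<Longrightarrow> (\<And>a. adj_act br (F a) v = 0) \<Longrightarrow> v = 0"
  unfolding adj_act_eq by (rule no_invariants[of br]) (rule linear_br)

text \<open>If \<open>z\<close> maps each \<open>E b\<close> and \<open>F b\<close> to a multiple of
  an element of the same family, then \<open>D z\<close> is annihilated by all of these, because
  \<open>D\<close> is zero on them. Absence of invariants then gives \<open>D z = 0\<close>.\<close>

lemma D_vanish:
  assumes D: "diagonal D" and N: "normal_torus D"
  shows "D x = 0"
proof -
  interpret sw: torus_sl2 br F E H G D1 D2 h F' E' H' G' D1' D2' s "- \<eta>" by (rule swap)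
  note d = diagonalD[OF D]
  have E0: "D (E b) = 0" for b by (rule D_E_vanish[OF D N])
  have F0: "D (F b) = 0" for b
    by (rule sw.D_E_vanish[OF diagonal_swap[OF D] normal_torus_swap[OF D N]])
  have kill: "D z = 0" if zE: "\<And>b. \<exists>m. br z (E b) = scl m (E (b + a))"
    and zF: "\<And>b. \<exists>m. br z (F b) = scl m (F (b + a))" for z a
  proof (rule no_invariants_adj)
    show "adj_act br (E b) (D z) = 0" for b
    proof -
      obtain m where "br z (E b) = scl m (E (b + a))" using zE[of b] by blast
      then show ?thesis using hcocycleD(3)[OF d(1), of z "E b"]
        by (simp add: E0 clinear_scl[OF hcocycleD(1)[OF d(1)]] clinear_0[OF clinear_adj_act])
    qed
    show "adj_act br (F b) (D z) = 0" for b
    proof -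
      obtain m where "br z (F b) = scl m (F (b + a))" using zF[of b] by blast
      then show ?thesis using hcocycleD(3)[OF d(1), of z "F b"]
        by (simp add: F0 clinear_scl[OF hcocycleD(1)[OF d(1)]] clinear_0[OF clinear_adj_act])
    qed
  qed
  have "D (G a) = 0" "D (H a) = 0" for a
    by (rule kill[of _ a]; metis brackets(1-4) add.commute)+
  moreover have "D D1 = 0" "D D2 = 0"
    by (rule kill[of _ 0]; metis brackets(7-10) add_0_right)+
  ultimately have "D x = 0" if "x \<in> range E \<union> range F \<union> range G \<union> range H \<union> {D1, D2}" for x
    using that E0 F0 by auto
  then have "D (bvec i) = 0" for i
    using spanning[of i] by (auto simp: clinear_scl[OF hcocycleD(1)[OF d(1)]])
  then show ?thesis
    by (rule clinear_eqI[OF hcocycleD(1)[OF d(1)] clinear_zero])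
qed

theorem hcocycle_inner:
  assumes D: "hcocycle D"
  obtains r where "skew r" "\<And>x. D x = adj_act br x r"
proof -
  obtain r1 where r1: "skew r1" "adj_act br h r1 = 0" "normal_torus (\<lambda>x. D x - adj_act br x r1)"
    by (rule normalize_torus[OF D])
  define A where "A = (\<lambda>x. D x - adj_act br x r1)"
  have A: "hcocycle A" "normal_torus A" using hcocycle_sub[OF D r1(1,2)] r1(3) by (simp_all add: A_def)
  obtain r2 where r2: "skew r2" "adj_act br h r2 = 0" "no_D_legs r2" "EF_free (\<lambda>x. A x - adj_act br x r2)"
    by (rule normalize_EF[OF A(1)])
  define B where "B = (\<lambda>x. A x - adj_act br x r2)"
  have B: "hcocycle B" "normal_torus B" "EF_free B"
    using hcocycle_sub[OF A(1) r2(1,2)] normal_torus_sub[OF A(2) r2(3)] r2(4) by (simp_all add: B_def)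
  obtain r3 where r3: "skew r3" "adj_act br h r3 = 0" "no_D_legs r3" "\<And>k l. tfun (E' k) (F' l) r3 = 0"
    "GH_free (\<lambda>x. B x - adj_act br x r3)"
    by (rule normalize_GH[OF B(1)]) (rule that)
  define C where "C = (\<lambda>x. B x - adj_act br x r3)"
  have C: "hcocycle C" "normal_torus C" "EF_free C" "GH_free C"
    using hcocycle_sub[OF B(1) r3(1,2)] normal_torus_sub[OF B(2) r3(3)] EF_free_sub[OF B(3) r3(4)] r3(5)
    by (simp_all add: C_def)
  obtain r4 where r4: "skew r4" "adj_act br h r4 = 0" "no_D_legs r4" "EF_free (\<lambda>x. C x - adj_act br x r4)"
    "GH_free (\<lambda>x. C x - adj_act br x r4)" "G_diagonal (\<lambda>x. C x - adj_act br x r4)"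
    "torus_sl2.G_diagonal F H F' H' (\<lambda>x. C x - adj_act br x r4)"
    by (rule normalize_GG[OF C(1,3,4)])
  have "diagonal (\<lambda>x. C x - adj_act br x r4)"
    using hcocycle_sub[OF C(1) r4(1,2)] r4(4-7) by (simp add: diagonal_def)
  then have "C x - adj_act br x r4 = 0" for x
    using normal_torus_sub[OF C(2) r4(3)] by (rule D_vanish)
  then have "D x = adj_act br x (r1 + r2 + r3 + r4)" for x
    by (simp add: C_def B_def A_def clinear_add[OF clinear_adj_act] algebra_simps)
  moreover have "skew (r1 + r2 + r3 + r4)" by (intro skew_add r1 r2 r3 r4)
  ultimately show ?thesis by (intro that)
qed

end


section \<open>The extended affine algebra\<close>

definition wgauge :: "complex \<Rightarrow> int \<times> int \<Rightarrow> complex" where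
  "wgauge s k = s powi (fst k * snd k)"

definition wcoef :: "complex \<Rightarrow> int \<times> int \<Rightarrow> qtorus \<Rightarrow> complex" where
  "wcoef s k p = Poly_Mapping.lookup p k / wgauge s k"

definition wmon :: "complex \<Rightarrow> int \<times> int \<Rightarrow> qtorus" where
  "wmon s a = scl (wgauge s a) (bvec a)"

lemma lfun_wcoef: "lfun (wcoef s k)"
  by (simp add: lfun_def wcoef_def lookup_add add_divide_distrib)

lemmas wcoef_simps = lfun_add[OF lfun_wcoef] lfun_scl[OF lfun_wcoef] lfun_diff[OF lfun_wcoef]
  lfun_0[OF lfun_wcoef] lfun_minus[OF lfun_wcoef]

context
  fixes s :: complex
  assumes s: "s \<noteq> 0"
begin

lemma wgauge_nonzero [simp]: "wgauge s k \<noteq> 0"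
  using s by (simp add: wgauge_def)

lemma wcoef_wmon: "wcoef s k (wmon s a) = (if k = a then 1 else 0)"
  by (auto simp: wcoef_def wmon_def)

lemma wcoef_bvec: "wcoef s k (bvec a) = (if k = a then 1 / wgauge s a else 0)"
  by (auto simp: wcoef_def)

lemma powi_square: "(s\<^sup>2) powi n = s powi (2 * n)"
  by (simp add: power_int_mult)

text \<open>Since \<open>str_const s a (k - a) = str_const s a k\<close>, the scalar can be written
  in terms of the degree \<open>k\<close> that is read off.\<close>

lemma wcoef_qmul:
  "wcoef s k (qmul (s\<^sup>2) (wmon s a) p) = str_const s a k * wcoef s (k - a) p"
  "wcoef s k (qmul (s\<^sup>2) p (wmon s a)) = str_const s k a * wcoef s (k - a) p"
proof -
  have ex: "k = a + i \<longleftrightarrow> k - a = i" for i by auto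
  have "wgauge s a * (s\<^sup>2) powi (snd a * fst i) / wgauge s (a + i) = str_const s a (a + i) / wgauge s i"
    "wgauge s a * (s\<^sup>2) powi (snd i * fst a) / wgauge s (a + i) = str_const s (a + i) a / wgauge s i" for i
    using s by (simp_all add: wgauge_def str_const_def pairing_def powi_square divide_eq_eq eq_divide_eq
      power_int_add[symmetric] algebra_simps)
  note g = this
  show "wcoef s k (qmul (s\<^sup>2) (wmon s a) p) = str_const s a k * wcoef s (k - a) p"
  proof (rule lfun_eqI[of "\<lambda>p. wcoef s k (qmul (s\<^sup>2) (wmon s a) p)"])
    show "wcoef s k (qmul (s\<^sup>2) (wmon s a) (bvec i)) = str_const s a k * wcoef s (k - a) (bvec i)" for i
      using g(1)[of i] by (cases a; cases i; cases k) (auto simp: wmon_def qmul_simps qmul_bvec wcoef_simps wcoef_bvec ex)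
  qed (intro lfun_compose[OF lfun_wcoef clinear_qmul_right] lfun_mult lfun_wcoef)+
  show "wcoef s k (qmul (s\<^sup>2) p (wmon s a)) = str_const s k a * wcoef s (k - a) p"
  proof (rule lfun_eqI[of "\<lambda>p. wcoef s k (qmul (s\<^sup>2) p (wmon s a))"])
    show "wcoef s k (qmul (s\<^sup>2) (bvec i) (wmon s a)) = str_const s k a * wcoef s (k - a) (bvec i)" for i
      using g(2)[of i] by (cases a; cases i; cases k) (auto simp: wmon_def qmul_simps qmul_bvec wcoef_simps wcoef_bvec ex add.commute)
  qed (intro lfun_compose[OF lfun_wcoef clinear_qmul_left] lfun_mult lfun_wcoef)+
qed

lemma wcoef_qgrad: "wcoef s k (qgrad t p) = (fst t * of_int (fst k) + snd t * of_int (snd k)) * wcoef s k p"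
  using lookup_qgrad[of t p "fst k" "snd k"] by (simp add: wcoef_def)

end

section \<open>Spanning families and coordinates of the concrete algebra\<close>

definition ltE :: "complex \<Rightarrow> int \<times> int \<Rightarrow> ltilde" where
  "ltE s a = scl (wgauge s a) (bvec (Be a))"

definition ltF :: "complex \<Rightarrow> int \<times> int \<Rightarrow> ltilde" where
  "ltF s a = scl (wgauge s a) (bvec (Bf a))"

text \<open>The matrix units of degree 0 are not in the algebra; their traceless parts
  \<open>d / 2\<close> and \<open>- d / 2\<close> act on root vectors in the same way and differ by
  \<open>d\<close>, so the bracket formulas need no exception in degree 0.\<close>

definition ltG :: "complex \<Rightarrow> int \<times> int \<Rightarrow> ltilde" where
  "ltG s a = (if a = 0 then scl (1/2) (bvec Bd) else scl (wgauge s a) (bvec (Bg (Abs_nonzero_index a))))"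

definition ltH :: "complex \<Rightarrow> int \<times> int \<Rightarrow> ltilde" where
  "ltH s a = (if a = 0 then scl (-1/2) (bvec Bd) else scl (wgauge s a) (bvec (Bh (Abs_nonzero_index a))))"

text \<open>\<open>d\<close> has eigenvalues 2 and -2 on root vectors, so 1/20 gives \<eta> = 1/10.
  Nonzero multiples j/10 with j at most 3 in absolute value are never integers, and the factor \<i>
  keeps the two degrees apart.\<close>

definition lth :: ltilde where
  "lth = bvec Bd1 + scl \<i> (bvec Bd2) + scl (1/20) (bvec Bd)"

definition ltcoef :: "complex \<Rightarrow> 2 \<Rightarrow> 2 \<Rightarrow> int \<times> int \<Rightarrow> ltilde \<Rightarrow> complex" where
  "ltcoef s i j k u = wcoef s k (mat_part u $ i $ j)"

definition ltder1 :: "ltilde \<Rightarrow> complex" where "ltder1 u = Poly_Mapping.lookup u Bd1"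
definition ltder2 :: "ltilde \<Rightarrow> complex" where "ltder2 u = Poly_Mapping.lookup u Bd2"

lemma der_part_eq: "der_part u = (ltder1 u, ltder2 u)"
  by (simp add: der_part_def ltder1_def ltder2_def)

lemma lfun_ltcoef: "lfun (ltcoef s i j k)"
  unfolding ltcoef_def by (rule lfun_compose[OF lfun_wcoef clinear_mat_part])

lemma lfun_ltder: "lfun ltder1" "lfun ltder2"
  by (simp_all add: lfun_def ltder1_def ltder2_def lookup_add)

lemma mat_part_scl: "mat_part (scl c u) $ i $ j = scl c (mat_part u $ i $ j)"
  by (rule clinear_scl[OF clinear_mat_part])

lemma wmon_0: "wmon s 0 = bvec (0, 0)"
  by (simp add: wmon_def wgauge_def zero_prod_def)

lemma Abs_nonzero_inverse: "a \<noteq> 0 \<Longrightarrow> Rep_nonzero_index (Abs_nonzero_index a) = a"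
  by (rule Abs_nonzero_index_inverse) (simp add: zero_prod_def)

lemma mat_part_basis:
  "mat_part (ltE s a) $ i $ j = (if i = 1 \<and> j = 2 then wmon s a else 0)"
  "mat_part (ltF s a) $ i $ j = (if i = 2 \<and> j = 1 then wmon s a else 0)"
  "mat_part (ltG s a) $ i $ j = (if i = 1 \<and> j = 1 then if a = 0 then scl (1/2) (wmon s 0) else wmon s a
     else if a = 0 \<and> i = 2 \<and> j = 2 then scl (-1/2) (wmon s 0) else 0)"
  "mat_part (ltH s a) $ i $ j = (if i = 2 \<and> j = 2 then if a = 0 then scl (1/2) (wmon s 0) else wmon s a
     else if a = 0 \<and> i = 1 \<and> j = 1 then scl (-1/2) (wmon s 0) else 0)"
  "mat_part (bvec Bd1) $ i $ j = 0" "mat_part (bvec Bd2) $ i $ j = 0"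
  "mat_part lth $ i $ j = (if i = 1 \<and> j = 1 then scl (1/20) (wmon s 0)
     else if i = 2 \<and> j = 2 then scl (-1/20) (wmon s 0) else 0)"
  using exhaust_2[of i] exhaust_2[of j]
  by (auto simp: ltE_def ltF_def ltG_def ltH_def lth_def mat_part_scl munit_def wmon_0 wmon_def[of s a]
      Abs_nonzero_inverse clinear_add[OF clinear_mat_part] lookup_add lookup_minus intro!: poly_mapping_eqI)

lemma der_values:
  "ltder1 (ltE s a) = 0" "ltder2 (ltE s a) = 0" "ltder1 (ltF s a) = 0" "ltder2 (ltF s a) = 0"
  "ltder1 (ltG s a) = 0" "ltder2 (ltG s a) = 0" "ltder1 (ltH s a) = 0" "ltder2 (ltH s a) = 0"
  "ltder1 (bvec Bd1) = 1" "ltder2 (bvec Bd1) = 0" "ltder1 (bvec Bd2) = 0" "ltder2 (bvec Bd2) = 1"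
  "ltder1 lth = 1" "ltder2 lth = \<i>"
  by (simp_all add: ltder1_def ltder2_def ltE_def ltF_def ltG_def ltH_def lth_def lookup_add)

lemma ltcoef_trace: "ltcoef s 2 2 0 u = - ltcoef s 1 1 0 u"
proof (rule lfun_eqI[OF lfun_ltcoef])
  show "lfun (\<lambda>u. - ltcoef s 1 1 0 u)"
    using lfun_mult(1)[OF lfun_ltcoef, of "- 1"] by simp
  have "Rep_nonzero_index k \<noteq> (0, 0)" for k using Rep_nonzero_index[of k] by simp
  then show "ltcoef s 2 2 0 (bvec b) = - ltcoef s 1 1 0 (bvec b)" for b
    by (cases b) (auto simp: ltcoef_def wcoef_def munit_def lookup_minus zero_prod_def)
qed

context
  fixes s :: complex
  assumes s: "s \<noteq> 0"
begin

lemma ltcoef_bracket: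
  "ltcoef s i j k (ltilde_bracket (s\<^sup>2) x u) =
     (\<Sum>l\<in>UNIV. wcoef s k (qmul (s\<^sup>2) (mat_part x $ i $ l) (mat_part u $ l $ j)))
   - (\<Sum>l\<in>UNIV. wcoef s k (qmul (s\<^sup>2) (mat_part u $ i $ l) (mat_part x $ l $ j)))
   + (ltder1 x * of_int (fst k) + ltder2 x * of_int (snd k)) * ltcoef s i j k u
   - (ltder1 u * of_int (fst k) + ltder2 u * of_int (snd k)) * wcoef s k (mat_part x $ i $ j)"
  by (simp add: ltcoef_def ltilde_bracket_parts mmul_def mgrad_def wcoef_simps lfun_sum[OF lfun_wcoef]
      wcoef_qgrad[OF s] der_part_eq)

lemma ltder_bracket: "ltder1 (ltilde_bracket q x u) = 0" "ltder2 (ltilde_bracket q x u) = 0"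
  using ltilde_bracket_parts(2)[of q x u] by (simp_all add: der_part_eq)

lemmas ltcoef_bracket_simps = ltcoef_bracket mat_part_basis(1-6) mat_part_basis(7)[where s = s] der_values sum_2
  wcoef_qmul[OF s] qmul_simps wcoef_simps wcoef_wmon[OF s]
  clinear_0[OF clinear_qmul_left] clinear_0[OF clinear_qmul_right] ltcoef_def[symmetric]

lemma ltcoef_values:
  "ltcoef s i j k (ltE s a) = (if i = 1 \<and> j = 2 \<and> k = a then 1 else 0)"
  "ltcoef s i j k (ltF s a) = (if i = 2 \<and> j = 1 \<and> k = a then 1 else 0)"
  "ltcoef s i j k (ltG s a) = (if i = 1 \<and> j = 1 \<and> k = a then 1 else 0) - (if i = j \<and> k = 0 \<and> a = 0 then 1/2 else 0)"
  "ltcoef s i j k (ltH s a) = (if i = 2 \<and> j = 2 \<and> k = a then 1 else 0) - (if i = j \<and> k = 0 \<and> a = 0 then 1/2 else 0)"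
  "ltcoef s i j k (bvec Bd1) = 0" "ltcoef s i j k (bvec Bd2) = 0"
  using exhaust_2[of i] exhaust_2[of j]
  by (simp_all only: ltcoef_def mat_part_basis) (auto simp: wcoef_simps wcoef_wmon[OF s])

lemma ltilde_coef_eqI:
  assumes "\<And>i j k. ltcoef s i j k u = ltcoef s i j k v" "ltder1 u = ltder1 v" "ltder2 u = ltder2 v"
  shows "u = v"
proof (rule ltilde_eqI)
  have "Poly_Mapping.lookup (mat_part u $ i $ j) k = Poly_Mapping.lookup (mat_part v $ i $ j) k" for i j k
    using assms(1)[of i j k] wgauge_nonzero[OF s, of k] by (simp add: ltcoef_def wcoef_def)
  then show "mat_part u = mat_part v" by (auto simp: vec_eq_iff intro!: poly_mapping_eqI)
qed (simp add: der_part_eq assms)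

lemma ltcoef_ad:
  "ltcoef s 1 2 k (ltilde_bracket (s\<^sup>2) (ltE s a) u) = str_const s a k * ltcoef s 2 2 (k - a) u
     - str_const s k a * ltcoef s 1 1 (k - a) u
     - (if k = a then of_int (fst a) * ltder1 u + of_int (snd a) * ltder2 u else 0)"
  "ltcoef s 1 2 k (ltilde_bracket (s\<^sup>2) (ltF s a) u) = 0"
  "ltcoef s 1 2 k (ltilde_bracket (s\<^sup>2) (ltG s a) u) = str_const s a k * ltcoef s 1 2 (k - a) u"
  "ltcoef s 1 2 k (ltilde_bracket (s\<^sup>2) (ltH s a) u) = - str_const s k a * ltcoef s 1 2 (k - a) u"
  "ltcoef s 1 2 k (ltilde_bracket (s\<^sup>2) lth u) = (degree_value k + 1/10) * ltcoef s 1 2 k u"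
  "ltcoef s 2 1 k (ltilde_bracket (s\<^sup>2) (ltF s a) u) = str_const s a k * ltcoef s 1 1 (k - a) u
     - str_const s k a * ltcoef s 2 2 (k - a) u
     - (if k = a then of_int (fst a) * ltder1 u + of_int (snd a) * ltder2 u else 0)"
  "ltcoef s 2 1 k (ltilde_bracket (s\<^sup>2) (ltE s a) u) = 0"
  "ltcoef s 2 1 k (ltilde_bracket (s\<^sup>2) (ltH s a) u) = str_const s a k * ltcoef s 2 1 (k - a) u"
  "ltcoef s 2 1 k (ltilde_bracket (s\<^sup>2) (ltG s a) u) = - str_const s k a * ltcoef s 2 1 (k - a) u"
  "ltcoef s 2 1 k (ltilde_bracket (s\<^sup>2) lth u) = (degree_value k - 1/10) * ltcoef s 2 1 k u"
  "ltcoef s 1 1 k (ltilde_bracket (s\<^sup>2) (ltE s a) u) = str_const s a k * ltcoef s 2 1 (k - a) u"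
  "ltcoef s 1 1 k (ltilde_bracket (s\<^sup>2) (ltF s a) u) = - str_const s k a * ltcoef s 1 2 (k - a) u"
  "ltcoef s 1 1 k (ltilde_bracket (s\<^sup>2) (ltG s a) u) = (str_const s a k - str_const s k a) * ltcoef s 1 1 (k - a) u
     - (if k = a then of_int (fst a) * ltder1 u + of_int (snd a) * ltder2 u else 0)"
  "ltcoef s 1 1 k (ltilde_bracket (s\<^sup>2) (ltH s a) u) = 0"
  "ltcoef s 1 1 k (ltilde_bracket (s\<^sup>2) lth u) = degree_value k * ltcoef s 1 1 k u"
  "ltcoef s 2 2 k (ltilde_bracket (s\<^sup>2) (ltF s a) u) = str_const s a k * ltcoef s 1 2 (k - a) u"
  "ltcoef s 2 2 k (ltilde_bracket (s\<^sup>2) (ltE s a) u) = - str_const s k a * ltcoef s 2 1 (k - a) u"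
  "ltcoef s 2 2 k (ltilde_bracket (s\<^sup>2) (ltH s a) u) = (str_const s a k - str_const s k a) * ltcoef s 2 2 (k - a) u
     - (if k = a then of_int (fst a) * ltder1 u + of_int (snd a) * ltder2 u else 0)"
  "ltcoef s 2 2 k (ltilde_bracket (s\<^sup>2) (ltG s a) u) = 0"
  "ltcoef s 2 2 k (ltilde_bracket (s\<^sup>2) lth u) = degree_value k * ltcoef s 2 2 k u"
  by (cases "a = 0"; simp add: ltcoef_bracket_simps degree_value_def algebra_simps)+

lemma ltcoef_ad_D:
  "ltcoef s i j k (ltilde_bracket (s\<^sup>2) (bvec Bd1) u) = of_int (fst k) * ltcoef s i j k u"
  "ltcoef s i j k (ltilde_bracket (s\<^sup>2) (bvec Bd2) u) = of_int (snd k) * ltcoef s i j k u"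
  by (simp_all add: ltcoef_bracket_simps)

lemmas lt_br_linear = lie_algebraD(1,2)[OF lie_algebra_ltilde[of "s\<^sup>2"]]

lemma ltcoef_linear: "ltcoef s i j k (u + v) = ltcoef s i j k u + ltcoef s i j k v"
    "ltcoef s i j k (u - v) = ltcoef s i j k u - ltcoef s i j k v"
    "ltcoef s i j k (scl z u) = z * ltcoef s i j k u" "ltcoef s i j k 0 = 0"
  by (simp_all add: lfun_add[OF lfun_ltcoef] lfun_diff[OF lfun_ltcoef] lfun_scl[OF lfun_ltcoef]
      lfun_0[OF lfun_ltcoef])

lemma ltder_linear: "ltder1 (u + v) = ltder1 u + ltder1 v" "ltder1 (u - v) = ltder1 u - ltder1 v"
    "ltder1 (scl z u) = z * ltder1 u" "ltder1 0 = 0"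
    "ltder2 (u + v) = ltder2 u + ltder2 v" "ltder2 (u - v) = ltder2 u - ltder2 v"
    "ltder2 (scl z u) = z * ltder2 u" "ltder2 0 = 0"
  by (simp_all add: ltder1_def ltder2_def lookup_add lookup_minus)

lemma lt_eqI:
  assumes "\<And>k. ltcoef s 1 2 k u = ltcoef s 1 2 k v" "\<And>k. ltcoef s 2 1 k u = ltcoef s 2 1 k v"
    "\<And>k. ltcoef s 1 1 k u = ltcoef s 1 1 k v" "\<And>k. ltcoef s 2 2 k u = ltcoef s 2 2 k v"
    "ltder1 u = ltder1 v" "ltder2 u = ltder2 v"
  shows "u = v"
proof (rule ltilde_coef_eqI)
  show "ltcoef s i j k u = ltcoef s i j k v" for i j k
    using exhaust_2[of i] exhaust_2[of j] assms(1-4)[of k] by auto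
qed (rule assms)+

lemma lt_brackets:
  "ltilde_bracket (s\<^sup>2) (ltG s a) (ltE s b) = scl (str_const s a b) (ltE s (a + b))"
  "ltilde_bracket (s\<^sup>2) (ltH s a) (ltE s b) = scl (- str_const s b a) (ltE s (a + b))"
  "ltilde_bracket (s\<^sup>2) (ltG s a) (ltF s b) = scl (- str_const s b a) (ltF s (a + b))"
  "ltilde_bracket (s\<^sup>2) (ltH s a) (ltF s b) = scl (str_const s a b) (ltF s (a + b))"
  "ltilde_bracket (s\<^sup>2) (ltG s a) (ltH s b) = 0"
  "ltilde_bracket (s\<^sup>2) (ltE s a) (ltF s b)
     = scl (str_const s a b) (ltG s (a + b)) - scl (str_const s b a) (ltH s (a + b))"
  "ltilde_bracket (s\<^sup>2) (bvec Bd1) (ltE s a) = scl (of_int (fst a)) (ltE s a)"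
  "ltilde_bracket (s\<^sup>2) (bvec Bd1) (ltF s a) = scl (of_int (fst a)) (ltF s a)"
  "ltilde_bracket (s\<^sup>2) (bvec Bd2) (ltE s a) = scl (of_int (snd a)) (ltE s a)"
  "ltilde_bracket (s\<^sup>2) (bvec Bd2) (ltF s a) = scl (of_int (snd a)) (ltF s a)"
  "ltilde_bracket (s\<^sup>2) lth (ltE s a) = scl (degree_value a + 1/10) (ltE s a)"
  "ltilde_bracket (s\<^sup>2) lth (ltF s a) = scl (degree_value a - 1/10) (ltF s a)"
  "ltilde_bracket (s\<^sup>2) lth (ltG s a) = scl (degree_value a) (ltG s a)"
  "ltilde_bracket (s\<^sup>2) lth (ltH s a) = scl (degree_value a) (ltH s a)"
  "ltilde_bracket (s\<^sup>2) lth (bvec Bd1) = 0" "ltilde_bracket (s\<^sup>2) lth (bvec Bd2) = 0"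
proof -
  \<comment> \<open>In opposite degrees both structure constants are 1, and the two degree-zero
    elements, which share coordinates, combine correctly.\<close>
  have opp: "b = - a" if "a + b = 0" for a b :: "int \<times> int" using that by (simp add: add_eq_0_iff)
  note S = ltcoef_ad ltcoef_ad_D ltcoef_values ltcoef_linear ltder_linear der_values ltder_bracket
  show "ltilde_bracket (s\<^sup>2) (ltG s a) (ltE s b) = scl (str_const s a b) (ltE s (a + b))"
    by (rule lt_eqI) (auto simp: S)
  show "ltilde_bracket (s\<^sup>2) (ltH s a) (ltE s b) = scl (- str_const s b a) (ltE s (a + b))"
    by (rule lt_eqI) (auto simp: S)
  show "ltilde_bracket (s\<^sup>2) (ltG s a) (ltF s b) = scl (- str_const s b a) (ltF s (a + b))"
    by (rule lt_eqI) (auto simp: S)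
  show "ltilde_bracket (s\<^sup>2) (ltH s a) (ltF s b) = scl (str_const s a b) (ltF s (a + b))"
    by (rule lt_eqI) (auto simp: S)
  show "ltilde_bracket (s\<^sup>2) (ltG s a) (ltH s b) = 0"
    by (rule lt_eqI) (auto simp: S)
  show "ltilde_bracket (s\<^sup>2) (ltE s a) (ltF s b)
     = scl (str_const s a b) (ltG s (a + b)) - scl (str_const s b a) (ltH s (a + b))"
    by (rule lt_eqI) (auto simp: S dest!: opp)
  show "ltilde_bracket (s\<^sup>2) (bvec Bd1) (ltE s a) = scl (of_int (fst a)) (ltE s a)"
    "ltilde_bracket (s\<^sup>2) (bvec Bd1) (ltF s a) = scl (of_int (fst a)) (ltF s a)"
    "ltilde_bracket (s\<^sup>2) (bvec Bd2) (ltE s a) = scl (of_int (snd a)) (ltE s a)"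
    "ltilde_bracket (s\<^sup>2) (bvec Bd2) (ltF s a) = scl (of_int (snd a)) (ltF s a)"
    "ltilde_bracket (s\<^sup>2) lth (ltE s a) = scl (degree_value a + 1/10) (ltE s a)"
    "ltilde_bracket (s\<^sup>2) lth (ltF s a) = scl (degree_value a - 1/10) (ltF s a)"
    "ltilde_bracket (s\<^sup>2) lth (ltG s a) = scl (degree_value a) (ltG s a)"
    "ltilde_bracket (s\<^sup>2) lth (ltH s a) = scl (degree_value a) (ltH s a)"
    "ltilde_bracket (s\<^sup>2) lth (bvec Bd1) = 0" "ltilde_bracket (s\<^sup>2) lth (bvec Bd2) = 0"
    by (rule lt_eqI; auto simp: S degree_value_def)+
qed

lemma lookup_ltcoef:
  "Poly_Mapping.lookup u (Be m) = wgauge s m * ltcoef s 1 2 m u"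
  "Poly_Mapping.lookup u (Bf m) = wgauge s m * ltcoef s 2 1 m u"
  "Poly_Mapping.lookup u Bd = 1 * ltcoef s 1 1 0 u"
  "Poly_Mapping.lookup u (Bg k) = wgauge s (Rep_nonzero_index k) * ltcoef s 1 1 (Rep_nonzero_index k) u"
  "Poly_Mapping.lookup u (Bh k) = wgauge s (Rep_nonzero_index k) * ltcoef s 2 2 (Rep_nonzero_index k) u"
  using wgauge_nonzero[OF s]
  by (simp_all add: lookup_ltilde ltcoef_def wcoef_def) (simp add: wgauge_def zero_prod_def)

lemma bvec_spanning:
  "bvec (Be m) = scl (1 / wgauge s m) (ltE s m)" "bvec (Bf m) = scl (1 / wgauge s m) (ltF s m)"
  "bvec Bd = scl 2 (ltG s 0)"
  "bvec (Bg k) = scl (1 / wgauge s (Rep_nonzero_index k)) (ltG s (Rep_nonzero_index k))"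
  "bvec (Bh k) = scl (1 / wgauge s (Rep_nonzero_index k)) (ltH s (Rep_nonzero_index k))"
  using wgauge_nonzero[OF s] Rep_nonzero_index[of k]
  by (simp_all add: ltE_def ltF_def ltG_def ltH_def scl_scl Rep_nonzero_index_inverse zero_prod_def)

lemma finite_ltcoef: "finite {k. ltcoef s i j k u \<noteq> 0}"
  by (rule finite_subset[of _ "Poly_Mapping.keys (mat_part u $ i $ j)"])
     (auto simp: ltcoef_def wcoef_def in_keys_iff)

lemma torus_sl2_ltilde:
  assumes root: "\<And>n::nat. n > 0 \<Longrightarrow> s ^ n \<noteq> 1"
  shows "torus_sl2 (ltilde_bracket (s\<^sup>2)) (ltE s) (ltF s) (ltG s) (ltH s) (bvec Bd1) (bvec Bd2) lth
     (ltcoef s 1 2) (ltcoef s 2 1) (ltcoef s 1 1) (ltcoef s 2 2) ltder1 ltder2 s (1/10)"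
proof -
  have eta: "k = 0 \<and> j = 0" if "degree_value k + of_int j * (1/10) = 0" "\<bar>j\<bar> \<le> 3" for k and j :: int
  proof -
    have "Im (degree_value k + of_int j * (1/10)) = 0" "Re (degree_value k + of_int j * (1/10)) = 0"
      using that(1) by simp_all
    then have "snd k = 0" "real_of_int (10 * fst k + j) = 0"
      by (simp_all add: degree_value_def)
    then have "snd k = 0" "10 * fst k + j = 0" by linarith+
    then show ?thesis using that(2) by (simp add: prod_eq_iff) arith
  qed
  have coords: "\<exists>c. \<exists>\<phi> \<in> range (ltcoef s 1 2) \<union> range (ltcoef s 2 1) \<union> range (ltcoef s 1 1)
      \<union> range (ltcoef s 2 2) \<union> {ltder1, ltder2}. \<forall>u. Poly_Mapping.lookup u b = c * \<phi> u" for b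
  proof (cases b)
    case (Be m) show ?thesis unfolding Be lookup_ltcoef by blast
  next
    case (Bf m) show ?thesis unfolding Bf lookup_ltcoef by blast
  next
    case Bd show ?thesis unfolding Bd lookup_ltcoef by blast
  next
    case (Bg m) show ?thesis unfolding Bg lookup_ltcoef by blast
  next
    case (Bh m) show ?thesis unfolding Bh lookup_ltcoef by blast
  next
    case Bd1 show ?thesis unfolding Bd1 by (intro exI[of _ 1] bexI[of _ ltder1]) (simp_all add: ltder1_def)
  next
    case Bd2 show ?thesis unfolding Bd2 by (intro exI[of _ 1] bexI[of _ ltder2]) (simp_all add: ltder2_def)
  qed
  have span: "\<exists>z. \<exists>x \<in> range (ltE s) \<union> range (ltF s) \<union> range (ltG s) \<union> range (ltH s) \<union> {bvec Bd1, bvec Bd2}.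
      bvec b = scl z x" for b
  proof (cases b)
    case (Be m) show ?thesis unfolding Be bvec_spanning by blast
  next
    case (Bf m) show ?thesis unfolding Bf bvec_spanning by blast
  next
    case Bd show ?thesis unfolding Bd bvec_spanning by blast
  next
    case (Bg m) show ?thesis unfolding Bg bvec_spanning by blast
  next
    case (Bh m) show ?thesis unfolding Bh bvec_spanning by blast
  next
    case Bd1 show ?thesis unfolding Bd1 by (intro exI[of _ 1] bexI[of _ "bvec Bd1"]) simp_all
  next
    case Bd2 show ?thesis unfolding Bd2 by (intro exI[of _ 1] bexI[of _ "bvec Bd2"]) simp_all
  qed
  have lie: "lie_algebra (ltilde_bracket (s\<^sup>2))" using s by (intro lie_algebra_ltilde) simp
  show ?thesis
    by (unfold_locales; (rule eta coords span lie root; assumption?)?)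
       (simp_all add: s lfun_ltcoef lfun_ltder finite_ltcoef ltcoef_trace ltcoef_ad ltder_bracket
         lt_brackets ltcoef_values der_values)
qed

lemma lth_diagonal:
  "\<exists>w. \<forall>b. ltilde_bracket (s\<^sup>2) lth (bvec b) = scl (w b) (bvec b)"
proof -
  have lin: "clinear (ltilde_bracket (s\<^sup>2) lth)" using lt_br_linear(1) s by simp
  have "\<exists>z. ltilde_bracket (s\<^sup>2) lth (bvec b) = scl z (bvec b)" for b
  proof -
    have *: "\<exists>z. ltilde_bracket (s\<^sup>2) lth (scl m x) = scl z (scl m x)"
      if "ltilde_bracket (s\<^sup>2) lth x = scl z' x" for m x z'
      using that by (auto simp: clinear_scl[OF lin] scl_scl mult.commute)
    show ?thesis
    proof (cases b)
      case (Be m) show ?thesis unfolding Be bvec_spanning by (rule *[OF lt_brackets(11)])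
    next
      case (Bf m) show ?thesis unfolding Bf bvec_spanning by (rule *[OF lt_brackets(12)])
    next
      case Bd show ?thesis unfolding Bd bvec_spanning by (rule *[OF lt_brackets(13)])
    next
      case (Bg m) show ?thesis unfolding Bg bvec_spanning by (rule *[OF lt_brackets(13)])
    next
      case (Bh m) show ?thesis unfolding Bh bvec_spanning by (rule *[OF lt_brackets(14)])
    next
      case Bd1 show ?thesis unfolding Bd1 lt_brackets(15) by (intro exI[of _ 0]) simp
    next
      case Bd2 show ?thesis unfolding Bd2 lt_brackets(16) by (intro exI[of _ 0]) simp
    qed
  qed
  then show ?thesis by metis
qed

end

theorem theorem1p1:
  fixes q :: complex
    and \<Delta> :: "ltilde \<Rightarrow> (ltilde_basis \<times> ltilde_basis \<Rightarrow>\<^sub>0 complex)"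
  assumes "q \<noteq> 0"
    and "\<forall>n::nat. n > 0 \<longrightarrow> q ^ n \<noteq> 1"
    and "lie_bialgebra (ltilde_bracket q) \<Delta>"
  shows "triangular_coboundary (ltilde_bracket q) \<Delta>"
proof -
  define s where "s = csqrt q"
  have q: "q = s\<^sup>2" by (simp add: s_def)
  have s: "s \<noteq> 0" using assms(1) by (simp add: q)
  have root: "s ^ n \<noteq> 1" if "n > 0" for n :: nat
  proof
    assume "s ^ n = 1"
    then have "q ^ n = 1" by (simp add: q power_mult[symmetric] mult.commute[of 2] power_mult)
    then show False using assms(2) that by simp
  qed
  interpret torus_sl2 "ltilde_bracket q" "ltE s" "ltF s" "ltG s" "ltH s" "bvec Bd1" "bvec Bd2" lth
     "ltcoef s 1 2" "ltcoef s 2 1" "ltcoef s 1 1" "ltcoef s 2 2" ltder1 ltder2 s "1/10"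
    unfolding q by (rule torus_sl2_ltilde[OF s root])
  obtain w where w: "\<And>b. ltilde_bracket q lth (bvec b) = scl (w b) (bvec b)"
    using lth_diagonal[OF s] unfolding q by blast
  note bialg = assms(3)[unfolded lie_bialgebra_def]
  have \<Delta>: "skew_cocycle (ltilde_bracket q) \<Delta>"
    using bialg by (auto simp: skew_cocycle_def skew_iff_range)
  obtain r0 where r0: "skew r0" "\<Delta> lth = adj_act (ltilde_bracket q) lth r0"
    by (rule skew_cocycle_kill_diagonal[OF lie w no_invariants_adj \<Delta>])
  have "hcocycle (\<lambda>x. \<Delta> x - adj_act (ltilde_bracket q) x r0)"
    using skew_cocycle_sub_inner[OF lie \<Delta> r0(1)] r0(2) by (simp add: hcocycle_def)
  then obtain r1 where r1: "skew r1"
    "\<And>x. \<Delta> x - adj_act (ltilde_bracket q) x r0 = adj_act (ltilde_bracket q) x r1"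
    by (rule hcocycle_inner) (rule that)
  define r where "r = r0 + r1"
  have r: "skew r" unfolding r_def by (rule skew_add[OF r0(1) r1(1)])
  have \<Delta>r: "\<Delta> x = adj_act (ltilde_bracket q) x r" for x
    using r1(2)[of x] by (simp add: r_def clinear_add[OF clinear_adj_act] algebra_simps)
  have inv: "tens_act (ltilde_bracket q x) (adj_act (ltilde_bracket q) x) (cyb (ltilde_bracket q) r) = 0" for x
  proof -
    have "(let u = tens_map id \<Delta> (\<Delta> x) in u + rot u + rot (rot u)) = 0"
      using bialg[THEN conjunct2, THEN conjunct2, THEN conjunct2, THEN conjunct1, THEN spec, of x]
      by (simp only: Let_def)
    then show ?thesis by (simp only: cojacobi_coboundary[OF lie r \<Delta>r])
  qed
  have "cyb (ltilde_bracket q) r = 0"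
    \<comment> \<open>The cube is regarded as the algebra tensored with its tensor square, on which
      the adjoint action is diagonal.\<close>
    by (rule no_invariants[of "adj_act (ltilde_bracket q)", OF clinear_adj_act inv inv])
  then show ?thesis
    unfolding triangular_coboundary_def using r[unfolded skew_iff_range] \<Delta>r by blast
qed

end
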